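(* Let $G$ be a pseudo-outerplanar graph with $\Delta(G)\geq 4$. Then $\chi'(G)=\Delta(G)$.
   Context: All graphs are finite, simple and undirected. A block is a maximal 2-connected subgraph; bridges are blocks too. A graph is pseudo-outerplanar if each of its blocks can be drawn in the plane so that its vertices lie on a fixed circle, its edges lie inside the disk bounded by that circle, and each edge crosses at most one other edge. $\Delta(G)$ is the maximum degree of $G$. $\chi'(G)$ is the edge chromatic number: the minimum number of matchings into which $E(G)$ can be partitioned. *)

theory Defs
  imports "HOL-Analysis.Analysis" "HOL-Library.Disjoint_Sets"
begin

definition simple_graph :: "'a set \<Rightarrow> 'a set set \<Rightarrow> bool" where
  "simple_graph V E \<longleftrightarrow> finite V \<and> (\<forall>e\<in>E. e \<subseteq> V \<and> card e = 2)"

definition subgraph :: "'a set \<Rightarrow> 'a set set \<Rightarrow> 'a set \<Rightarrow> 'a set set \<Rightarrow> bool" where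
  "subgraph W F V E \<longleftrightarrow> simple_graph W F \<and> W \<subseteq> V \<and> F \<subseteq> E"

definition vdegree :: "'a set set \<Rightarrow> 'a \<Rightarrow> nat" where
  "vdegree E v = card {e \<in> E. v \<in> e}"

text \<open>Inserting \<open>0\<close> only matters for the graph without vertices, where \<open>Max {}\<close> is unspecified.\<close>

definition max_degree :: "'a set \<Rightarrow> 'a set set \<Rightarrow> nat" where
  "max_degree V E = Max (insert 0 (vdegree E ` V))"

definition matching :: "'a set set \<Rightarrow> 'a set set \<Rightarrow> bool" where
  "matching E M \<longleftrightarrow> M \<subseteq> E \<and> disjoint M"

definition chromatic_index :: "'a set set \<Rightarrow> nat" where
  "chromatic_index E =
    (LEAST k. \<exists>P. partition_on E P \<and> finite P \<and> card P = k \<and> (\<forall>M\<in>P. matching E M))"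

definition adj :: "'a set set \<Rightarrow> ('a \<times> 'a) set" where
  "adj E = {(u, v). {u, v} \<in> E}"

definition graph_connected :: "'a set \<Rightarrow> 'a set set \<Rightarrow> bool" where
  "graph_connected V E \<longleftrightarrow> V \<noteq> {} \<and> (\<forall>u\<in>V. \<forall>v\<in>V. (u, v) \<in> (adj E)\<^sup>*)"

definition two_connected :: "'a set \<Rightarrow> 'a set set \<Rightarrow> bool" where
  "two_connected V E \<longleftrightarrow> card V \<ge> 3 \<and> graph_connected V E \<and>
    (\<forall>v\<in>V. graph_connected (V - {v}) {e \<in> E. v \<notin> e})"

definition bridge :: "'a set set \<Rightarrow> 'a set \<Rightarrow> bool" where
  "bridge E e \<longleftrightarrow> e \<in> E \<and> (\<exists>u v. e = {u, v} \<and> (u, v) \<notin> (adj (E - {e}))\<^sup>*)"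

text \<open>The second alternative is the subgraph formed by a bridge and its two ends. Isolated vertices
  are not counted as blocks; they could be drawn trivially anyway.\<close>

definition block :: "'a set \<Rightarrow> 'a set set \<Rightarrow> 'a set \<Rightarrow> 'a set set \<Rightarrow> bool" where
  "block V E W F \<longleftrightarrow>
    (subgraph W F V E \<and> two_connected W F \<and>
      (\<forall>W' F'. subgraph W' F' V E \<and> two_connected W' F' \<and> W \<subseteq> W' \<and> F \<subseteq> F'
        \<longrightarrow> W' = W \<and> F' = F))
    \<or> (\<exists>e. bridge E e \<and> W = e \<and> F = {e})"

text \<open>A drawing of the graph \<open>(W, F)\<close>: the vertex \<open>v\<close> is the point \<open>p v\<close> of the circle with centre
  \<open>c\<close> and radius \<open>r\<close>, and the edge \<open>e\<close> is the (not necessarily straight) simple arc \<open>g e\<close> in the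
  closed disk, which meets the vertices exactly in its two ends.\<close>

definition circle_drawing ::
    "real^2 \<Rightarrow> real \<Rightarrow> ('a \<Rightarrow> real^2) \<Rightarrow> ('a set \<Rightarrow> real \<Rightarrow> real^2) \<Rightarrow> 'a set \<Rightarrow> 'a set set \<Rightarrow> bool" where
  "circle_drawing c r p g W F \<longleftrightarrow>
    r > 0 \<and> inj_on p W \<and> p ` W \<subseteq> sphere c r \<and>
    (\<forall>e\<in>F. arc (g e) \<and> {pathstart (g e), pathfinish (g e)} = p ` e \<and>
      path_image (g e) \<subseteq> cball c r \<and> path_image (g e) \<inter> p ` W = p ` e)"

text \<open>Two edges cross if they have a common point other than a common end. Adjacent edges may cross,
  two edges may meet repeatedly, and touching counts as crossing.\<close>

definition crosses ::
    "('a \<Rightarrow> real^2) \<Rightarrow> ('a set \<Rightarrow> real \<Rightarrow> real^2) \<Rightarrow> 'a set \<Rightarrow> 'a set \<Rightarrow> bool" where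
  "crosses p g e f \<longleftrightarrow> e \<noteq> f \<and> (path_image (g e) \<inter> path_image (g f)) - p ` (e \<inter> f) \<noteq> {}"

definition pseudo_outerplanar :: "'a set \<Rightarrow> 'a set set \<Rightarrow> bool" where
  "pseudo_outerplanar V E \<longleftrightarrow>
    (\<forall>W F. block V E W F \<longrightarrow>
      (\<exists>c r p g. circle_drawing c r p g W F \<and>
        (\<forall>e\<in>F. card {f \<in> F. crosses p g e f} \<le> 1)))"

end

(*
  Fix k >= 4. Put the vertices of a block on a line by stereographic projection of the circle. By the
  Fashoda theorem, edges whose ends alternate on the line must cross, so every edge alternates with at
  most one other edge. Such a graph of maximum degree at most k is k-edge-colourable. In a
  counterexample with the fewest edges, adjacent vertices have degree sum at least k + 2. Take a
  shortest interval with at least two inner vertices such that no edge leads from its interior to the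
  outside; each such interval inside it then has at most one inner vertex, which has degree 2 and
  whose neighbours have degree k. This leaves two shapes for the interval: two such vertices around a
  common neighbour, or a pair of crossing edges with at most three degree-2 vertices around it. In
  almost all cases k <= 5 and any colouring of the rest extends, whatever colours are missing at the
  two ends of the interval. In the other cases one first replaces the interval by a triangle, or
  contracts it to a point, to control these colours. Blocks are glued by permuting colours at a cut vertex.
*)
theory Submission
  imports Defs
begin

subsection \<open>Colourings and palettes\<close>

text \<open>The replacements dictate the form of the induction. A triangle put in place of an
  interval, or a contracted interval, is not a subgraph of the given graph. Thinness, that is,
  interleaving with at most one other edge, survives both operations and speaks only of edge sets on
  an ordered vertex type; and \<open>k\<close> stays fixed, so that the maximum degree may drop. The
  obstacle behind the replacements occurs for \<open>k = 4\<close>, when two inner vertices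
  \<open>b\<close>, \<open>c\<close> are joined to each other and to both ends \<open>u\<close>,
  \<open>v\<close>. The rest may use two colours at each end. If these pairs are disjoint, the edges
  from \<open>u\<close> and \<open>v\<close> to \<open>b\<close> and \<open>c\<close> take all four
  colours and \<open>bc\<close> gets none. If they are equal and \<open>b\<close>, \<open>c\<close>
  have a further common neighbour of degree 2, two colours remain for a triangle. So the rest must
  be coloured with pairs that share exactly one colour. The bound \<open>k <= 5\<close> arises
  because a degree-2 vertex beside \<open>b\<close> or \<open>c\<close> forces degree
  \<open>k\<close> there, while the interval offers at most five candidates for a neighbour.\<close>

definition proper_colouring :: "nat \<Rightarrow> 'a set set \<Rightarrow> ('a set \<Rightarrow> nat) \<Rightarrow> bool" where
  "proper_colouring k E c \<longleftrightarrow>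
    (\<forall>e\<in>E. c e < k) \<and> (\<forall>e\<in>E. \<forall>f\<in>E. e \<noteq> f \<longrightarrow> e \<inter> f \<noteq> {} \<longrightarrow> c e \<noteq> c f)"

lemma proper_colouringD:
  assumes "proper_colouring k E c" "e \<in> E"
  shows "c e < k" and "f \<in> E \<Longrightarrow> e \<noteq> f \<Longrightarrow> e \<inter> f \<noteq> {} \<Longrightarrow> c e \<noteq> c f"
  using assms unfolding proper_colouring_def by blast+

definition colourable :: "nat \<Rightarrow> 'a set set \<Rightarrow> bool" where
  "colourable k E \<longleftrightarrow> (\<exists>c. proper_colouring k E c)"

text \<open>\<open>U w\<close> is only an upper bound for the set of colours seen by \<open>w\<close>, so it may be enlarged freely.\<close>

definition coloured_within :: "nat \<Rightarrow> 'a set set \<Rightarrow> ('a \<Rightarrow> nat set) \<Rightarrow> bool" where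
  "coloured_within k E U \<longleftrightarrow>
    (\<exists>c. proper_colouring k E c \<and> (\<forall>e\<in>E. \<forall>w\<in>e. c e \<in> U w))"

lemma coloured_within_colourable: "coloured_within k E U \<Longrightarrow> colourable k E"
  unfolding coloured_within_def colourable_def by blast

lemma coloured_within_mono:
  assumes "coloured_within k E U" "\<And>w. w \<in> \<Union>E \<Longrightarrow> U w \<subseteq> U' w"
  shows "coloured_within k E U'"
  using assms unfolding coloured_within_def by (meson UnionI subsetD)

lemma proper_colouring_subset: "proper_colouring k E c \<Longrightarrow> F \<subseteq> E \<Longrightarrow> proper_colouring k F c"
  unfolding proper_colouring_def by (meson subsetD)

lemma colourable_subset: "colourable k E \<Longrightarrow> F \<subseteq> E \<Longrightarrow> colourable k F"
  unfolding colourable_def using proper_colouring_subset by blast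

text \<open>A new edge differs from all edges it meets because \<open>i\<close> lies outside the
  bounds at both ends. An edge that is already present keeps its colour and only the bounds grow, so
  insertions need no check for freshness.\<close>

lemma coloured_within_insert:
  assumes "coloured_within k E U" "i < k" "i \<notin> U x" "i \<notin> U y"
  shows "coloured_within k (insert {x, y} E) (U(x := insert i (U x), y := insert i (U y)))"
proof (cases "{x, y} \<in> E")
  case True
  then have "insert {x, y} E = E" by blast
  moreover have "coloured_within k E (U(x := insert i (U x), y := insert i (U y)))"
    by (rule coloured_within_mono[OF assms(1)]) auto
  ultimately show ?thesis by simp
next
  case False
  obtain c where c: "proper_colouring k E c" "\<forall>e\<in>E. \<forall>w\<in>e. c e \<in> U w"
    using assms(1) unfolding coloured_within_def by blast
  let ?c = "c({x, y} := i)"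
  have old: "?c e = c e" if "e \<in> E" for e using that False by auto
  have fresh: "c e \<noteq> i" if "e \<in> E" "e \<inter> {x, y} \<noteq> {}" for e
    using that c(2) assms(3,4) by auto
  have new: "?c {x, y} = i" by simp
  have "proper_colouring k (insert {x, y} E) ?c"
    unfolding proper_colouring_def
  proof (intro conjI ballI impI)
    fix e assume "e \<in> insert {x, y} E"
    then show "?c e < k"
      using c(1) old new assms(2) unfolding proper_colouring_def by force
  next
    fix e f assume "e \<in> insert {x, y} E" "f \<in> insert {x, y} E" "e \<noteq> f" "e \<inter> f \<noteq> {}"
    then consider "e \<in> E" "f \<in> E" | "e = {x, y}" "f \<in> E" | "e \<in> E" "f = {x, y}" by blast
    then show "?c e \<noteq> ?c f"
    proof cases
      case 1
      then show ?thesis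
        using c(1) old \<open>e \<noteq> f\<close> \<open>e \<inter> f \<noteq> {}\<close> unfolding proper_colouring_def by force
    next
      case 2
      then show ?thesis using fresh[of f] old[of f] new \<open>e \<inter> f \<noteq> {}\<close> by (metis Int_commute)
    next
      case 3
      then show ?thesis using fresh[of e] old[of e] new \<open>e \<inter> f \<noteq> {}\<close> by metis
    qed
  qed
  moreover have "\<forall>e\<in>insert {x, y} E. \<forall>w\<in>e. ?c e \<in> (U(x := insert i (U x), y := insert i (U y))) w"
    using c(2) old new by auto
  ultimately show ?thesis unfolding coloured_within_def by blast
qed

text \<open>A certificate for colouring further edges one at a time: each triple names an edge and
  its colour. Simplification decides it once the disequalities between vertices and between colours
  are supplied, so a gadget is settled by writing down a table.\<close>

fun extends :: "nat \<Rightarrow> ('a \<Rightarrow> nat set) \<Rightarrow> ('a \<times> 'a \<times> nat) list \<Rightarrow> bool" where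
  "extends k U [] = True"
| "extends k U ((x, y, i) # es) \<longleftrightarrow> i < k \<and> i \<notin> U x \<and> i \<notin> U y \<and>
    extends k (U(x := insert i (U x), y := insert i (U y))) es"

text \<open>The list may name edges missing from \<open>F\<close>, since colourability passes to
  subsets.\<close>

lemma colourable_extends:
  assumes "coloured_within k E U" "extends k U es"
    and "F \<subseteq> E \<union> (\<lambda>(x, y, i). {x, y}) ` set es"
  shows "colourable k F"
proof -
  have "colourable k (E \<union> (\<lambda>(x, y, i). {x, y}) ` set es)"
    using assms(1,2)
  proof (induction es arbitrary: E U)
    case Nil
    then show ?case by (simp add: coloured_within_colourable)
  next
    case (Cons a es)
    obtain x y i where a: "a = (x, y, i)" by (cases a) auto
    have "coloured_within k (insert {x, y} E) (U(x := insert i (U x), y := insert i (U y)))"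
      using Cons.prems a by (intro coloured_within_insert) auto
    moreover have "extends k (U(x := insert i (U x), y := insert i (U y))) es"
      using Cons.prems(2) a by simp
    ultimately have "colourable k (insert {x, y} E \<union> (\<lambda>(x, y, i). {x, y}) ` set es)"
      by (rule Cons.IH)
    then show ?case using a by simp
  qed
  then show ?thesis using assms(3) colourable_subset by blast
qed

lemma coloured_within_palettes:
  assumes "colourable k E" "finite E"
  obtains U where "coloured_within k E U" "\<And>w. U w \<subseteq> {..<k}" "\<And>w. card (U w) \<le> vdegree E w"
proof -
  obtain c where c: "proper_colouring k E c" using assms(1) unfolding colourable_def by blast
  let ?U = "\<lambda>w. c ` {e \<in> E. w \<in> e}"
  have "coloured_within k E ?U" unfolding coloured_within_def using c by blast
  moreover have "?U w \<subseteq> {..<k}" for w using c unfolding proper_colouring_def by auto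
  moreover have "card (?U w) \<le> vdegree E w" for w
    unfolding vdegree_def using assms(2) by (simp add: card_image_le)
  ultimately show ?thesis using that by blast
qed

section \<open>Relative position of two sets of colours\<close>

text \<open>The four lists are the regions of a Venn diagram: both, only the first, only the second,
  neither. After padding \<open>A\<close> and \<open>B\<close> to exactly \<open>a\<close> and
  \<open>b\<close> colours, the size of the overlap is the only parameter up to renaming colours;
  hence one disjunct per overlap in the special cases that follow.\<close>

lemma palettes_enumeration:
  fixes A B :: "nat set"
  assumes "A \<subseteq> {..<k}" "B \<subseteq> {..<k}" "card A \<le> a" "card B \<le> b" "a \<le> k" "b \<le> k"
  obtains l1 l2 l3 l4 where "distinct (l1 @ l2 @ l3 @ l4)" "set (l1 @ l2 @ l3 @ l4) = {..<k}"
    "A \<subseteq> set (l1 @ l2)" "B \<subseteq> set (l1 @ l3)" "length l1 + length l2 = a" "length l1 + length l3 = b"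
    "length l1 + length l2 + length l3 + length l4 = k"
proof -
  obtain A' where A': "A \<subseteq> A'" "A' \<subseteq> {..<k}" "card A' = a"
    using exists_subset_between[of A a "{..<k}"] assms by auto
  obtain B' where B': "B \<subseteq> B'" "B' \<subseteq> {..<k}" "card B' = b"
    using exists_subset_between[of B b "{..<k}"] assms by auto
  have fin: "finite A'" "finite B'" using A' B' finite_subset by blast+
  define l1 l2 l3 l4 where "l1 = sorted_list_of_set (A' \<inter> B')" and "l2 = sorted_list_of_set (A' - B')"
    and "l3 = sorted_list_of_set (B' - A')" and "l4 = sorted_list_of_set ({..<k} - (A' \<union> B'))"
  have s: "set l1 = A' \<inter> B'" "set l2 = A' - B'" "set l3 = B' - A'" "set l4 = {..<k} - (A' \<union> B')"
    unfolding l1_def l2_def l3_def l4_def using fin by auto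
  have d: "distinct l1" "distinct l2" "distinct l3" "distinct l4"
    unfolding l1_def l2_def l3_def l4_def by simp_all
  have dd: "distinct (l1 @ l2 @ l3 @ l4)" using s d by auto
  have ss: "set (l1 @ l2 @ l3 @ l4) = {..<k}" using s A' B' by auto
  have "set (l1 @ l2) = A'" "set (l1 @ l3) = B'" using s by auto
  moreover have "distinct (l1 @ l2)" "distinct (l1 @ l3)" using dd by auto
  ultimately have "length (l1 @ l2) = a" "length (l1 @ l3) = b"
    using A'(3) B'(3) distinct_card by metis+
  moreover have "length (l1 @ l2 @ l3 @ l4) = k" using distinct_card[OF dd] ss by simp
  ultimately show ?thesis
    using that[of l1 l2 l3 l4] dd ss A'(1) B'(1) \<open>set (l1 @ l2) = A'\<close> \<open>set (l1 @ l3) = B'\<close> by simp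
qed

lemma palettes_22_of_4:
  fixes A B :: "nat set"
  assumes "A \<subseteq> {..<4}" "B \<subseteq> {..<4}" "card A \<le> 2" "card B \<le> 2"
  obtains p q r s where "distinct [p, q, r, s]" "{p, q, r, s} = {..<4}" "A \<subseteq> {p, q}"
    "B \<subseteq> {p, q} \<or> B \<subseteq> {p, r} \<or> B \<subseteq> {r, s}"
proof -
  have le: "2 \<le> (4::nat)" "2 \<le> (4::nat)" by simp_all
  obtain l1 l2 l3 l4 where l: "distinct (l1 @ l2 @ l3 @ l4)" "set (l1 @ l2 @ l3 @ l4) = {..<4}"
    "A \<subseteq> set (l1 @ l2)" "B \<subseteq> set (l1 @ l3)"
    and len: "length l1 + length l2 = 2" "length l1 + length l3 = 2"
      "length l1 + length l2 + length l3 + length l4 = 4"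
    by (rule palettes_enumeration[OF assms le])
  consider "length l1 = 2" "length l2 = 0" "length l3 = 0" "length l4 = 2" | "length l1 = 1" "length l2 = 1" "length l3 = 1" "length l4 = 1" | "length l1 = 0" "length l2 = 2" "length l3 = 2" "length l4 = 0"
    using len by linarith
  then show ?thesis
  proof cases
    case 1
    then obtain p q r s where "l1 = [p, q]" "l2 = []" "l3 = []" "l4 = [r, s]"
      by (auto simp: length_Suc_conv eval_nat_numeral)
    with l that[of p q r s] show ?thesis by simp
  next
    case 2
    then obtain p q r s where "l1 = [p]" "l2 = [q]" "l3 = [r]" "l4 = [s]"
      by (auto simp: length_Suc_conv eval_nat_numeral)
    with l that[of p q r s] show ?thesis by simp
  next
    case 3
    then obtain p q r s where "l1 = []" "l2 = [p, q]" "l3 = [r, s]" "l4 = []"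
      by (auto simp: length_Suc_conv eval_nat_numeral)
    with l that[of p q r s] show ?thesis by simp
  qed
qed

lemma palettes_11_of_4:
  fixes A B :: "nat set"
  assumes "A \<subseteq> {..<4}" "B \<subseteq> {..<4}" "card A \<le> 1" "card B \<le> 1"
  obtains p q r s where "distinct [p, q, r, s]" "{p, q, r, s} = {..<4}" "A \<subseteq> {p}"
    "B \<subseteq> {p} \<or> B \<subseteq> {q}"
proof -
  have le: "1 \<le> (4::nat)" "1 \<le> (4::nat)" by simp_all
  obtain l1 l2 l3 l4 where l: "distinct (l1 @ l2 @ l3 @ l4)" "set (l1 @ l2 @ l3 @ l4) = {..<4}"
    "A \<subseteq> set (l1 @ l2)" "B \<subseteq> set (l1 @ l3)"
    and len: "length l1 + length l2 = 1" "length l1 + length l3 = 1"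
      "length l1 + length l2 + length l3 + length l4 = 4"
    by (rule palettes_enumeration[OF assms le])
  consider "length l1 = 1" "length l2 = 0" "length l3 = 0" "length l4 = 3" | "length l1 = 0" "length l2 = 1" "length l3 = 1" "length l4 = 2"
    using len by linarith
  then show ?thesis
  proof cases
    case 1
    then obtain p q r s where "l1 = [p]" "l2 = []" "l3 = []" "l4 = [q, r, s]"
      by (auto simp: length_Suc_conv eval_nat_numeral)
    with l that[of p q r s] show ?thesis by simp
  next
    case 2
    then obtain p q r s where "l1 = []" "l2 = [p]" "l3 = [q]" "l4 = [r, s]"
      by (auto simp: length_Suc_conv eval_nat_numeral)
    with l that[of p q r s] show ?thesis by simp
  qed
qed

lemma palettes_12_of_4:
  fixes A B :: "nat set"
  assumes "A \<subseteq> {..<4}" "B \<subseteq> {..<4}" "card A \<le> 1" "card B \<le> 2"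
  obtains p q r s where "distinct [p, q, r, s]" "{p, q, r, s} = {..<4}" "A \<subseteq> {p}"
    "B \<subseteq> {p, q} \<or> B \<subseteq> {q, r}"
proof -
  have le: "1 \<le> (4::nat)" "2 \<le> (4::nat)" by simp_all
  obtain l1 l2 l3 l4 where l: "distinct (l1 @ l2 @ l3 @ l4)" "set (l1 @ l2 @ l3 @ l4) = {..<4}"
    "A \<subseteq> set (l1 @ l2)" "B \<subseteq> set (l1 @ l3)"
    and len: "length l1 + length l2 = 1" "length l1 + length l3 = 2"
      "length l1 + length l2 + length l3 + length l4 = 4"
    by (rule palettes_enumeration[OF assms le])
  consider "length l1 = 1" "length l2 = 0" "length l3 = 1" "length l4 = 2" | "length l1 = 0" "length l2 = 1" "length l3 = 2" "length l4 = 1"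
    using len by linarith
  then show ?thesis
  proof cases
    case 1
    then obtain p q r s where "l1 = [p]" "l2 = []" "l3 = [q]" "l4 = [r, s]"
      by (auto simp: length_Suc_conv eval_nat_numeral)
    with l that[of p q r s] show ?thesis by simp
  next
    case 2
    then obtain p q r s where "l1 = []" "l2 = [p]" "l3 = [q, r]" "l4 = [s]"
      by (auto simp: length_Suc_conv eval_nat_numeral)
    with l that[of p q r s] show ?thesis by simp
  qed
qed

lemma palettes_13_of_4:
  fixes A B :: "nat set"
  assumes "A \<subseteq> {..<4}" "B \<subseteq> {..<4}" "card A \<le> 1" "card B \<le> 3"
  obtains p q r s where "distinct [p, q, r, s]" "{p, q, r, s} = {..<4}" "A \<subseteq> {p}"
    "B \<subseteq> {p, q, r} \<or> B \<subseteq> {q, r, s}"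
proof -
  have le: "1 \<le> (4::nat)" "3 \<le> (4::nat)" by simp_all
  obtain l1 l2 l3 l4 where l: "distinct (l1 @ l2 @ l3 @ l4)" "set (l1 @ l2 @ l3 @ l4) = {..<4}"
    "A \<subseteq> set (l1 @ l2)" "B \<subseteq> set (l1 @ l3)"
    and len: "length l1 + length l2 = 1" "length l1 + length l3 = 3"
      "length l1 + length l2 + length l3 + length l4 = 4"
    by (rule palettes_enumeration[OF assms le])
  consider "length l1 = 1" "length l2 = 0" "length l3 = 2" "length l4 = 1" | "length l1 = 0" "length l2 = 1" "length l3 = 3" "length l4 = 0"
    using len by linarith
  then show ?thesis
  proof cases
    case 1
    then obtain p q r s where "l1 = [p]" "l2 = []" "l3 = [q, r]" "l4 = [s]"
      by (auto simp: length_Suc_conv eval_nat_numeral)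
    with l that[of p q r s] show ?thesis by simp
  next
    case 2
    then obtain p q r s where "l1 = []" "l2 = [p]" "l3 = [q, r, s]" "l4 = []"
      by (auto simp: length_Suc_conv eval_nat_numeral)
    with l that[of p q r s] show ?thesis by simp
  qed
qed

lemma palettes_22_of_5:
  fixes A B :: "nat set"
  assumes "A \<subseteq> {..<5}" "B \<subseteq> {..<5}" "card A \<le> 2" "card B \<le> 2"
  obtains p q r s t where "distinct [p, q, r, s, t]" "{p, q, r, s, t} = {..<5}" "A \<subseteq> {p, q}"
    "B \<subseteq> {p, q} \<or> B \<subseteq> {p, r} \<or> B \<subseteq> {r, s}"
proof -
  have le: "2 \<le> (5::nat)" "2 \<le> (5::nat)" by simp_all
  obtain l1 l2 l3 l4 where l: "distinct (l1 @ l2 @ l3 @ l4)" "set (l1 @ l2 @ l3 @ l4) = {..<5}"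
    "A \<subseteq> set (l1 @ l2)" "B \<subseteq> set (l1 @ l3)"
    and len: "length l1 + length l2 = 2" "length l1 + length l3 = 2"
      "length l1 + length l2 + length l3 + length l4 = 5"
    by (rule palettes_enumeration[OF assms le])
  consider "length l1 = 2" "length l2 = 0" "length l3 = 0" "length l4 = 3" | "length l1 = 1" "length l2 = 1" "length l3 = 1" "length l4 = 2" | "length l1 = 0" "length l2 = 2" "length l3 = 2" "length l4 = 1"
    using len by linarith
  then show ?thesis
  proof cases
    case 1
    then obtain p q r s t where "l1 = [p, q]" "l2 = []" "l3 = []" "l4 = [r, s, t]"
      by (auto simp: length_Suc_conv eval_nat_numeral)
    with l that[of p q r s t] show ?thesis by simp
  next
    case 2
    then obtain p q r s t where "l1 = [p]" "l2 = [q]" "l3 = [r]" "l4 = [s, t]"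
      by (auto simp: length_Suc_conv eval_nat_numeral)
    with l that[of p q r s t] show ?thesis by simp
  next
    case 3
    then obtain p q r s t where "l1 = []" "l2 = [p, q]" "l3 = [r, s]" "l4 = [t]"
      by (auto simp: length_Suc_conv eval_nat_numeral)
    with l that[of p q r s t] show ?thesis by simp
  qed
qed

subsection \<open>Gadgets with two attachment vertices\<close>

text \<open>The vertices of \<open>S\<close> see no colour yet because \<open>E\<close> avoids them.
  \<open>UNIV\<close> at all vertices other than \<open>u\<close>, \<open>v\<close> and those of
  \<open>S\<close> is a trivially valid bound, under which any table that touches them
  fails.\<close>

lemma colourable_gadget:
  assumes "coloured_within k E U" "U u \<subseteq> A" "U v \<subseteq> B" "S \<inter> \<Union>E = {}"
    and "extends k (\<lambda>w. if w \<in> S then {} else if w = u then A else if w = v then B else UNIV) es"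
    and "F \<subseteq> E \<union> (\<lambda>(x, y, i). {x, y}) ` set es"
  shows "colourable k F"
proof (rule colourable_extends[OF _ assms(5,6)])
  show "coloured_within k E (\<lambda>w. if w \<in> S then {} else if w = u then A else if w = v then B else UNIV)"
    using assms(2-4) by (intro coloured_within_mono[OF assms(1)]) auto
qed

text \<open>The common neighbour \<open>w\<close> has the degree-2 vertices \<open>x\<close> and
  \<open>y\<close> on its two sides. Every overlap of the pairs seen at \<open>u\<close> and
  \<open>v\<close> has a table here, in contrast to \<open>colourable_K4\<close>.\<close>

lemma colourable_path:
  assumes "coloured_within 4 E U" "U u \<subseteq> {..<4}" "U v \<subseteq> {..<4}" "card (U u) \<le> 2" "card (U v) \<le> 2"
    and "distinct [u, v, x, w, y]" "{x, w, y} \<inter> \<Union>E = {}"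
    and "F \<subseteq> E \<union> {{u, x}, {u, w}, {v, y}, {v, w}, {w, x}, {w, y}}"
  shows "colourable 4 F"
proof -
  obtain p q r s where c: "distinct [p, q, r, s]" "{p, q, r, s} = {..<4}"
    and A: "U u \<subseteq> {p, q}" and B: "U v \<subseteq> {p, q} \<or> U v \<subseteq> {p, r} \<or> U v \<subseteq> {r, s}"
    by (rule palettes_22_of_4[OF assms(2-5)])
  have lt: "p < 4" "q < 4" "r < 4" "s < 4" using c(2) by blast+
  \<comment> \<open>The reversed lists supply each disequality in the other orientation; the
    simplifier needs both to evaluate a table.\<close>
  have neq: "distinct [s, r, q, p]" "distinct [y, w, x, v, u]"
    using c(1) assms(6) by auto
  note neq = c(1)[simplified] neq[simplified] assms(6)[simplified] lt
  note gadget = colourable_gadget[OF assms(1) A _ assms(7)]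
  from B show ?thesis
  proof (elim disjE)
    assume "U v \<subseteq> {p, q}"
    from gadget[OF this, where es = "[(u, x, r), (u, w, s), (v, y, s), (v, w, r), (w, x, p), (w, y, q)]"]
    show ?thesis using assms(8) by (simp add: neq)
  next
    assume "U v \<subseteq> {p, r}"
    from gadget[OF this, where es = "[(u, x, r), (u, w, s), (v, y, s), (v, w, q), (w, x, p), (w, y, r)]"]
    show ?thesis using assms(8) by (simp add: neq)
  next
    assume "U v \<subseteq> {r, s}"
    from gadget[OF this, where es = "[(u, x, r), (u, w, s), (v, y, p), (v, w, q), (w, x, p), (w, y, r)]"]
    show ?thesis using assms(8) by (simp add: neq)
  qed
qed

text \<open>Names in this family tell which degree-2 vertices are present: \<open>left\<close>
  between \<open>u\<close> and \<open>b\<close>, \<open>mid\<close> between \<open>b\<close> and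
  \<open>c\<close>, \<open>right\<close> between \<open>c\<close> and \<open>v\<close>,
  \<open>all\<close> for the three together. In \<open>open\<close> the edge \<open>cv\<close> is
  missing, in \<open>inner\<close> the edges \<open>ub\<close> and \<open>cv\<close>, in
  \<open>outer\<close> the edge \<open>bc\<close>.\<close>

lemma colourable_K4:
  assumes "coloured_within 4 E U" "U u \<subseteq> {p, q}" "U v \<subseteq> {p, r}"
    and "distinct [p, q, r, s]" "{p, q, r, s} = {..<4}"
    and "distinct [u, v, b, c]" "{b, c} \<inter> \<Union>E = {}"
    and "F \<subseteq> E \<union> {{u, b}, {u, c}, {b, v}, {c, v}, {b, c}}"
  shows "colourable 4 F"
proof -
  note A = assms(2) and B = assms(3) and c = assms(4,5)
  have lt: "p < 4" "q < 4" "r < 4" "s < 4" using c(2) by blast+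
  have neq: "distinct [s, r, q, p]" "distinct [c, b, v, u]"
    using c(1) assms(6) by auto
  note neq = c(1)[simplified] neq[simplified] assms(6)[simplified] lt
  note gadget = colourable_gadget[OF assms(1) A _ assms(7)]
  from gadget[OF B, where es = "[(u, b, r), (u, c, s), (b, v, s), (c, v, q), (b, c, p)]"]
  show ?thesis using assms(8) by (simp add: neq)
qed

lemma colourable_K4_mid:
  assumes "coloured_within 4 E U" "U u \<subseteq> {p, q}" "U v \<subseteq> {p, r}"
    and "distinct [p, q, r, s]" "{p, q, r, s} = {..<4}"
    and "distinct [u, v, b, c, x]" "{b, c, x} \<inter> \<Union>E = {}"
    and "F \<subseteq> E \<union> {{u, b}, {u, c}, {b, v}, {c, v}, {b, c}, {b, x}, {c, x}}"
  shows "colourable 4 F"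
proof -
  note A = assms(2) and B = assms(3) and c = assms(4,5)
  have lt: "p < 4" "q < 4" "r < 4" "s < 4" using c(2) by blast+
  have neq: "distinct [s, r, q, p]" "distinct [x, c, b, v, u]"
    using c(1) assms(6) by auto
  note neq = c(1)[simplified] neq[simplified] assms(6)[simplified] lt
  note gadget = colourable_gadget[OF assms(1) A _ assms(7)]
  from gadget[OF B, where es = "[(u, b, r), (u, c, s), (b, v, s), (c, v, q), (b, c, p), (b, x, q), (c, x, r)]"]
  show ?thesis using assms(8) by (simp add: neq)
qed

lemma colourable_K4_left_open:
  assumes "coloured_within 4 E U" "U u \<subseteq> {..<4}" "U v \<subseteq> {..<4}" "card (U u) \<le> 1" "card (U v) \<le> 3"
    and "distinct [u, v, b, c, x]" "{b, c, x} \<inter> \<Union>E = {}"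
    and "F \<subseteq> E \<union> {{u, x}, {u, b}, {u, c}, {b, v}, {b, x}, {b, c}}"
  shows "colourable 4 F"
proof -
  obtain p q r s where c: "distinct [p, q, r, s]" "{p, q, r, s} = {..<4}"
    and A: "U u \<subseteq> {p}" and B: "U v \<subseteq> {p, q, r} \<or> U v \<subseteq> {q, r, s}"
    by (rule palettes_13_of_4[OF assms(2-5)])
  have lt: "p < 4" "q < 4" "r < 4" "s < 4" using c(2) by blast+
  have neq: "distinct [s, r, q, p]" "distinct [x, c, b, v, u]"
    using c(1) assms(6) by auto
  note neq = c(1)[simplified] neq[simplified] assms(6)[simplified] lt
  note gadget = colourable_gadget[OF assms(1) A _ assms(7)]
  from B show ?thesis
  proof (elim disjE)
    assume "U v \<subseteq> {p, q, r}"
    from gadget[OF this, where es = "[(u, x, q), (u, b, r), (u, c, s), (b, v, s), (b, x, p), (b, c, q)]"]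
    show ?thesis using assms(8) by (simp add: neq)
  next
    assume "U v \<subseteq> {q, r, s}"
    from gadget[OF this, where es = "[(u, x, q), (u, b, r), (u, c, s), (b, v, p), (b, x, s), (b, c, q)]"]
    show ?thesis using assms(8) by (simp add: neq)
  qed
qed

lemma colourable_K4_left:
  assumes "coloured_within 4 E U" "U u \<subseteq> {..<4}" "U v \<subseteq> {..<4}" "card (U u) \<le> 1" "card (U v) \<le> 2"
    and "distinct [u, v, b, c, x]" "{b, c, x} \<inter> \<Union>E = {}"
    and "F \<subseteq> E \<union> {{u, x}, {u, b}, {u, c}, {b, v}, {c, v}, {b, x}, {b, c}}"
  shows "colourable 4 F"
proof -
  obtain p q r s where c: "distinct [p, q, r, s]" "{p, q, r, s} = {..<4}"
    and A: "U u \<subseteq> {p}" and B: "U v \<subseteq> {p, q} \<or> U v \<subseteq> {q, r}"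
    by (rule palettes_12_of_4[OF assms(2-5)])
  have lt: "p < 4" "q < 4" "r < 4" "s < 4" using c(2) by blast+
  have neq: "distinct [s, r, q, p]" "distinct [x, c, b, v, u]"
    using c(1) assms(6) by auto
  note neq = c(1)[simplified] neq[simplified] assms(6)[simplified] lt
  note gadget = colourable_gadget[OF assms(1) A _ assms(7)]
  from B show ?thesis
  proof (elim disjE)
    assume "U v \<subseteq> {p, q}"
    from gadget[OF this, where es = "[(u, x, q), (u, b, r), (u, c, s), (b, v, s), (c, v, r), (b, x, p), (b, c, q)]"]
    show ?thesis using assms(8) by (simp add: neq)
  next
    assume "U v \<subseteq> {q, r}"
    from gadget[OF this, where es = "[(u, x, q), (u, b, r), (u, c, s), (b, v, s), (c, v, p), (b, x, p), (b, c, q)]"]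
    show ?thesis using assms(8) by (simp add: neq)
  qed
qed

text \<open>The edge \<open>ub\<close> is absent: with four colours, the neighbours
  \<open>c\<close>, \<open>v\<close>, \<open>x\<close>, \<open>y\<close> leave no room for it at
  \<open>b\<close>.\<close>

lemma colourable_K4_left_mid:
  assumes "coloured_within 4 E U" "U u \<subseteq> {..<4}" "U v \<subseteq> {..<4}" "card (U u) \<le> 2" "card (U v) \<le> 2"
    and "distinct [u, v, b, c, x, y]" "{b, c, x, y} \<inter> \<Union>E = {}"
    and "F \<subseteq> E \<union> {{u, x}, {u, c}, {b, v}, {c, v}, {b, x}, {b, c}, {b, y}, {c, y}}"
  shows "colourable 4 F"
proof -
  obtain p q r s where c: "distinct [p, q, r, s]" "{p, q, r, s} = {..<4}"
    and A: "U u \<subseteq> {p, q}" and B: "U v \<subseteq> {p, q} \<or> U v \<subseteq> {p, r} \<or> U v \<subseteq> {r, s}"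
    by (rule palettes_22_of_4[OF assms(2-5)])
  have lt: "p < 4" "q < 4" "r < 4" "s < 4" using c(2) by blast+
  have neq: "distinct [s, r, q, p]" "distinct [y, x, c, b, v, u]"
    using c(1) assms(6) by auto
  note neq = c(1)[simplified] neq[simplified] assms(6)[simplified] lt
  note gadget = colourable_gadget[OF assms(1) A _ assms(7)]
  from B show ?thesis
  proof (elim disjE)
    assume "U v \<subseteq> {p, q}"
    from gadget[OF this, where es = "[(u, x, r), (u, c, s), (b, v, s), (c, v, r), (b, x, p), (b, c, q), (b, y, r), (c, y, p)]"]
    show ?thesis using assms(8) by (simp add: neq)
  next
    assume "U v \<subseteq> {p, r}"
    from gadget[OF this, where es = "[(u, x, r), (u, c, s), (b, v, s), (c, v, q), (b, x, p), (b, c, r), (b, y, q), (c, y, p)]"]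
    show ?thesis using assms(8) by (simp add: neq)
  next
    assume "U v \<subseteq> {r, s}"
    from gadget[OF this, where es = "[(u, x, r), (u, c, s), (b, v, p), (c, v, q), (b, x, q), (b, c, r), (b, y, s), (c, y, p)]"]
    show ?thesis using assms(8) by (simp add: neq)
  qed
qed

lemma colourable_K4_left_right:
  assumes "coloured_within 4 E U" "U u \<subseteq> {..<4}" "U v \<subseteq> {..<4}" "card (U u) \<le> 1" "card (U v) \<le> 1"
    and "distinct [u, v, b, c, x, z]" "{b, c, x, z} \<inter> \<Union>E = {}"
    and "F \<subseteq> E \<union> {{u, x}, {u, b}, {u, c}, {v, z}, {v, b}, {v, c}, {b, x}, {c, z}, {b, c}}"
  shows "colourable 4 F"
proof -
  obtain p q r s where c: "distinct [p, q, r, s]" "{p, q, r, s} = {..<4}"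
    and A: "U u \<subseteq> {p}" and B: "U v \<subseteq> {p} \<or> U v \<subseteq> {q}"
    by (rule palettes_11_of_4[OF assms(2-5)])
  have lt: "p < 4" "q < 4" "r < 4" "s < 4" using c(2) by blast+
  have neq: "distinct [s, r, q, p]" "distinct [z, x, c, b, v, u]"
    using c(1) assms(6) by auto
  note neq = c(1)[simplified] neq[simplified] assms(6)[simplified] lt
  note gadget = colourable_gadget[OF assms(1) A _ assms(7)]
  from B show ?thesis
  proof (elim disjE)
    assume "U v \<subseteq> {p}"
    from gadget[OF this, where es = "[(u, x, q), (u, b, r), (u, c, s), (v, z, q), (v, b, s), (v, c, r), (b, x, p), (c, z, p), (b, c, q)]"]
    show ?thesis using assms(8) by (simp add: neq)
  next
    assume "U v \<subseteq> {q}"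
    from gadget[OF this, where es = "[(u, x, q), (u, b, r), (u, c, s), (v, z, s), (v, b, p), (v, c, r), (b, x, s), (c, z, p), (b, c, q)]"]
    show ?thesis using assms(8) by (simp add: neq)
  qed
qed

lemma colourable_K4_all_inner:
  assumes "coloured_within 4 E U" "U u \<subseteq> {..<4}" "U v \<subseteq> {..<4}" "card (U u) \<le> 2" "card (U v) \<le> 2"
    and "distinct [u, v, b, c, x, y, z]" "{b, c, x, y, z} \<inter> \<Union>E = {}"
    and "F \<subseteq> E \<union> {{u, x}, {u, c}, {v, z}, {v, b}, {b, x}, {b, y}, {b, c}, {c, y}, {c, z}}"
  shows "colourable 4 F"
proof -
  obtain p q r s where c: "distinct [p, q, r, s]" "{p, q, r, s} = {..<4}"
    and A: "U u \<subseteq> {p, q}" and B: "U v \<subseteq> {p, q} \<or> U v \<subseteq> {p, r} \<or> U v \<subseteq> {r, s}"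
    by (rule palettes_22_of_4[OF assms(2-5)])
  have lt: "p < 4" "q < 4" "r < 4" "s < 4" using c(2) by blast+
  have neq: "distinct [s, r, q, p]" "distinct [z, y, x, c, b, v, u]"
    using c(1) assms(6) by auto
  note neq = c(1)[simplified] neq[simplified] assms(6)[simplified] lt
  note gadget = colourable_gadget[OF assms(1) A _ assms(7)]
  from B show ?thesis
  proof (elim disjE)
    assume "U v \<subseteq> {p, q}"
    from gadget[OF this, where es = "[(u, x, r), (u, c, s), (v, z, r), (v, b, s), (b, x, p), (b, y, q), (b, c, r), (c, y, p), (c, z, q)]"]
    show ?thesis using assms(8) by (simp add: neq)
  next
    assume "U v \<subseteq> {p, r}"
    from gadget[OF this, where es = "[(u, x, r), (u, c, s), (v, z, q), (v, b, s), (b, x, p), (b, y, r), (b, c, q), (c, y, p), (c, z, r)]"]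
    show ?thesis using assms(8) by (simp add: neq)
  next
    assume "U v \<subseteq> {r, s}"
    from gadget[OF this, where es = "[(u, x, r), (u, c, s), (v, z, p), (v, b, q), (b, x, p), (b, y, s), (b, c, r), (c, y, p), (c, z, q)]"]
    show ?thesis using assms(8) by (simp add: neq)
  qed
qed

lemma colourable_K4_all_outer:
  assumes "coloured_within 4 E U" "U u \<subseteq> {..<4}" "U v \<subseteq> {..<4}" "card (U u) \<le> 1" "card (U v) \<le> 1"
    and "distinct [u, v, b, c, x, y, z]" "{b, c, x, y, z} \<inter> \<Union>E = {}"
    and "F \<subseteq> E \<union> {{u, x}, {u, b}, {u, c}, {v, z}, {v, b}, {v, c}, {b, x}, {b, y}, {c, y}, {c, z}}"
  shows "colourable 4 F"
proof -
  obtain p q r s where c: "distinct [p, q, r, s]" "{p, q, r, s} = {..<4}"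
    and A: "U u \<subseteq> {p}" and B: "U v \<subseteq> {p} \<or> U v \<subseteq> {q}"
    by (rule palettes_11_of_4[OF assms(2-5)])
  have lt: "p < 4" "q < 4" "r < 4" "s < 4" using c(2) by blast+
  have neq: "distinct [s, r, q, p]" "distinct [z, y, x, c, b, v, u]"
    using c(1) assms(6) by auto
  note neq = c(1)[simplified] neq[simplified] assms(6)[simplified] lt
  note gadget = colourable_gadget[OF assms(1) A _ assms(7)]
  from B show ?thesis
  proof (elim disjE)
    assume "U v \<subseteq> {p}"
    from gadget[OF this, where es = "[(u, x, q), (u, b, r), (u, c, s), (v, z, r), (v, b, s), (v, c, q), (b, x, p), (b, y, q), (c, y, r), (c, z, p)]"]
    show ?thesis using assms(8) by (simp add: neq)
  next
    assume "U v \<subseteq> {q}"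
    from gadget[OF this, where es = "[(u, x, q), (u, b, r), (u, c, s), (v, z, p), (v, b, s), (v, c, r), (b, x, p), (b, y, q), (c, y, p), (c, z, q)]"]
    show ?thesis using assms(8) by (simp add: neq)
  qed
qed

text \<open>With all three degree-2 vertices present, \<open>b\<close> and \<open>c\<close> can have
  five neighbours each, which is how five colours come in.\<close>

lemma colourable_K4_all:
  assumes "coloured_within 5 E U" "U u \<subseteq> {..<5}" "U v \<subseteq> {..<5}" "card (U u) \<le> 2" "card (U v) \<le> 2"
    and "distinct [u, v, b, c, x, y, z]" "{b, c, x, y, z} \<inter> \<Union>E = {}"
    and "F \<subseteq> E \<union> {{u, x}, {u, b}, {u, c}, {v, z}, {v, b}, {v, c}, {b, x}, {b, y}, {c, y}, {c, z}, {b, c}}"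
  shows "colourable 5 F"
proof -
  obtain p q r s t where c: "distinct [p, q, r, s, t]" "{p, q, r, s, t} = {..<5}"
    and A: "U u \<subseteq> {p, q}" and B: "U v \<subseteq> {p, q} \<or> U v \<subseteq> {p, r} \<or> U v \<subseteq> {r, s}"
    by (rule palettes_22_of_5[OF assms(2-5)])
  have lt: "p < 5" "q < 5" "r < 5" "s < 5" "t < 5" using c(2) by blast+
  have neq: "distinct [t, s, r, q, p]" "distinct [z, y, x, c, b, v, u]"
    using c(1) assms(6) by auto
  note neq = c(1)[simplified] neq[simplified] assms(6)[simplified] lt
  note gadget = colourable_gadget[OF assms(1) A _ assms(7)]
  from B show ?thesis
  proof (elim disjE)
    assume "U v \<subseteq> {p, q}"
    from gadget[OF this, where es = "[(u, x, r), (u, b, s), (u, c, t), (v, z, r), (v, b, t), (v, c, s), (b, x, p), (b, y, q), (c, y, p), (c, z, q), (b, c, r)]"]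
    show ?thesis using assms(8) by (simp add: neq)
  next
    assume "U v \<subseteq> {p, r}"
    from gadget[OF this, where es = "[(u, x, r), (u, b, s), (u, c, t), (v, z, q), (v, b, t), (v, c, s), (b, x, p), (b, y, r), (c, y, p), (c, z, r), (b, c, q)]"]
    show ?thesis using assms(8) by (simp add: neq)
  next
    assume "U v \<subseteq> {r, s}"
    from gadget[OF this, where es = "[(u, x, r), (u, b, s), (u, c, t), (v, z, p), (v, b, t), (v, c, q), (b, x, p), (b, y, q), (c, y, p), (c, z, s), (b, c, r)]"]
    show ?thesis using assms(8) by (simp add: neq)
  qed
qed

text \<open>The four edges form an even cycle with two colours available to each: \<open>p\<close>,
  \<open>q\<close> at \<open>u\<close> and \<open>r\<close>, \<open>s\<close> at \<open>v\<close>.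
  If the edges at \<open>u\<close> get \<open>p\<close> and \<open>q\<close>, one of the two orders
  of \<open>r\<close> and \<open>s\<close> fits at \<open>v\<close>. It is stated for all
  \<open>k\<close> because nothing bounds \<open>k\<close> when \<open>b\<close> and
  \<open>c\<close> have degree 2.\<close>

lemma colourable_C4:
  assumes "coloured_within k E U" "U u \<subseteq> {..<k}" "U v \<subseteq> {..<k}"
    and "card (U u) + 2 \<le> k" "card (U v) + 2 \<le> k"
    and "distinct [u, v, b, c]" "{b, c} \<inter> \<Union>E = {}"
    and "F \<subseteq> E \<union> {{u, b}, {u, c}, {b, v}, {c, v}}"
  shows "colourable k F"
proof -
  have two: "\<exists>p q. p \<noteq> q \<and> p < k \<and> q < k \<and> A \<subseteq> {..<k} - {p, q}"
    if A: "A \<subseteq> {..<k}" "card A + 2 \<le> k" for A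
  proof -
    have "2 \<le> card ({..<k} - A)" using A by (simp add: card_Diff_subset finite_subset)
    then obtain T where "T \<subseteq> {..<k} - A" "card T = 2" using obtain_subset_with_card_n by metis
    then obtain p q where "T = {p, q}" "p \<noteq> q" by (meson card_2_iff)
    with \<open>T \<subseteq> {..<k} - A\<close> A show ?thesis by (intro exI[of _ p] exI[of _ q]) auto
  qed
  obtain p q where pq: "p \<noteq> q" "p < k" "q < k" and A: "U u \<subseteq> {..<k} - {p, q}"
    using two[of "U u"] assms(2,4) by blast
  obtain r s where rs: "r \<noteq> s" "r < k" "s < k" and B: "U v \<subseteq> {..<k} - {r, s}"
    using two[of "U v"] assms(3,5) by blast
  have neq: "distinct [c, b, v, u]" using assms(6) by auto
  note neq = neq[simplified] assms(6)[simplified] pq rs pq(1)[symmetric] rs(1)[symmetric]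
  note gadget = colourable_gadget[OF assms(1) A B assms(7)]
  show ?thesis
  proof (cases "p \<noteq> r \<and> q \<noteq> s")
    case True
    with gadget[where es = "[(u, b, p), (u, c, q), (b, v, r), (c, v, s)]"]
    show ?thesis using assms(8) by (simp add: neq)
  next
    case False
    then have "p \<noteq> s \<and> q \<noteq> r" using pq(1) rs(1) by auto
    with gadget[where es = "[(u, b, p), (u, c, q), (b, v, s), (c, v, r)]"]
    show ?thesis using assms(8) by (simp add: neq)
  qed
qed

subsection \<open>Edge-minimal counterexamples\<close>

definition nbrs :: "'a set set \<Rightarrow> 'a \<Rightarrow> 'a set" where
  "nbrs E w = {z. {w, z} \<in> E}"

lemma nbrs_sym: "z \<in> nbrs E w \<longleftrightarrow> w \<in> nbrs E z"
  unfolding nbrs_def by (simp add: insert_commute)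

lemma vdegree_eq_card_nbrs:
  assumes "\<forall>e\<in>E. card e = 2"
  shows "vdegree E w = card (nbrs E w)"
proof -
  have "{e \<in> E. w \<in> e} = (\<lambda>z. {w, z}) ` nbrs E w"
  proof (intro equalityI subsetI)
    fix e assume "e \<in> {e \<in> E. w \<in> e}"
    then have e: "e \<in> E" "w \<in> e" "card e = 2" using assms by auto
    then obtain z where "e = {w, z}" by (metis card_2_iff doubleton_eq_iff insertE singletonD)
    then show "e \<in> (\<lambda>z. {w, z}) ` nbrs E w" using e unfolding nbrs_def by auto
  qed (auto simp: nbrs_def)
  moreover have "inj_on (\<lambda>z. {w, z}) (nbrs E w)" by (auto simp: inj_on_def doubleton_eq_iff)
  ultimately show ?thesis unfolding vdegree_def by (simp add: card_image)
qed

lemma finite_nbrs: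
  assumes "finite E" shows "finite (nbrs E w)"
proof -
  have "(\<lambda>z. {w, z}) ` nbrs E w \<subseteq> E" unfolding nbrs_def by auto
  then have "finite ((\<lambda>z. {w, z}) ` nbrs E w)" using assms finite_subset by blast
  moreover have "inj_on (\<lambda>z. {w, z}) (nbrs E w)" by (auto simp: inj_on_def doubleton_eq_iff)
  ultimately show ?thesis by (rule finite_imageD)
qed

lemma vdegree_mono: "finite E \<Longrightarrow> F \<subseteq> E \<Longrightarrow> vdegree F w \<le> vdegree E w"
  unfolding vdegree_def by (rule card_mono) auto

section \<open>Edges as pairs of points on a line\<close>

text \<open>The form that two chords separating each other's ends take when the circle is cut open
  to a line.\<close>

definition interleave :: "'a::linorder set \<Rightarrow> 'a set \<Rightarrow> bool" where
  "interleave e f \<longleftrightarrow> (\<exists>a b c d. a < b \<and> b < c \<and> c < d \<and>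
    (e = {a, c} \<and> f = {b, d} \<or> e = {b, d} \<and> f = {a, c}))"

lemma interleave_sym: "interleave e f \<Longrightarrow> interleave f e"
  unfolding interleave_def by blast

lemma interleaveI:
  assumes "a < b" "b < c" "c < d"
  shows "interleave {a, c} {b, d}" "interleave {b, d} {a, c}"
  using assms unfolding interleave_def by blast+

lemma interleave_disjoint: "interleave e f \<Longrightarrow> e \<inter> f = {}"
  unfolding interleave_def by auto

lemma interleave_separates:
  assumes "interleave e f"
  obtains x y m where "x \<in> e" "y \<in> e" "m \<in> f" "x < m" "m < y"
  using assms unfolding interleave_def by blast

definition thin :: "'a::linorder set set \<Rightarrow> bool" where
  "thin E \<longleftrightarrow> (\<forall>e\<in>E. \<forall>f\<in>E. \<forall>g\<in>E. interleave e f \<longrightarrow> interleave e g \<longrightarrow> f = g)"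

lemma thin_subset: "thin E \<Longrightarrow> F \<subseteq> E \<Longrightarrow> thin F"
  unfolding thin_def by (meson subsetD)

text \<open>Minimality ranges over all thin edge sets on the same ordered type, not only over
  subsets of \<open>E\<close>, because the replacements add edges that \<open>E\<close> lacks. No
  vertex set is carried along; the vertices are the points of \<open>\<Union>E\<close>.\<close>

locale edge_minimal =
  fixes k :: nat and E :: "'a::linorder set set"
  assumes fin: "finite E" and pairs: "\<forall>e\<in>E. card e = 2" and thin: "thin E"
    and degree_le: "\<And>w. vdegree E w \<le> k" and four_le: "4 \<le> k"
    and not_colourable: "\<not> colourable k E"
    and minimal: "\<And>F :: 'a set set. card F < card E \<Longrightarrow> finite F \<Longrightarrow> \<forall>e\<in>F. card e = 2 \<Longrightarrow>
      thin F \<Longrightarrow> (\<And>w. vdegree F w \<le> k) \<Longrightarrow> colourable k F"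
begin

abbreviation "N \<equiv> nbrs E"

lemma subset_colourable:
  assumes "F \<subset> E"
  shows "colourable k F"
proof (rule minimal)
  have F: "F \<subseteq> E" using assms by blast
  show "finite F" using F fin finite_subset by blast
  show "card F < card E" using assms fin psubset_card_mono by blast
  show "\<forall>e\<in>F. card e = 2" using F pairs by blast
  show "thin F" using F thin thin_subset by blast
  show "vdegree F w \<le> k" for w using vdegree_mono[OF fin F, of w] degree_le[of w] by linarith
qed

lemma N_finite: "finite (N w)" by (rule finite_nbrs[OF fin])

lemma N_card_le: "card (N w) \<le> k"
  using degree_le[of w] vdegree_eq_card_nbrs[OF pairs] by simp

lemma N_irrefl: "w \<notin> N w"
  using pairs unfolding nbrs_def by force

lemma N_vertex: "z \<in> N w \<Longrightarrow> z \<in> \<Union>E"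
  unfolding nbrs_def by blast

lemma edge_cases:
  assumes "e \<in> E" "w \<in> e"
  obtains z where "z \<in> N w" "e = {w, z}"
proof -
  have "card e = 2" using assms pairs by blast
  then obtain x y where "e = {x, y}" by (meson card_2_iff)
  then have "e = {w, if w = x then y else x}" using assms(2) by auto
  then show ?thesis using that assms(1) unfolding nbrs_def by auto
qed

lemma N_nonempty: "w \<in> \<Union>E \<Longrightarrow> N w \<noteq> {}"
  using edge_cases by blast

lemma delete_vertices:
  assumes "S \<inter> \<Union>E \<noteq> {}"
  obtains U where "coloured_within k {e \<in> E. e \<inter> S = {}} U" "\<And>w. U w \<subseteq> {..<k}"
    "\<And>w. card (U w) \<le> card (N w - S)"
proof -
  let ?F = "{e \<in> E. e \<inter> S = {}}"
  have "?F \<subset> E" using assms by blast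
  then obtain U where U: "coloured_within k ?F U" "\<And>w. U w \<subseteq> {..<k}"
      "\<And>w. card (U w) \<le> vdegree ?F w"
    using coloured_within_palettes[of k ?F] subset_colourable fin by auto
  have "card (U w) \<le> card (N w - S)" for w
  proof -
    have "vdegree ?F w = card (nbrs ?F w)" by (rule vdegree_eq_card_nbrs) (use pairs in auto)
    moreover have "card (nbrs ?F w) \<le> card (N w - S)"
      by (rule card_mono) (use N_finite[of w] in \<open>auto simp: nbrs_def\<close>)
    ultimately show ?thesis using U(3)[of w] by linarith
  qed
  then show ?thesis using that U by blast
qed

text \<open>Once the neighbourhoods of the vertices in \<open>S\<close> are explicit, the right-hand
  side becomes the list of edges that a gadget has to colour.\<close>

lemma edges_at: "E \<subseteq> {e \<in> E. e \<inter> S = {}} \<union> (\<Union>w\<in>S. (\<lambda>z. {w, z}) ` N w)"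
proof
  fix e assume e: "e \<in> E"
  show "e \<in> {e \<in> E. e \<inter> S = {}} \<union> (\<Union>w\<in>S. (\<lambda>z. {w, z}) ` N w)"
  proof (cases "e \<inter> S = {}")
    case False
    then obtain w where w: "w \<in> e" "w \<in> S" by blast
    then obtain z where "z \<in> N w" "e = {w, z}" using edge_cases[OF e] by metis
    then show ?thesis using \<open>w \<in> S\<close> by blast
  qed (use e in simp)
qed

text \<open>Colour everything except \<open>xy\<close>. The two ends then see at most
  \<open>card (N x) - 1\<close> and \<open>card (N y) - 1\<close> colours; if these numbers add up
  to less than \<open>k\<close>, some colour is free at both ends and \<open>xy\<close> can take
  it.\<close>

lemma degree_sum:
  assumes "y \<in> N x"
  shows "k + 2 \<le> card (N x) + card (N y)"
proof (rule ccontr)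
  assume small: "\<not> k + 2 \<le> card (N x) + card (N y)"
  let ?F = "E - {{x, y}}"
  have xy: "{x, y} \<in> E" using assms unfolding nbrs_def by simp
  then have "?F \<subset> E" by blast
  then obtain U where U: "coloured_within k ?F U" "\<And>w. U w \<subseteq> {..<k}"
      "\<And>w. card (U w) \<le> vdegree ?F w"
    using coloured_within_palettes[of k ?F] subset_colourable fin by auto
  have "vdegree ?F w < vdegree E w" if "w \<in> {x, y}" for w
    unfolding vdegree_def by (rule psubset_card_mono) (use fin xy that in auto)
  then have "card (U x) < card (N x)" "card (U y) < card (N y)"
    using U(3)[of x] U(3)[of y] vdegree_eq_card_nbrs[OF pairs] by force+
  then have "card (U x \<union> U y) < k" using small card_Un_le[of "U x" "U y"] by linarith
  moreover have "U x \<union> U y \<subseteq> {..<k}" using U(2) by blast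
  ultimately have "U x \<union> U y \<subset> {..<k}" using card_lessThan[of k] by force
  then obtain i where "i < k" "i \<notin> U x \<union> U y" by blast
  then have "colourable k E"
    by (intro colourable_extends[OF U(1), of "[(x, y, i)]"]) auto
  then show False using not_colourable by simp
qed

lemma two_le_degree:
  assumes "w \<in> \<Union>E"
  shows "2 \<le> card (N w)"
proof -
  obtain y where "y \<in> N w" using N_nonempty[OF assms] by blast
  then show ?thesis using degree_sum[of y w] N_card_le[of y] by linarith
qed

lemma nbr_of_degree_two: "card (N x) \<le> 2 \<Longrightarrow> y \<in> N x \<Longrightarrow> card (N y) = k"
  using degree_sum[of y x] N_card_le[of y] by linarith

text \<open>Three vertices carry at most three edges, and these could all get different colours. The
  bound ensures that the interval spanned by all vertices has two inner ones.\<close>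

lemma four_vertices: "4 \<le> card (\<Union>E)"
proof (rule ccontr)
  let ?V = "\<Union>E"
  assume "\<not> 4 \<le> card ?V"
  have "finite e" if "e \<in> E" for e using that pairs card.infinite by fastforce
  then have "finite ?V" using fin by blast
  have "E \<subseteq> {e. e \<subseteq> ?V \<and> card e = 2}" using pairs by blast
  then have "card E \<le> card ?V choose 2"
    using card_mono[of "{e. e \<subseteq> ?V \<and> card e = 2}" E] n_subsets[OF \<open>finite ?V\<close>, of 2] \<open>finite ?V\<close>
    by simp
  moreover have "card ?V = 0 \<or> card ?V = 1 \<or> card ?V = 2 \<or> card ?V = 3"
    using \<open>\<not> 4 \<le> card ?V\<close> by linarith
  ultimately have "card E \<le> k" using four_le by (auto simp: choose_two)
  obtain c where c: "bij_betw c E {0..<card E}" using ex_bij_betw_finite_nat[OF fin] by blast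
  then have "inj_on c E" "c ` E = {0..<card E}" unfolding bij_betw_def by auto
  moreover have "c e < k" if "e \<in> E" for e
  proof -
    have "c e \<in> {0..<card E}" using \<open>c ` E = {0..<card E}\<close> that by blast
    then show ?thesis using \<open>card E \<le> k\<close> by simp
  qed
  ultimately have "proper_colouring k E c"
    unfolding proper_colouring_def inj_on_def by blast
  then show False using not_colourable unfolding colourable_def by blast
qed


text \<open>In a colouring of the graph below, \<open>u\<close> and \<open>v\<close> lose the colour of \<open>uv\<close> and one further colour
  each, and these further colours differ.\<close>

lemma triangle_layout:
  assumes "S \<noteq> {}" "S = \<Union>E \<inter> {u<..<v}" "w \<in> S" "u \<in> \<Union>E" "v \<in> \<Union>E"
  defines "F \<equiv> {e \<in> E. e \<inter> S = {}}"
  assumes "card F + 3 < card E" "card (N u - S) + 2 \<le> k" "card (N v - S) + 2 \<le> k"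
  shows "colourable k (F \<union> {{u, v}, {u, w}, {v, w}})"
proof (rule minimal)
  let ?T = "{{u, v}, {u, w}, {v, w}}"
  have uwv: "u < w" "w < v" using assms(2,3) by auto
  have finF: "finite F" unfolding F_def using fin by simp
  show "finite (F \<union> ?T)" using finF by simp
  have "card ?T \<le> 3" by (simp add: card_insert_if)
  then show "card (F \<union> ?T) < card E" using card_Un_le[of F ?T] assms(7) by linarith
  show "\<forall>e\<in>F \<union> ?T. card e = 2" using pairs uwv unfolding F_def by auto
  have range: "x \<in> {u..v}" if "x \<in> e" "e \<in> ?T" for x e using that uwv by auto
  have out: "\<not> (u < x \<and> x < v)" if "x \<in> f" "f \<in> F" for x f
    using that unfolding F_def assms(2) by auto
  \<comment> \<open>An edge of \<open>F\<close> that interleaves a triangle edge would have an end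
    strictly between \<open>u\<close> and \<open>v\<close>, where all vertices belong to
    \<open>S\<close>. Two triangle edges always share an end.\<close>
  have no: "\<not> interleave e f" if "e \<in> ?T" "f \<in> F \<union> ?T" for e f
  proof
    assume i: "interleave e f"
    show False
    proof (cases "f \<in> F")
      case True
      obtain x y m where "x \<in> e" "y \<in> e" "m \<in> f" "x < m" "m < y"
        using interleave_separates[OF i] .
      then show False using range[of x e] range[of y e] out[of m f] True that(1) by auto
    next
      case False
      then have "e \<inter> f \<noteq> {}" using that by auto
      then show False using interleave_disjoint[OF i] by blast
    qed
  qed
  have "thin F" using thin_subset[OF thin] unfolding F_def by auto
  moreover have "e \<in> F \<and> f \<in> F" if "e \<in> F \<union> ?T" "f \<in> F \<union> ?T" "interleave e f" for e f
    using that no[of e f] no[of f e] interleave_sym[of e f] by blast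
  ultimately show "thin (F \<union> ?T)" unfolding thin_def by blast
  show "vdegree (F \<union> ?T) z \<le> k" for z
  proof -
    have F_deg: "vdegree F z \<le> card (N z - S)"
    proof -
      have "vdegree F z = card (nbrs F z)" by (rule vdegree_eq_card_nbrs) (use pairs F_def in auto)
      also have "\<dots> \<le> card (N z - S)"
        by (rule card_mono) (use N_finite[of z] in \<open>auto simp: nbrs_def F_def\<close>)
      finally show ?thesis .
    qed
    have split: "vdegree (F \<union> ?T) z \<le> vdegree F z + card {e \<in> ?T. z \<in> e}"
    proof -
      have "{e \<in> F \<union> ?T. z \<in> e} = {e \<in> F. z \<in> e} \<union> {e \<in> ?T. z \<in> e}" by blast
      then show ?thesis
        unfolding vdegree_def using card_Un_le[of "{e \<in> F. z \<in> e}" "{e \<in> ?T. z \<in> e}"] by simp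
    qed
    consider "z = u" | "z = v" | "z = w" | "z \<notin> {u, v, w}" by blast
    then show ?thesis
    proof cases
      case 1
      then have "{e \<in> ?T. z \<in> e} = {{u, v}, {u, w}}" using uwv by auto
      moreover have "card {{u, v}, {u, w}} \<le> 2" by (simp add: card_insert_if)
      ultimately show ?thesis using split F_deg assms(8) 1 by simp
    next
      case 2
      then have "{e \<in> ?T. z \<in> e} = {{u, v}, {v, w}}" using uwv by auto
      moreover have "card {{u, v}, {v, w}} \<le> 2" by (simp add: card_insert_if)
      ultimately show ?thesis using split F_deg assms(9) 2 by simp
    next
      case 3
      then have "{e \<in> ?T. z \<in> e} = {{u, w}, {v, w}}" using uwv by auto
      moreover have "card {{u, w}, {v, w}} \<le> 2" by (simp add: card_insert_if)
      moreover have "vdegree F z = 0"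
        using 3 assms(3) unfolding vdegree_def F_def card_eq_0_iff by blast
      ultimately show ?thesis using split four_le by simp
    next
      case 4
      then have "{e \<in> ?T. z \<in> e} = {}" by auto
      with split have "vdegree (F \<union> ?T) z \<le> vdegree F z" by (simp only: card.empty add_0_right)
      also have "\<dots> \<le> vdegree E z" by (rule vdegree_mono[OF fin]) (auto simp: F_def)
      finally show ?thesis using degree_le[of z] by linarith
    qed
  qed
qed


text \<open>The new edge \<open>ut\<close> is what becomes of \<open>vt\<close> when the interval from \<open>u\<close> to \<open>v\<close> is contracted to a
  point; it forces \<open>us\<close> and \<open>vt\<close> to get different colours.\<close>

lemma contraction_layout:
  assumes S: "S = \<Union>E \<inter> {u<..<v}" and uv: "u < v" "{u, v} \<in> E"
    and s: "N u - S - {v} = {s}" and t: "N v - S - {u} = {t}" and st: "s \<noteq> t"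
  defines "F \<equiv> {e \<in> E. e \<inter> S = {}} - {{u, v}, {v, t}}"
  shows "colourable k (insert {u, t} F)"
proof (rule minimal)
  \<comment> \<open>This map undoes the contraction at the only edge it changes. It injects the new
    edge set into \<open>E\<close> without \<open>uv\<close> and preserves interleaving, so size,
    thinness and the degrees away from \<open>u\<close> are read off in \<open>E\<close>.\<close>
  let ?\<phi> = "\<lambda>e. if e = {u, t} then {v, t} else e"
  have FE: "F \<subseteq> E" unfolding F_def by blast
  have s': "{u, s} \<in> E" "s \<noteq> v" "s \<notin> S" "s \<noteq> u" proof -
    have "s \<in> N u" "s \<noteq> v" "s \<notin> S" using s by blast+
    then show "{u, s} \<in> E" "s \<noteq> v" "s \<notin> S" "s \<noteq> u" using N_irrefl[of u] unfolding nbrs_def by auto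
  qed
  have t': "{v, t} \<in> E" "t \<noteq> u" "t \<notin> S" "t \<noteq> v" proof -
    have "t \<in> N v" "t \<noteq> u" "t \<notin> S" using t by blast+
    then show "{v, t} \<in> E" "t \<noteq> u" "t \<notin> S" "t \<noteq> v" using N_irrefl[of v] unfolding nbrs_def by auto
  qed
  have at_u: "e = {u, s}" if ue: "e \<in> F" "u \<in> e" for e
  proof -
    have e: "e \<in> E" "e \<inter> S = {}" "e \<noteq> {u, v}" "e \<noteq> {v, t}" using that(1) unfolding F_def by auto
    obtain z where z: "z \<in> N u" "e = {u, z}" using edge_cases[OF e(1) ue(2)] .
    then have "z \<in> N u - S - {v}" using e by blast
    then have "z = s" unfolding s by simp
    then show ?thesis using z by simp
  qed
  have at_v: "v \<notin> e" if "e \<in> F" for e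
  proof
    assume "v \<in> e"
    have e: "e \<in> E" "e \<inter> S = {}" "e \<noteq> {u, v}" "e \<noteq> {v, t}" using that unfolding F_def by auto
    obtain z where z: "z \<in> N v" "e = {v, z}" using edge_cases[OF e(1) \<open>v \<in> e\<close>] .
    then have "z \<in> N v - S - {u}" using e by (auto simp: insert_commute)
    then have "z = t" unfolding t by simp
    then show False using z e by simp
  qed
  have utF: "{u, t} \<notin> F" using at_u[of "{u, t}"] st s'(4) by (auto simp: doubleton_eq_iff)
  have vtF: "{v, t} \<notin> F" unfolding F_def by blast
  have inj: "inj_on ?\<phi> (insert {u, t} F)" using utF vtF by (auto simp: inj_on_def)
  have image: "?\<phi> ` insert {u, t} F \<subseteq> E - {{u, v}}"
    using FE t'(1,2) unfolding F_def by (auto simp: doubleton_eq_iff)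
  have finF: "finite F" using FE fin finite_subset by blast
  then show "finite (insert {u, t} F)" by simp
  have "card (insert {u, t} F) \<le> card (E - {{u, v}})"
    using card_inj_on_le[OF inj image] fin by blast
  also have "\<dots> < card E" by (rule psubset_card_mono) (use fin uv in auto)
  finally show "card (insert {u, t} F) < card E" .
  show "\<forall>e\<in>insert {u, t} F. card e = 2" using FE pairs t'(2) by auto
  have out: "m < u \<or> m = u \<or> v < m" if "m \<in> e" "e \<in> F" for m e
  proof -
    have "e \<in> E" "e \<inter> S = {}" using that(2) unfolding F_def by simp_all
    then have "m \<notin> S" "m \<in> \<Union>E" using that(1) by blast+
    moreover have "m \<noteq> v" using that at_v by blast
    ultimately show ?thesis unfolding S by auto
  qed
  have tout: "t < u \<or> v < t"
  proof -
    have "t \<in> \<Union>E" using t'(1) by blast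
    then show ?thesis using t'(2-4) unfolding S by auto
  qed
  \<comment> \<open>\<open>f\<close> has no end in the closed interval from \<open>u\<close> to
    \<open>v\<close>, so sliding the end \<open>u\<close> of the new edge to \<open>v\<close> passes
    no end of \<open>f\<close>.\<close>
  have moved: "interleave {v, t} f" if f: "f \<in> F" and i: "interleave {u, t} f" for f
  proof -
    have "u \<notin> f" using interleave_disjoint[OF i] by blast
    then have out': "m < u \<or> v < m" if "m \<in> f" for m using out[OF that f] that by blast
    obtain a b c d where o: "a < b" "b < c" "c < d"
      and "{u, t} = {a, c} \<and> f = {b, d} \<or> {u, t} = {b, d} \<and> f = {a, c}"
      using i unfolding interleave_def by blast
    then consider "u = a" "t = c" "f = {b, d}" | "u = c" "t = a" "f = {b, d}"
      | "u = b" "t = d" "f = {a, c}" | "u = d" "t = b" "f = {a, c}"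
      by (auto simp: doubleton_eq_iff)
    then show ?thesis
    proof cases
      case 1
      then have "v < b" using out'[of b] o by auto
      then show ?thesis using interleaveI(1)[of v b t d] 1 o by simp
    next
      case 2
      then have "v < d" using out'[of d] o by auto
      then show ?thesis using interleaveI(1)[of t b v d] 2 o uv(1) by (simp add: insert_commute)
    next
      case 3
      then have "v < c" using out'[of c] o by auto
      then show ?thesis using interleaveI(2)[of a v c t] 3 o uv(1) by simp
    next
      case 4
      then show ?thesis using interleaveI(2)[of a t c v] o uv(1) by (simp add: insert_commute)
    qed
  qed
  have self: "\<not> interleave e e" for e :: "'a set"
    using interleave_disjoint[of e e] unfolding interleave_def by blast
  have transfer: "interleave (?\<phi> e) (?\<phi> f)"
    if "e \<in> insert {u, t} F" "f \<in> insert {u, t} F" "interleave e f" for e f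
  proof (cases "e = {u, t}")
    case True
    then have "f \<in> F" using that(2,3) self by auto
    moreover have "f \<noteq> {u, t}" using that(3) self True by auto
    ultimately show ?thesis using moved[of f] that(3) True by simp
  next
    case e: False
    then have "e \<in> F" using that(1) by auto
    show ?thesis
    proof (cases "f = {u, t}")
      case True
      then show ?thesis
        using moved[OF \<open>e \<in> F\<close>] that(3) e by (simp add: interleave_sym)
    next
      case False
      then show ?thesis using that(3) e by simp
    qed
  qed
  show "thin (insert {u, t} F)"
    unfolding thin_def
  proof (intro ballI impI)
    fix e f g assume h: "e \<in> insert {u, t} F" "f \<in> insert {u, t} F" "g \<in> insert {u, t} F"
      "interleave e f" "interleave e g"
    have "?\<phi> e \<in> E" "?\<phi> f \<in> E" "?\<phi> g \<in> E"
      using subsetD[OF image imageI[OF h(1)]] subsetD[OF image imageI[OF h(2)]]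
        subsetD[OF image imageI[OF h(3)]] by simp_all
    then have "?\<phi> f = ?\<phi> g" using transfer[OF h(1,2,4)] transfer[OF h(1,3,5)] thin
      unfolding thin_def by blast
    then show "f = g" using inj h(2,3) unfolding inj_on_def by blast
  qed
  show "vdegree (insert {u, t} F) z \<le> k" for z
  \<comment> \<open>At \<open>u\<close> the map moves an edge away, so the degree is counted
    directly: nothing but \<open>us\<close> and \<open>ut\<close> is left there.\<close>
  proof (cases "z = u")
    case True
    have "{e \<in> insert {u, t} F. z \<in> e} \<subseteq> {{u, s}, {u, t}}" using at_u True by auto
    then have "vdegree (insert {u, t} F) z \<le> card {{u, s}, {u, t}}"
      unfolding vdegree_def by (intro card_mono) auto
    also have "\<dots> \<le> 2" by (simp add: card_insert_if)
    finally show ?thesis using four_le by simp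
  next
    case False
    have "?\<phi> ` {e \<in> insert {u, t} F. z \<in> e} \<subseteq> {e \<in> E. z \<in> e}" using image False by auto
    moreover have "inj_on ?\<phi> {e \<in> insert {u, t} F. z \<in> e}" by (rule inj_on_subset[OF inj]) auto
    ultimately have "vdegree (insert {u, t} F) z \<le> vdegree E z"
      unfolding vdegree_def by (intro card_inj_on_le[of ?\<phi>]) (use fin in auto)
    then show ?thesis using degree_le[of z] by linarith
  qed
qed

end

lemma fourth_colour:
  assumes "distinct [p, q, r]" "p < 4" "q < 4" "r < (4::nat)"
  obtains s where "distinct [p, q, r, s]" "{p, q, r, s} = {..<4}"
proof -
  have three: "card {p, q, r} = 3" using assms(1) by simp
  have sub: "{p, q, r} \<subseteq> {..<4}" using assms(2-4) by simp
  have "card ({..<4} - {p, q, r}) = 1" using card_Diff_subset[OF _ sub] three by simp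
  then obtain s where s: "{..<4} - {p, q, r} = {s}" by (meson card_1_singletonE)
  then have "s \<in> {..<4} - {p, q, r}" by simp
  moreover have "{p, q, r, s} = {..<4}" using s sub by blast
  ultimately show ?thesis using that[of s] assms(1) by simp
qed

context edge_minimal
begin

lemma outer_edges_at:
  assumes "w \<notin> S"
  shows "{e \<in> {e \<in> E. e \<inter> S = {}}. w \<in> e} = (\<lambda>z. {w, z}) ` (N w - S)"
proof (intro equalityI subsetI)
  fix e assume "e \<in> {e \<in> {e \<in> E. e \<inter> S = {}}. w \<in> e}"
  then have e: "e \<in> E" "e \<inter> S = {}" "w \<in> e" by auto
  obtain z where "z \<in> N w" "e = {w, z}" using edge_cases[OF e(1,3)] .
  then show "e \<in> (\<lambda>z. {w, z}) ` (N w - S)" using e by auto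
next
  fix e assume "e \<in> (\<lambda>z. {w, z}) ` (N w - S)"
  then show "e \<in> {e \<in> {e \<in> E. e \<inter> S = {}}. w \<in> e}" using assms unfolding nbrs_def by auto
qed

text \<open>The conclusion says that the colours seen at \<open>u\<close> and \<open>v\<close> can
  be padded to two pairs with exactly one common colour. Without the edge \<open>uv\<close>, the
  triangle achieves this: its edges get three colours, and the fourth is the common one. With
  \<open>uv\<close> present, its colour is the common one. The other edges at \<open>u\<close> and
  \<open>v\<close> must then differ in colour, which is automatic if they end in the same vertex and
  otherwise comes from the contraction.\<close>

lemma rerouted_palettes:
  assumes k: "k = 4" and uv: "u < v" and S: "S = \<Union>E \<inter> {u<..<v}" "S \<noteq> {}"
    and u: "u \<in> \<Union>E" "card (N u - S) \<le> 2" and v: "v \<in> \<Union>E" "card (N v - S) \<le> 2"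
  defines "F \<equiv> {e \<in> E. e \<inter> S = {}}"
  assumes few: "card F + 3 < card E"
  obtains U p q r s where "coloured_within 4 F U" "U u \<subseteq> {p, q}" "U v \<subseteq> {p, r}"
    "distinct [p, q, r, s]" "{p, q, r, s} = {..<4}"
proof -
  have FE: "F \<subset> E" using few unfolding F_def by auto
  have uS: "u \<notin> S" and vS: "v \<notin> S" using S by auto
  have at: "{e \<in> F. w \<in> e} = (\<lambda>z. {w, z}) ` (N w - S)" if "w \<notin> S" for w
    using outer_edges_at[OF that] unfolding F_def by simp
  note result = that
  have conclude: thesis if h: "coloured_within 4 F U" "U u \<subseteq> {\<gamma>, \<alpha>}" "U v \<subseteq> {\<gamma>, \<beta>}"
    "distinct [\<gamma>, \<alpha>, \<beta>]" "\<alpha> < 4" "\<beta> < 4" "\<gamma> < 4" for U \<alpha> \<beta> \<gamma>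
  proof -
    obtain s where "distinct [\<gamma>, \<alpha>, \<beta>, s]" "{\<gamma>, \<alpha>, \<beta>, s} = {..<4}"
      using fourth_colour[OF h(4,7,5,6)] .
    then show thesis by (rule result[OF h(1-3)])
  qed
  have palettes: "coloured_within 4 F (\<lambda>w. c ` {e \<in> F. w \<in> e})" if "proper_colouring 4 F c" for c
    using that unfolding coloured_within_def by blast
  show ?thesis
  proof (cases "{u, v} \<in> E")
    case False
    obtain w where w: "w \<in> S" using S(2) by blast
    then have uwv: "u < w" "w < v" using S(1) by auto
    have "colourable 4 (F \<union> {{u, v}, {u, w}, {v, w}})"
      using triangle_layout[OF S(2,1) w u(1) v(1)] few u(2) v(2) k unfolding F_def by simp
    then obtain c where c: "proper_colouring 4 (F \<union> {{u, v}, {u, w}, {v, w}}) c"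
      unfolding colourable_def by blast
    let ?a = "c {u, v}" and ?b = "c {u, w}" and ?d = "c {v, w}"
    have "{u, v} \<noteq> {u, w}" "{u, v} \<noteq> {v, w}" "{u, w} \<noteq> {v, w}"
      using uwv by (auto simp: doubleton_eq_iff)
    then have "?a \<noteq> ?b" "?a \<noteq> ?d" "?b \<noteq> ?d"
      using proper_colouringD(2)[OF c, of "{u, v}" "{u, w}"]
        proper_colouringD(2)[OF c, of "{u, v}" "{v, w}"]
        proper_colouringD(2)[OF c, of "{u, w}" "{v, w}"] by auto
    moreover have lt: "?a < 4" "?b < 4" "?d < 4" by (rule proper_colouringD(1)[OF c], simp)+
    ultimately obtain s where s: "distinct [?a, ?b, ?d, s]" "{?a, ?b, ?d, s} = {..<4}"
      using fourth_colour[of ?a ?b ?d] by auto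
    have notF: "{u, v} \<notin> F" "{u, w} \<notin> F" "{v, w} \<notin> F"
      using False w unfolding F_def by auto
    have avoid: "c e \<noteq> c f" if "e \<in> F" "f \<in> {{u, v}, {u, w}, {v, w}}" "e \<inter> f \<noteq> {}" for e f
    proof -
      have "e \<noteq> f" using that notF by blast
      then show ?thesis using proper_colouringD(2)[OF c, of e f] that by blast
    qed
    have "c ` {e \<in> F. u \<in> e} \<subseteq> {s, ?d}"
    proof
      fix i assume "i \<in> c ` {e \<in> F. u \<in> e}"
      then obtain e where e: "i = c e" "e \<in> F" "u \<in> e" by blast
      have "i \<noteq> ?a" "i \<noteq> ?b" using e avoid[of e "{u, v}"] avoid[of e "{u, w}"] by auto
      moreover have "i < 4" using proper_colouringD(1)[OF c, of e] e by simp
      then have "i \<in> {?a, ?b, ?d, s}" unfolding s(2) by simp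
      ultimately show "i \<in> {s, ?d}" by auto
    qed
    moreover have "c ` {e \<in> F. v \<in> e} \<subseteq> {s, ?b}"
    proof
      fix i assume "i \<in> c ` {e \<in> F. v \<in> e}"
      then obtain e where e: "i = c e" "e \<in> F" "v \<in> e" by blast
      have "i \<noteq> ?a" "i \<noteq> ?d" using e avoid[of e "{u, v}"] avoid[of e "{v, w}"] by auto
      moreover have "i < 4" using proper_colouringD(1)[OF c, of e] e by simp
      then have "i \<in> {?a, ?b, ?d, s}" unfolding s(2) by simp
      ultimately show "i \<in> {s, ?b}" by auto
    qed
    moreover have "proper_colouring 4 F c" by (rule proper_colouring_subset[OF c]) blast
    moreover have "s < 4" using s(2) by blast
    ultimately show ?thesis using conclude[OF palettes, of c s ?d ?b] lt s(1) by auto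
  next
    case True
    then have uvF: "{u, v} \<in> F" using uS vS unfolding F_def by simp
    have "v \<in> N u - S" "u \<in> N v - S"
      using True uS vS unfolding nbrs_def by (auto simp: insert_commute)
    define Nu Nv where N_def: "Nu = N u - S - {v}" "Nv = N v - S - {u}"
    have one: "card (Nu) \<le> 1" "card (Nv) \<le> 1"
      using u(2) v(2) N_finite \<open>v \<in> N u - S\<close> \<open>u \<in> N v - S\<close> unfolding N_def
      by (simp_all add: card_Diff_singleton)
    have N_split: "N u - S = insert v (Nu)" "N v - S = insert u (Nv)"
      using \<open>v \<in> N u - S\<close> \<open>u \<in> N v - S\<close> unfolding N_def by auto
    have fin_N: "finite Nu" "finite Nv" unfolding N_def using N_finite by simp_all
    have edges_u: "{e \<in> F. u \<in> e} = insert {u, v} ((\<lambda>z. {u, z}) ` Nu)"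
      by (simp only: at[OF uS]) (subst N_split(1), simp only: image_insert)
    have edges_v: "{e \<in> F. v \<in> e} = insert {u, v} ((\<lambda>z. {v, z}) ` Nv)"
      by (simp only: at[OF vS]) (subst N_split(2), simp only: image_insert insert_commute[of v u "{}"])
    have at_u: "c ` {e \<in> F. u \<in> e} = insert (c {u, v}) ((\<lambda>z. c {u, z}) ` Nu)" for c :: "'a set \<Rightarrow> nat"
      unfolding edges_u by (simp only: image_insert image_image)
    have at_v: "c ` {e \<in> F. v \<in> e} = insert (c {u, v}) ((\<lambda>z. c {v, z}) ` Nv)" for c :: "'a set \<Rightarrow> nat"
      unfolding edges_v by (simp only: image_insert image_image)
    have empty_or_one: "A = {} \<or> (\<exists>a. A = {a})" if "card A \<le> 1" "finite A" for A :: "'a set"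
    proof (cases "card A = 0")
      case True then show ?thesis using that(2) by simp
    next
      case False
      then have "card A = 1" using that(1) by linarith
      then show ?thesis by (metis card_1_singletonE)
    qed
    have sides: "Nu = {} \<or> (\<exists>s. Nu = {s})"
      "Nv = {} \<or> (\<exists>t. Nv = {t})"
      using empty_or_one one fin_N by blast+
    obtain c where c: "proper_colouring 4 F c"
      using subset_colourable[OF FE] k unfolding colourable_def by blast
    then have lt: "c e < 4" if "e \<in> F" for e using that by (rule proper_colouringD(1))
    have meet: "c e \<noteq> c f" if "e \<in> F" "f \<in> F" "e \<noteq> f" "e \<inter> f \<noteq> {}" for e f
      by (rule proper_colouringD(2)[OF c that])
    have third: "\<exists>i<4. i \<noteq> a \<and> i \<noteq> b" for a b :: nat by presburger
    have inF: "{u, s} \<in> F" "s \<noteq> u" "s \<noteq> v" if "Nu = {s}" for s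
    proof -
      have "s \<in> N u - S - {v}" using that unfolding N_def by blast
      then show "{u, s} \<in> F" "s \<noteq> u" "s \<noteq> v" using uS N_irrefl unfolding F_def nbrs_def by auto
    qed
    have inF': "{v, t} \<in> F" "t \<noteq> v" "t \<noteq> u" if "Nv = {t}" for t
    proof -
      have "t \<in> N v - S - {u}" using that unfolding N_def by blast
      then show "{v, t} \<in> F" "t \<noteq> v" "t \<noteq> u" using vS N_irrefl unfolding F_def nbrs_def by auto
    qed
    consider "Nu = {}" "Nv = {}"
      | t where "Nu = {}" "Nv = {t}"
      | s where "Nu = {s}" "Nv = {}"
      | s where "Nu = {s}" "Nv = {s}"
      | s t where "Nu = {s}" "Nv = {t}" "s \<noteq> t"
      using sides by metis
    then show ?thesis
    proof cases
      case 1
      \<comment> \<open>The \<open>0\<close> is a dummy; only the colour of \<open>uv\<close> has to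
        be avoided.\<close>
      obtain \<alpha> where "\<alpha> < 4" "\<alpha> \<noteq> c {u, v}" using third[of "c {u, v}" 0] by blast
      moreover obtain \<beta> where "\<beta> < 4" "\<beta> \<noteq> c {u, v}" "\<beta> \<noteq> \<alpha>"
        using third[of "c {u, v}" \<alpha>] by blast
      ultimately show ?thesis
        using conclude[OF palettes[OF c], of "c {u, v}" \<alpha> \<beta>] at_u[of c] at_v[of c] 1 lt[OF uvF] by simp
    next
      case (2 t)
      have "c {u, v} \<noteq> c {v, t}" using inF'[OF 2(2)] meet[of "{u, v}" "{v, t}"] 2 uvF
        by (auto simp: doubleton_eq_iff)
      moreover obtain \<alpha> where "\<alpha> < 4" "\<alpha> \<noteq> c {u, v}" "\<alpha> \<noteq> c {v, t}"
        using third[of "c {u, v}" "c {v, t}"] by blast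
      ultimately show ?thesis
        using conclude[OF palettes[OF c], of "c {u, v}" \<alpha> "c {v, t}"] at_u[of c] at_v[of c] 2
          lt[OF uvF] lt[OF inF'(1)[OF 2(2)]] by simp
    next
      case (3 s)
      have "c {u, v} \<noteq> c {u, s}" using inF[OF 3(1)] meet[of "{u, v}" "{u, s}"] 3 uvF
        by (auto simp: doubleton_eq_iff)
      moreover obtain \<beta> where "\<beta> < 4" "\<beta> \<noteq> c {u, v}" "\<beta> \<noteq> c {u, s}"
        using third[of "c {u, v}" "c {u, s}"] by blast
      ultimately show ?thesis
        using conclude[OF palettes[OF c], of "c {u, v}" "c {u, s}" \<beta>] at_u[of c] at_v[of c] 3
          lt[OF uvF] lt[OF inF(1)[OF 3(1)]] by simp
    next
      case (4 s)
      note s = inF[OF 4(1)] inF'[OF 4(2)]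
      have "c {u, v} \<noteq> c {u, s}" "c {u, v} \<noteq> c {v, s}" "c {u, s} \<noteq> c {v, s}"
        using s uv uvF meet[of "{u, v}" "{u, s}"] meet[of "{u, v}" "{v, s}"] meet[of "{u, s}" "{v, s}"]
        by (auto simp: doubleton_eq_iff)
      then show ?thesis
        using conclude[OF palettes[OF c], of "c {u, v}" "c {u, s}" "c {v, s}"] at_u[of c] at_v[of c] 4
          lt[OF uvF] lt[OF s(1)] lt[OF s(4)] by simp
    next
      case (5 s t)
      note st = inF[OF 5(1)] inF'[OF 5(2)]
      have svtu: "s \<noteq> v" "t \<noteq> u" using st by simp_all
      define F' where "F' = F - {{u, v}, {v, t}}"
      have "colourable 4 (insert {u, t} F')"
        using contraction_layout[OF S(1) uv True 5[unfolded N_def]] k unfolding F'_def F_def by simp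
      then obtain d where d: "proper_colouring 4 (insert {u, t} F') d" unfolding colourable_def by blast
      have us: "{u, s} \<in> F'" using st svtu uv 5(3) unfolding F'_def by (auto simp: doubleton_eq_iff)
      have only_us: "e = {u, s}" if "e \<in> F'" "u \<in> e" for e
      proof -
        have "e \<in> {e \<in> F. u \<in> e}" "e \<noteq> {u, v}" using that unfolding F'_def by auto
        then show ?thesis unfolding edges_u 5 by simp
      qed
      have not_v: "v \<notin> e" if "e \<in> F'" for e
      proof
        assume "v \<in> e"
        then have "e \<in> {e \<in> F. v \<in> e}" "e \<noteq> {u, v}" "e \<noteq> {v, t}"
          using that unfolding F'_def by auto
        then show False unfolding edges_v 5 by simp
      qed
      let ?\<alpha> = "d {u, s}" and ?\<beta> = "d {u, t}"
      let ?U = "\<lambda>w. d ` {e \<in> F'. w \<in> e}"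
      have "{u, s} \<noteq> {u, t}" using 5(3) by (auto simp: doubleton_eq_iff)
      then have ab: "?\<alpha> \<noteq> ?\<beta>" using proper_colouringD(2)[OF d, of "{u, s}" "{u, t}"] us by auto
      have utF': "{u, t} \<notin> F'" using only_us[of "{u, t}"] \<open>{u, s} \<noteq> {u, t}\<close> by auto
      have ltd: "?\<alpha> < 4" "?\<beta> < 4" using proper_colouringD(1)[OF d] us by auto
      have U: "coloured_within 4 F' ?U"
        using proper_colouring_subset[OF d, of F'] unfolding coloured_within_def by blast
      have Uu: "?U u \<subseteq> {?\<alpha>}" using only_us by auto
      have Uv: "?U v = {}" using not_v by auto
      have Ut: "?\<beta> \<notin> ?U t"
      proof
        assume "?\<beta> \<in> ?U t"
        then obtain e where e: "e \<in> F'" "t \<in> e" "d e = ?\<beta>" by auto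
        then have "e \<noteq> {u, t}" using utF' by auto
        then show False using proper_colouringD(2)[OF d, of e "{u, t}"] e by auto
      qed
      obtain \<gamma> where g: "\<gamma> < 4" "\<gamma> \<noteq> ?\<alpha>" "\<gamma> \<noteq> ?\<beta>" using third[of ?\<alpha> ?\<beta>] by blast
      have neq: "u \<noteq> v" "v \<noteq> u" "u \<noteq> t" "v \<noteq> t" using uv st by auto
      \<comment> \<open>The edge \<open>ut\<close> hands its colour over to \<open>vt\<close>: it is
        free at \<open>t\<close> once \<open>ut\<close> is gone, and \<open>v\<close> sees no colour
        yet. As \<open>us\<close> and \<open>ut\<close> met at \<open>u\<close>, the colours of
        \<open>us\<close> and \<open>vt\<close> differ.\<close>
      define U1 where "U1 = ?U(v := insert ?\<beta> (?U v), t := insert ?\<beta> (?U t))"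
      have U1: "coloured_within 4 (insert {v, t} F') U1"
        unfolding U1_def by (rule coloured_within_insert[OF U ltd(2) _ Ut]) (simp add: Uv)
      have U1u: "U1 u \<subseteq> {?\<alpha>}" unfolding U1_def using Uu neq by simp
      have "U1 v = insert ?\<beta> (?U v)" unfolding U1_def using neq by simp
      then have U1v: "U1 v = {?\<beta>}" by (simp only: Uv)
      \<comment> \<open>The edge \<open>uv\<close> comes back with a colour different from both;
        this is the common colour of the two pairs.\<close>
      define U2 where "U2 = U1(u := insert \<gamma> (U1 u), v := insert \<gamma> (U1 v))"
      have "coloured_within 4 (insert {u, v} (insert {v, t} F')) U2"
        unfolding U2_def by (rule coloured_within_insert[OF U1 g(1)]) (use U1u U1v g in auto)
      moreover have "insert {u, v} (insert {v, t} F') = F"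
        using uvF st(4) unfolding F'_def by auto
      moreover have "U2 u \<subseteq> {\<gamma>, ?\<alpha>}" unfolding U2_def using U1u neq by auto
      moreover have "U2 v \<subseteq> {\<gamma>, ?\<beta>}" unfolding U2_def using U1v by simp
      ultimately show ?thesis using conclude[of U2 \<gamma> ?\<alpha> ?\<beta>] ab g ltd by simp
    qed
  qed
qed
end

subsection \<open>Excluded configurations\<close>

text \<open>The order gives a list of candidates for a neighbourhood and minimality gives a lower
  bound on its size. When the two agree, the neighbourhood is the whole list.\<close>

lemma eq_set_if_card_ge:
  assumes "A \<subseteq> set xs" "length xs \<le> card A"
  shows "A = set xs"
  using assms card_length[of xs] by (intro card_seteq) auto

context edge_minimal
begin

lemma N_sym: "z \<in> N w \<Longrightarrow> w \<in> N z"
  using nbrs_sym[of z E w] by simp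

text \<open>The lists hold known neighbours inside \<open>S\<close>. Each of them frees one of the
  \<open>k\<close> colours, and further deleted neighbours can only lower the count of seen
  colours.\<close>

lemma delete_below:
  assumes "S \<inter> \<Union>E \<noteq> {}"
    and "distinct xs" "set xs \<subseteq> N u \<inter> S" "distinct ys" "set ys \<subseteq> N v \<inter> S"
  obtains U where "coloured_within k {e \<in> E. e \<inter> S = {}} U" "U u \<subseteq> {..<k}" "U v \<subseteq> {..<k}"
    "card (U u) \<le> k - length xs" "card (U v) \<le> k - length ys"
proof -
  obtain U where U: "coloured_within k {e \<in> E. e \<inter> S = {}} U" "\<And>w. U w \<subseteq> {..<k}"
    "\<And>w. card (U w) \<le> card (N w - S)"
    by (rule delete_vertices[OF assms(1)]) blast
  have "card (U w) \<le> k - length ts" if "distinct ts" "set ts \<subseteq> N w \<inter> S" for w ts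
  proof -
    have "card (N w - S) \<le> card (N w - set ts)" by (rule card_mono) (use N_finite that in auto)
    also have "\<dots> = card (N w) - length ts"
      using that card_Diff_subset[of "set ts" "N w"] distinct_card[of ts] by simp
    finally show ?thesis using U(3)[of w] N_card_le[of w] by linarith
  qed
  then show ?thesis using that[OF U(1,2,2)] assms(2-5) by blast
qed

text \<open>This is what minimality leaves of a separating interval with at most one inner vertex.
  The degrees at \<open>a\<close> and \<open>b\<close> follow from the degree-sum bound at the
  degree-2 vertex and are recorded because they later bound \<open>k\<close>.\<close>

definition cap :: "'a \<Rightarrow> 'a \<Rightarrow> 'a set \<Rightarrow> bool" where
  "cap a b X \<longleftrightarrow> X = {} \<or> (\<exists>x. X = {x} \<and> N x = {a, b} \<and> card (N a) = k \<and> card (N b) = k)"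

lemma cap_sym: "cap a b X \<Longrightarrow> cap b a X"
  unfolding cap_def by (auto simp: insert_commute)

text \<open>The edges \<open>uc\<close> and \<open>bv\<close> cross, and \<open>X\<close>, \<open>Y\<close>, \<open>Z\<close> are the vertices between \<open>u\<close> and \<open>b\<close>, \<open>b\<close> and
  \<open>c\<close>, \<open>c\<close> and \<open>v\<close>. The order is left out to make the situation symmetric.\<close>

definition K4_config :: "'a \<Rightarrow> 'a \<Rightarrow> 'a \<Rightarrow> 'a \<Rightarrow> 'a set \<Rightarrow> 'a set \<Rightarrow> 'a set \<Rightarrow> bool" where
  "K4_config u b c v X Y Z \<longleftrightarrow> distinct [u, v, b, c] \<and> c \<in> N u \<and> v \<in> N b \<and>
    N b \<subseteq> {u, c, v} \<union> X \<union> Y \<and> N c \<subseteq> {u, b, v} \<union> Y \<union> Z \<and>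
    cap u b X \<and> cap b c Y \<and> cap c v Z \<and>
    (X \<union> Y \<union> Z) \<inter> {u, v, b, c} = {} \<and> X \<inter> Y = {} \<and> X \<inter> Z = {} \<and> Y \<inter> Z = {}"

lemma K4_config_sym:
  assumes "K4_config u b c v X Y Z"
  shows "K4_config v c b u Z Y X"
  using assms cap_sym nbrs_sym[of c E u] nbrs_sym[of v E b] unfolding K4_config_def
  by (auto simp: insert_commute)

text \<open>The vertex \<open>x\<close> forces degree \<open>k\<close> at \<open>b\<close>, where
  only \<open>u\<close>, \<open>c\<close>, \<open>v\<close>, \<open>x\<close> and possibly one
  vertex of \<open>Y\<close> can be neighbours. Hence \<open>k\<close> is 4 or 5 and almost all
  candidates are neighbours. The few remaining cases are each covered by a gadget that extends every
  colouring of the rest.\<close>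

lemma no_left_cap:
  assumes config: "K4_config u b c v X Y Z"
  shows "X = {}"
proof (rule ccontr)
  assume "X \<noteq> {}"
  then obtain x where x: "X = {x}" "N x = {u, b}" "card (N u) = k" "card (N b) = k"
    using config unfolding K4_config_def cap_def by blast
  have d: "distinct [u, v, b, c, x]" using config x(1) unfolding K4_config_def by auto
  have cu: "c \<in> N u" "u \<in> N c" and bv: "v \<in> N b" "b \<in> N v" and xx: "x \<in> N u" "x \<in> N b"
    using config x(2) nbrs_sym[of _ E] unfolding K4_config_def by auto
  have Nb: "N b \<subseteq> {u, c, v, x} \<union> Y" and Nc: "N c \<subseteq> {u, b, v} \<union> Y \<union> Z"
    using config x(1) unfolding K4_config_def by auto
  have Y: "Y = {} \<or> (\<exists>y. Y = {y} \<and> N y = {b, c} \<and> card (N c) = k)"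
    and Z: "Z = {} \<or> (\<exists>z. Z = {z} \<and> N z = {c, v} \<and> card (N c) = k)"
    using config unfolding K4_config_def cap_def by auto
  have V: "S \<inter> \<Union>E \<noteq> {}" if "b \<in> S" for S
    using that N_vertex[OF bv(2)] by blast
  consider "Y = {}" "Z = {}" | z where "Y = {}" "Z = {z}" "N z = {c, v}" "card (N c) = k"
    | y where "Y = {y}" "N y = {b, c}" "Z = {}" "card (N c) = k"
    | y z where "Y = {y}" "N y = {b, c}" "Z = {z}" "N z = {c, v}" "card (N c) = k"
    using Y Z by blast
  then show False
  proof cases
    case 1
    have Nb4: "N b = set [u, c, v, x]"
      by (rule eq_set_if_card_ge) (use Nb 1 x(4) four_le in auto)
    then have "k = 4" using x(4) four_le card_length[of "[u, c, v, x]"] by simp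
    have "b \<in> N c" "b \<in> N u" "b \<in> N v"
      by (rule N_sym, simp add: Nb4)+
    note in_N = this xx(1) cu(1)
    show False
    proof (cases "v \<in> N c")
      case True
      then have Nc4: "N c = {u, b, v}" using Nc 1 cu in_N by auto
      note in_N = in_N N_sym[OF True]
      obtain U where U: "coloured_within k {e \<in> E. e \<inter> {b, c, x} = {}} U" "U u \<subseteq> {..<k}" "U v \<subseteq> {..<k}"
        "card (U u) \<le> k - length [x, b, c]" "card (U v) \<le> k - length [b, c]"
        by (rule delete_below[of "{b, c, x}" "[x, b, c]" u "[b, c]" v]) (use V in_N d in auto)
      note U = U[unfolded \<open>k = 4\<close>]
      have "E \<subseteq> {e \<in> E. e \<inter> {b, c, x} = {}} \<union> {{u, x}, {u, b}, {u, c}, {b, v}, {c, v}, {b, x}, {b, c}}"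
        using edges_at[of "{b, c, x}"] by (simp add: Nb4 Nc4 x(2) insert_commute)
      then have "colourable 4 E"
        using colourable_K4_left[OF U(1-3) _ _ d, of E] U(4,5) by simp
      then show False using not_colourable \<open>k = 4\<close> by simp
    next
      case False
      then have Nc4: "N c = {u, b}" using Nc 1 cu in_N by auto
      obtain U where U: "coloured_within k {e \<in> E. e \<inter> {b, c, x} = {}} U" "U u \<subseteq> {..<k}" "U v \<subseteq> {..<k}"
        "card (U u) \<le> k - length [x, b, c]" "card (U v) \<le> k - length [b]"
        by (rule delete_below[of "{b, c, x}" "[x, b, c]" u "[b]" v]) (use V in_N d in auto)
      note U = U[unfolded \<open>k = 4\<close>]
      have "E \<subseteq> {e \<in> E. e \<inter> {b, c, x} = {}} \<union> {{u, x}, {u, b}, {u, c}, {b, v}, {b, x}, {b, c}}"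
        using edges_at[of "{b, c, x}"] by (simp add: Nb4 Nc4 x(2) insert_commute)
      then have "colourable 4 E"
        using colourable_K4_left_open[OF U(1-3) _ _ d, of E] U(4,5) by simp
      then show False using not_colourable \<open>k = 4\<close> by simp
    qed
  next
    case (2 z)
    have d': "distinct [u, v, b, c, x, z]" using d config 2(2) x(1) unfolding K4_config_def by auto
    have Nb4: "N b = set [u, c, v, x]"
      by (rule eq_set_if_card_ge) (use Nb 2 x(4) four_le in auto)
    then have "k = 4" using x(4) four_le card_length[of "[u, c, v, x]"] by simp
    have Nc4: "N c = set [u, b, v, z]"
      by (rule eq_set_if_card_ge) (use Nc 2 four_le in auto)
    have in_N: "b \<in> N u" "x \<in> N u" "c \<in> N u" "b \<in> N v" "c \<in> N v" "z \<in> N v"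
      by (rule N_sym, simp add: Nb4 Nc4 2(3) x(2))+
    obtain U where U: "coloured_within k {e \<in> E. e \<inter> {b, c, x, z} = {}} U" "U u \<subseteq> {..<k}" "U v \<subseteq> {..<k}"
      "card (U u) \<le> k - length [x, b, c]" "card (U v) \<le> k - length [z, b, c]"
      by (rule delete_below[of "{b, c, x, z}" "[x, b, c]" u "[z, b, c]" v]) (use V in_N d' in auto)
    note U = U[unfolded \<open>k = 4\<close>]
    have "E \<subseteq> {e \<in> E. e \<inter> {b, c, x, z} = {}} \<union> {{u, x}, {u, b}, {u, c}, {v, z}, {v, b}, {v, c}, {b, x}, {c, z}, {b, c}}"
      using edges_at[of "{b, c, x, z}"] by (simp add: Nb4 Nc4 x(2) 2(3) insert_commute)
    then have "colourable 4 E"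
      using colourable_K4_left_right[OF U(1-3) _ _ d', of E] U(4,5) by simp
    then show False using not_colourable \<open>k = 4\<close> by simp
  next
    case (3 y)
    have d': "distinct [u, v, b, c, x, y]" using d config 3(1) x(1) unfolding K4_config_def by auto
    \<comment> \<open>Because of \<open>y\<close> the degree of \<open>c\<close> is \<open>k\<close>
      too, and its four candidates give \<open>k = 4\<close>. Then \<open>c\<close>,
      \<open>v\<close>, \<open>x\<close>, \<open>y\<close> exhaust the degree of \<open>b\<close>,
      so \<open>ub\<close> is not an edge.\<close>
    have Nc4: "N c = set [u, b, v, y]"
      by (rule eq_set_if_card_ge) (use Nc 3 four_le in auto)
    then have "k = 4" using 3(4) four_le card_length[of "[u, b, v, y]"] by simp
    have "c \<in> N b" "y \<in> N b" by (rule N_sym, simp add: Nc4 3(2))+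
    then have "{c, v, x, y} \<subseteq> N b" using bv xx by simp
    moreover have "card {c, v, x, y} = card (N b)" using d' x(4) \<open>k = 4\<close> by auto
    ultimately have Nb4: "N b = {c, v, x, y}" using N_finite by (metis card_subset_eq)
    have "c \<in> N v" by (rule N_sym) (simp add: Nc4)
    note in_N = this xx(1) cu(1) bv(2)
    obtain U where U: "coloured_within k {e \<in> E. e \<inter> {b, c, x, y} = {}} U" "U u \<subseteq> {..<k}" "U v \<subseteq> {..<k}"
      "card (U u) \<le> k - length [x, c]" "card (U v) \<le> k - length [b, c]"
      by (rule delete_below[of "{b, c, x, y}" "[x, c]" u "[b, c]" v]) (use V in_N d' in auto)
    note U = U[unfolded \<open>k = 4\<close>]
    have "E \<subseteq> {e \<in> E. e \<inter> {b, c, x, y} = {}} \<union> {{u, x}, {u, c}, {b, v}, {c, v}, {b, x}, {b, c}, {b, y}, {c, y}}"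
      using edges_at[of "{b, c, x, y}"] by (simp add: Nb4 Nc4 x(2) 3(2) insert_commute)
    then have "colourable 4 E"
      using colourable_K4_left_mid[OF U(1-3) _ _ d', of E] U(4,5) by simp
    then show False using not_colourable \<open>k = 4\<close> by simp
  next
    case (4 y z)
    have d': "distinct [u, v, b, c, x, y, z]"
      using d config 4(1,3) x(1) unfolding K4_config_def by auto
    have "z \<in> N v" and yb: "y \<in> N b" "y \<in> N c" and zc: "z \<in> N c"
      by (rule N_sym, simp add: 4(2,4))+
    note in_N = this(1) xx(1) cu(1) bv(2)
    have Nb5: "N b \<subseteq> set [u, c, v, x, y]" and Nc5: "N c \<subseteq> set [u, b, v, y, z]"
      using Nb Nc 4 by auto
    have "card (N b) \<le> 5" using card_mono[OF _ Nb5] card_length[of "[u, c, v, x, y]"] by simp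
    \<comment> \<open>For \<open>k = 5\<close> all candidates are neighbours. For
      \<open>k = 4\<close> exactly one is missing at each of \<open>b\<close> and \<open>c\<close>:
      either \<open>bc\<close> is no edge, or both \<open>ub\<close> and \<open>cv\<close> are
      missing.\<close>
    then consider "k = 5" | "k = 4" "b \<in> N c" | "k = 4" "b \<notin> N c" using x(4) four_le by linarith
    then show False
    proof cases
      case 1
      have Nb4: "N b = set [u, c, v, x, y]" by (rule eq_set_if_card_ge) (use Nb5 1 x(4) in auto)
      have Nc4: "N c = set [u, b, v, y, z]" by (rule eq_set_if_card_ge) (use Nc5 1 4(5) in auto)
      have in_N': "b \<in> N u" "c \<in> N v" by (rule N_sym, simp add: Nb4 Nc4)+
      note in_N = in_N in_N'
      obtain U where U: "coloured_within k {e \<in> E. e \<inter> {b, c, x, y, z} = {}} U" "U u \<subseteq> {..<k}" "U v \<subseteq> {..<k}"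
        "card (U u) \<le> k - length [x, b, c]" "card (U v) \<le> k - length [z, b, c]"
        by (rule delete_below[of "{b, c, x, y, z}" "[x, b, c]" u "[z, b, c]" v]) (use V in_N d' in auto)
      note U = U[unfolded 1]
      have "E \<subseteq> {e \<in> E. e \<inter> {b, c, x, y, z} = {}} \<union> {{u, x}, {u, b}, {u, c}, {v, z}, {v, b}, {v, c}, {b, x}, {b, y}, {c, y}, {c, z}, {b, c}}"
        using edges_at[of "{b, c, x, y, z}"] by (simp add: Nb4 Nc4 x(2) 4(2,4) insert_commute)
      then have "colourable 5 E"
        using colourable_K4_all[OF U(1-3) _ _ d', of E] U(4,5) by simp
      then show False using not_colourable 1 by simp
    next
      case 2
      have "c \<in> N b" using 2(2) by (simp add: nbrs_sym)
      then have "{c, v, x, y} \<subseteq> N b" "{b, u, y, z} \<subseteq> N c" using bv xx yb zc cu 2 by auto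
      moreover have "card {c, v, x, y} = card (N b)" "card {b, u, y, z} = card (N c)"
        using d' x(4) 4(5) 2(1) by auto
      ultimately have Nb4: "N b = {c, v, x, y}" and Nc4: "N c = {b, u, y, z}"
        using N_finite by (metis card_subset_eq)+
      obtain U where U: "coloured_within k {e \<in> E. e \<inter> {b, c, x, y, z} = {}} U" "U u \<subseteq> {..<k}" "U v \<subseteq> {..<k}"
        "card (U u) \<le> k - length [x, c]" "card (U v) \<le> k - length [z, b]"
        by (rule delete_below[of "{b, c, x, y, z}" "[x, c]" u "[z, b]" v]) (use V in_N d' in auto)
      note U = U[unfolded 2(1)]
      have "E \<subseteq> {e \<in> E. e \<inter> {b, c, x, y, z} = {}} \<union> {{u, x}, {u, c}, {v, z}, {v, b}, {b, x}, {b, y}, {b, c}, {c, y}, {c, z}}"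
        using edges_at[of "{b, c, x, y, z}"] by (simp add: Nb4 Nc4 x(2) 4(2,4) insert_commute)
      then have "colourable 4 E"
        using colourable_K4_all_inner[OF U(1-3) _ _ d', of E] U(4,5) by simp
      then show False using not_colourable 2(1) by simp
    next
      case 3
      have "c \<notin> N b" using 3(2) by (simp add: nbrs_sym)
      have Nb4: "N b = set [u, v, x, y]"
        by (rule eq_set_if_card_ge) (use Nb5 \<open>c \<notin> N b\<close> 3 x(4) in auto)
      have Nc4: "N c = set [u, v, y, z]"
        by (rule eq_set_if_card_ge) (use Nc5 3 4(5) in auto)
      have in_N': "b \<in> N u" "c \<in> N v" by (rule N_sym, simp add: Nb4 Nc4)+
      note in_N = in_N in_N'
      obtain U where U: "coloured_within k {e \<in> E. e \<inter> {b, c, x, y, z} = {}} U" "U u \<subseteq> {..<k}" "U v \<subseteq> {..<k}"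
        "card (U u) \<le> k - length [x, b, c]" "card (U v) \<le> k - length [z, b, c]"
        by (rule delete_below[of "{b, c, x, y, z}" "[x, b, c]" u "[z, b, c]" v]) (use V in_N d' in auto)
      note U = U[unfolded 3(1)]
      have "E \<subseteq> {e \<in> E. e \<inter> {b, c, x, y, z} = {}} \<union> {{u, x}, {u, b}, {u, c}, {v, z}, {v, b}, {v, c}, {b, x}, {b, y}, {c, y}, {c, z}}"
        using edges_at[of "{b, c, x, y, z}"] by (simp add: Nb4 Nc4 x(2) 4(2,4) insert_commute)
      then have "colourable 4 E"
        using colourable_K4_all_outer[OF U(1-3) _ _ d', of E] U(4,5) by simp
      then show False using not_colourable 3(1) by simp
    qed
  qed
qed


lemma no_caps: "K4_config u b c v X Y Z \<Longrightarrow> X = {} \<and> Z = {}"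
  using no_left_cap K4_config_sym by blast

text \<open>Without outer caps, the ends \<open>u\<close> and \<open>v\<close> lose only their edges
  to \<open>b\<close> and \<open>c\<close>. If \<open>Y\<close> is empty and \<open>bc\<close> is
  missing, a 4-cycle has to be coloured, which works for every \<open>k\<close>. Otherwise the
  degrees give \<open>k = 4\<close>, and the colours seen at \<open>u\<close> and \<open>v\<close>
  have to be controlled.\<close>

lemma no_K4_config:
  assumes config: "K4_config u b c v X Y Z" and uv: "u < v"
    and inner: "\<Union>E \<inter> {u<..<v} = {b, c} \<union> X \<union> Y \<union> Z"
  shows False
proof -
  have XZ: "X = {}" "Z = {}" using no_caps[OF config] by auto
  have d: "distinct [u, v, b, c]" using config unfolding K4_config_def by auto
  have cu: "c \<in> N u" and bv: "v \<in> N b" using config unfolding K4_config_def by auto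
  note uc = N_sym[OF cu] and vb = N_sym[OF bv]
  have Nb: "N b \<subseteq> {u, c, v} \<union> Y" and Nc: "N c \<subseteq> {u, b, v} \<union> Y"
    using config XZ unfolding K4_config_def by auto
  have V: "u \<in> \<Union>E" "v \<in> \<Union>E" "b \<in> \<Union>E" "c \<in> \<Union>E"
    using N_vertex[OF uc] N_vertex[OF bv] N_vertex[OF vb] N_vertex[OF cu] by auto
  \<comment> \<open>At least four edges disappear with \<open>b\<close> and \<open>c\<close>, so
    adding the three edges of a triangle still gives a smaller edge set.\<close>
  have few: "card {e \<in> E. e \<inter> S = {}} + 3 < card E"
    if "b \<in> S" "c \<in> S" "N b = {u, c, v} \<union> Y" for S
  proof -
    let ?F = "{e \<in> E. e \<inter> S = {}}" and ?D = "{{b, u}, {b, c}, {b, v}, {c, u}}"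
    have "?D \<subseteq> E" using that(3) uc unfolding nbrs_def by auto
    moreover have "?F \<inter> ?D = {}" using that by auto
    moreover have "card ?D = 4" using d by (auto simp: card_insert_if doubleton_eq_iff)
    moreover have "card (?F \<union> ?D) = card ?F + card ?D"
      using \<open>?F \<inter> ?D = {}\<close> fin by (intro card_Un_disjoint) auto
    moreover have "card (?F \<union> ?D) \<le> card E" using \<open>?D \<subseteq> E\<close> fin by (intro card_mono) auto
    ultimately show ?thesis by linarith
  qed
  have rerouted: thesis if k: "k = 4" and S: "S = {b, c} \<union> Y" and N: "N b = {u, c, v} \<union> Y" "N c = {u, b, v} \<union> Y"
    and result: "\<And>U p q r s. coloured_within 4 {e \<in> E. e \<inter> S = {}} U \<Longrightarrow> U u \<subseteq> {p, q} \<Longrightarrow> U v \<subseteq> {p, r} \<Longrightarrow>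
      distinct [p, q, r, s] \<Longrightarrow> {p, q, r, s} = {..<4} \<Longrightarrow> thesis" for S thesis
  proof (rule rerouted_palettes[OF k uv _ _ V(1) _ V(2)])
    show S': "S = \<Union>E \<inter> {u<..<v}" "S \<noteq> {}" using inner S XZ by auto
    have card_le: "card (N w - S) \<le> 2" if w: "b \<in> N w" "c \<in> N w" for w
    proof -
      have "card (N w - S) \<le> card (N w - {b, c})"
        by (rule card_mono) (use S N_finite in auto)
      also have "\<dots> = card (N w) - 2" using w d by (simp add: card_Diff_subset)
      finally show ?thesis using N_card_le[of w] k by linarith
    qed
    have "u \<in> N b" "v \<in> N c" using N by auto
    then have "b \<in> N u" "c \<in> N v" by (auto intro: N_sym)
    then show "card (N u - S) \<le> 2" "card (N v - S) \<le> 2" using card_le cu vb by auto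
    show "card {e \<in> E. e \<inter> S = {}} + 3 < card E" using few[of S] S N by blast
  qed (rule result)
  have "cap b c Y" using config unfolding K4_config_def by blast
  then consider "Y = {}" "b \<notin> N c" | "Y = {}" "b \<in> N c"
    | y where "Y = {y}" "N y = {b, c}" "card (N b) = k" "card (N c) = k"
    unfolding cap_def by blast
  then show False
  proof cases
    case 1
    have "c \<notin> N b" using 1(2) N_sym by blast
    have Nb2: "N b = set [u, v]"
      by (rule eq_set_if_card_ge) (use Nb 1 \<open>c \<notin> N b\<close> two_le_degree[OF V(3)] in auto)
    have Nc2: "N c = set [u, v]"
      by (rule eq_set_if_card_ge) (use Nc 1 two_le_degree[OF V(4)] in auto)
    have in_N: "b \<in> N u" "c \<in> N u" "b \<in> N v" "c \<in> N v"
      by (rule N_sym, simp add: Nb2 Nc2)+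
    obtain U where U: "coloured_within k {e \<in> E. e \<inter> {b, c} = {}} U" "U u \<subseteq> {..<k}" "U v \<subseteq> {..<k}"
      "card (U u) \<le> k - length [b, c]" "card (U v) \<le> k - length [b, c]"
      by (rule delete_below[of "{b, c}" "[b, c]" u "[b, c]" v]) (use V in_N d in auto)
    have "E \<subseteq> {e \<in> E. e \<inter> {b, c} = {}} \<union> {{u, b}, {u, c}, {b, v}, {c, v}}"
      using edges_at[of "{b, c}"] by (simp add: Nb2 Nc2 insert_commute)
    then have "colourable k E"
      using colourable_C4[OF U(1-3) _ _ d, of E] U(4,5) four_le by simp
    then show False using not_colourable by simp
  next
    case 2
    \<comment> \<open>\<open>b\<close> and \<open>c\<close> have at most three neighbours each, so
      the degree sum at the edge \<open>bc\<close> leaves only \<open>k = 4\<close>.\<close>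
    have "k + 2 \<le> card (N b) + card (N c)" using degree_sum[OF 2(2)] by simp
    moreover have "card (N b) \<le> 3" "card (N c) \<le> 3"
      using card_mono[of "set [u, c, v]" "N b"] card_length[of "[u, c, v]"]
        card_mono[of "set [u, b, v]" "N c"] card_length[of "[u, b, v]"] Nb Nc 2 by simp_all
    ultimately have k: "k = 4" and card3: "card (N b) = 3" "card (N c) = 3" using four_le by linarith+
    have Nb3: "N b = set [u, c, v]" by (rule eq_set_if_card_ge) (use Nb 2 card3 in auto)
    have Nc3: "N c = set [u, b, v]" by (rule eq_set_if_card_ge) (use Nc 2 card3 in auto)
    obtain U p q r s where U: "coloured_within 4 {e \<in> E. e \<inter> {b, c} = {}} U" "U u \<subseteq> {p, q}" "U v \<subseteq> {p, r}"
      "distinct [p, q, r, s]" "{p, q, r, s} = {..<4}"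
      by (rule rerouted[OF k, of "{b, c}"]) (use Nb3 Nc3 2 in auto)
    have "E \<subseteq> {e \<in> E. e \<inter> {b, c} = {}} \<union> {{u, b}, {u, c}, {b, v}, {c, v}, {b, c}}"
      using edges_at[of "{b, c}"] by (simp add: Nb3 Nc3 insert_commute)
    then have "colourable 4 E"
      using colourable_K4[OF U d, of E] by simp
    then show False using not_colourable k by simp
  next
    case (3 y)
    have d': "distinct [u, v, b, c, y]" using d config 3(1) unfolding K4_config_def by auto
    have Nb4: "N b = set [u, c, v, y]"
      by (rule eq_set_if_card_ge) (use Nb 3 four_le in auto)
    have Nc4: "N c = set [u, b, v, y]"
      by (rule eq_set_if_card_ge) (use Nc 3 four_le in auto)
    have k: "k = 4" using 3(3) Nb4 four_le card_length[of "[u, c, v, y]"] by simp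
    obtain U p q r s where U: "coloured_within 4 {e \<in> E. e \<inter> {b, c, y} = {}} U" "U u \<subseteq> {p, q}" "U v \<subseteq> {p, r}"
      "distinct [p, q, r, s]" "{p, q, r, s} = {..<4}"
      by (rule rerouted[OF k, of "{b, c, y}"]) (use Nb4 Nc4 3 in auto)
    have "E \<subseteq> {e \<in> E. e \<inter> {b, c, y} = {}} \<union> {{u, b}, {u, c}, {b, v}, {c, v}, {b, c}, {b, y}, {c, y}}"
      using edges_at[of "{b, c, y}"] by (simp add: Nb4 Nc4 3(2) insert_commute)
    then have "colourable 4 E"
      using colourable_K4_mid[OF U d', of E] by simp
    then show False using not_colourable k by simp
  qed
qed

subsection \<open>Separating intervals\<close>

text \<open>Edges may run from the inside to the two ends but not beyond them; edges that pass over
  the whole interval are allowed.\<close>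

definition separates :: "'a \<Rightarrow> 'a \<Rightarrow> bool" where
  "separates a b \<longleftrightarrow> a < b \<and> (\<forall>w z. a < w \<longrightarrow> w < b \<longrightarrow> z \<in> N w \<longrightarrow> a \<le> z \<and> z \<le> b)"

definition between :: "'a \<Rightarrow> 'a \<Rightarrow> 'a set" where
  "between a b = \<Union>E \<inter> {a<..<b}"

lemma finite_vertices: "finite (\<Union>E)"
proof -
  have "finite e" if "e \<in> E" for e using that pairs card.infinite by fastforce
  then show ?thesis using fin by blast
qed

lemma finite_between: "finite (between a b)"
  unfolding between_def using finite_vertices by simp

text \<open>A single inner vertex can be joined only to \<open>a\<close> and \<open>b\<close>, and
  as its degree is at least 2, it is joined to both.\<close>

lemma cap_between:
  assumes "separates a b" "card (between a b) \<le> 1"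
  shows "cap a b (between a b)"
proof (cases "between a b = {}")
  case False
  then have "0 < card (between a b)" using finite_between by (simp add: card_gt_0_iff)
  then have "card (between a b) = 1" using assms(2) by linarith
  then obtain x where x: "between a b = {x}" by (meson card_1_singletonE)
  then have xV: "x \<in> \<Union>E" "a < x" "x < b" unfolding between_def by auto
  have "N x \<subseteq> {a, b}"
  proof
    fix z assume z: "z \<in> N x"
    then have "a \<le> z" "z \<le> b" using assms(1) xV unfolding separates_def by blast+
    moreover have "z \<noteq> x" using z N_irrefl by blast
    then have "z \<notin> between a b" using x by simp
    ultimately show "z \<in> {a, b}" using N_vertex[OF z] unfolding between_def by auto
  qed
  then have "N x = set [a, b]"
    by (intro eq_set_if_card_ge) (use two_le_degree[OF xV(1)] in auto)
  moreover have "card (N x) \<le> 2" using \<open>N x = set [a, b]\<close> card_length[of "[a, b]"] by simp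
  ultimately have "card (N a) = k" "card (N b) = k" using nbr_of_degree_two[of x] by simp_all
  then show ?thesis unfolding cap_def using x \<open>N x = set [a, b]\<close> by simp
qed (simp add: cap_def)

text \<open>Length is measured by the number of inner vertices. The interval from the least to the
  greatest vertex qualifies, so a shortest one exists, and \<open>cap_between\<close> describes the
  separating intervals inside it.\<close>

lemma tight_interval:
  obtains u v where "u \<in> \<Union>E" "v \<in> \<Union>E" "separates u v" "2 \<le> card (between u v)"
    "\<And>a b. a \<in> \<Union>E \<Longrightarrow> b \<in> \<Union>E \<Longrightarrow> u \<le> a \<Longrightarrow> b \<le> v \<Longrightarrow> a \<noteq> u \<or> b \<noteq> v \<Longrightarrow> separates a b \<Longrightarrow>
      cap a b (between a b)"
proof -
  define P where "P = (\<lambda>(u, v). u \<in> \<Union>E \<and> v \<in> \<Union>E \<and> separates u v \<and> 2 \<le> card (between u v))"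
  let ?V = "\<Union>E"
  let ?l = "Min ?V" and ?r = "Max ?V"
  have ne: "?V \<noteq> {}" using four_vertices by force
  have ends: "?l \<in> ?V" "?r \<in> ?V" using ne finite_vertices by (auto intro: Min_in Max_in simp del: Union_iff)
  have bounds: "?l \<le> w" "w \<le> ?r" if "w \<in> ?V" for w using that finite_vertices by simp_all
  have "card (?V - {?l, ?r}) + 2 \<ge> card ?V"
    using card_Diff_subset[of "{?l, ?r}" ?V] ends card_length[of "[?l, ?r]"] by simp
  moreover have "?V - {?l, ?r} \<subseteq> between ?l ?r"
  proof
    fix w assume w: "w \<in> ?V - {?l, ?r}"
    then have "?l \<le> w" "w \<le> ?r" using bounds by blast+
    then have "?l < w" "w < ?r" using w by (auto simp: order.strict_iff_order)
    then show "w \<in> between ?l ?r" unfolding between_def using w by simp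
  qed
  ultimately have two: "2 \<le> card (between ?l ?r)"
    using four_vertices card_mono[OF finite_between, of "?V - {?l, ?r}" ?l ?r] by linarith
  then have "between ?l ?r \<noteq> {}" by (metis card.empty not_numeral_le_zero)
  then obtain w where "w \<in> between ?l ?r" by blast
  then have "?l < ?r" unfolding between_def by auto
  then have "separates ?l ?r" unfolding separates_def using bounds N_vertex by blast
  then have "P (?l, ?r)" unfolding P_def using ends two by simp
  then obtain uv where uv: "P uv" "\<forall>ab. P ab \<longrightarrow> card (between (fst uv) (snd uv)) \<le> card (between (fst ab) (snd ab))"
    using ex_has_least_nat[of P "(?l, ?r)" "\<lambda>ab. card (between (fst ab) (snd ab))"] by metis
  obtain u v where uv_eq: "uv = (u, v)" by (cases uv)
  have u: "u \<in> ?V" "v \<in> ?V" "separates u v" "2 \<le> card (between u v)" using uv(1) unfolding P_def uv_eq by auto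
  have "cap a b (between a b)" if ab: "a \<in> ?V" "b \<in> ?V" "u \<le> a" "b \<le> v" "a \<noteq> u \<or> b \<noteq> v" "separates a b" for a b
  proof (rule cap_between[OF ab(6)], rule ccontr)
    assume "\<not> card (between a b) \<le> 1"
    then have "P (a, b)" unfolding P_def using ab by auto
    then have "card (between u v) \<le> card (between a b)" using uv(2) unfolding uv_eq by fastforce
    moreover have "between a b \<subset> between u v"
    proof -
      have "a < b" using ab(6) unfolding separates_def by blast
      \<comment> \<open>Shrinking turns some former inner vertex into an end, so the number of inner
        vertices drops strictly.\<close>
      then have "a \<in> between u v \<or> b \<in> between u v" using ab unfolding between_def by auto
      moreover have "a \<notin> between a b" "b \<notin> between a b" unfolding between_def by auto
      moreover have "between a b \<subseteq> between u v" using ab(3,4) unfolding between_def by auto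
      ultimately show ?thesis by blast
    qed
    then have "card (between a b) < card (between u v)" by (rule psubset_card_mono[OF finite_between])
    ultimately show False by simp
  qed
  then show ?thesis using that[OF u] by blast
qed


text \<open>By thinness \<open>ac\<close> and \<open>bd\<close> are each other's only partner, so an
  edge \<open>xy\<close> that interleaves one of them must be the other.\<close>

lemma crossing_partner:
  assumes "c \<in> N a" "d \<in> N b" "a < b" "b < c" "c < d" and "y \<in> N x" "x < y"
  shows "a < x \<Longrightarrow> x < c \<Longrightarrow> c < y \<Longrightarrow> x = b \<and> y = d"
    and "x < a \<Longrightarrow> a < y \<Longrightarrow> y < c \<Longrightarrow> False"
    and "b < x \<Longrightarrow> x < d \<Longrightarrow> d < y \<Longrightarrow> False"
    and "x < b \<Longrightarrow> b < y \<Longrightarrow> y < d \<Longrightarrow> x = a \<and> y = c"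
proof -
  have E: "{a, c} \<in> E" "{b, d} \<in> E" "{x, y} \<in> E" using assms unfolding nbrs_def by auto
  have i: "interleave {a, c} {b, d}" "interleave {b, d} {a, c}" by (rule interleaveI[OF assms(3-5)])+
  have ac: "{x, y} = {b, d}" if "interleave {a, c} {x, y}"
    using thin E i(1) that unfolding thin_def by blast
  have bd: "{x, y} = {a, c}" if "interleave {b, d} {x, y}"
    using thin E i(2) that unfolding thin_def by blast
  show "x = b \<and> y = d" if "a < x" "x < c" "c < y"
    using ac[OF interleaveI(1)[OF that]] assms(3-5,7) that by (auto simp: doubleton_eq_iff)
  show False if "x < a" "a < y" "y < c"
    using ac[OF interleaveI(2)[OF that]] assms(3-5,7) that by (auto simp: doubleton_eq_iff)
  show False if "b < x" "x < d" "d < y"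
    using bd[OF interleaveI(1)[OF that]] assms(3-5,7) that by (auto simp: doubleton_eq_iff)
  show "x = a \<and> y = c" if "x < b" "b < y" "y < d"
    using bd[OF interleaveI(2)[OF that]] assms(3-5,7) that by (auto simp: doubleton_eq_iff)
qed

text \<open>An edge leaving one of these intervals would interleave \<open>ac\<close> or
  \<open>bd\<close> without being the other of the two.\<close>

lemma crossing_separates:
  assumes "c \<in> N a" "d \<in> N b" "a < b" "b < c" "c < d"
  shows "separates a b" "separates b c" "separates c d" "separates a d"
proof -
  note X = crossing_partner[OF assms]
  show "separates a b"
    unfolding separates_def
  proof (intro conjI allI impI)
    fix w z assume w: "a < w" "w < b" "z \<in> N w"
    have z: "w \<in> N z" using w(3) by (rule N_sym)
    show "a \<le> z" using X(2)[OF z] w assms(3-5) by force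
    show "z \<le> b" using X(1)[OF w(3)] X(4)[OF w(3)] w assms(3-5) by force
  qed (rule assms(3))
  show "separates b c"
    unfolding separates_def
  proof (intro conjI allI impI)
    fix w z assume w: "b < w" "w < c" "z \<in> N w"
    have z: "w \<in> N z" using w(3) by (rule N_sym)
    show "b \<le> z" using X(2)[OF z] X(4)[OF z] w assms(3-5) by force
    show "z \<le> c" using X(1)[OF w(3)] X(3)[OF w(3)] w assms(3-5) by force
  qed (rule assms(4))
  show "separates c d"
    unfolding separates_def
  proof (intro conjI allI impI)
    fix w z assume w: "c < w" "w < d" "z \<in> N w"
    have z: "w \<in> N z" using w(3) by (rule N_sym)
    show "c \<le> z" using X(1)[OF z] X(4)[OF z] w assms(3-5) by force
    show "z \<le> d" using X(3)[OF w(3)] w assms(3-5) by force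
  qed (rule assms(5))
  show "separates a d"
    unfolding separates_def
  proof (intro conjI allI impI)
    fix w z assume w: "a < w" "w < d" "z \<in> N w"
    have z: "w \<in> N z" using w(3) by (rule N_sym)
    show "a \<le> z" using X(2)[OF z] X(4)[OF z] w assms(3-5) by force
    show "z \<le> d" using X(3)[OF w(3)] X(1)[OF w(3)] w assms(3-5) by force
  qed (use assms in order)
qed

lemma cap_le_one: "cap a b X \<Longrightarrow> x \<in> X \<Longrightarrow> y \<in> X \<Longrightarrow> x = y"
  unfolding cap_def by auto

lemma cap_nbrs: "cap a b X \<Longrightarrow> x \<in> X \<Longrightarrow> N x = {a, b}"
  unfolding cap_def by auto

text \<open>A nonempty cap gives \<open>p\<close> degree \<open>k\<close>, while the candidates for
  its neighbours are \<open>u\<close>, \<open>v\<close> and one vertex from each cap. So both caps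
  are nonempty and \<open>k = 4\<close>, and \<open>colourable_path\<close> extends any colouring of
  the rest.\<close>

lemma no_path_config:
  assumes "distinct [u, p, v]" "cap u p X" "cap p v Y" "X \<inter> Y = {}"
    and "(X \<union> Y) \<inter> {u, p, v} = {}" "N p \<subseteq> {u, v} \<union> X \<union> Y" "X \<noteq> {} \<or> Y \<noteq> {}"
  shows False
proof -
  have Np: "card (N p) = k" using assms(2,3,7) unfolding cap_def by auto
  then have "N p \<noteq> {}" using four_le by force
  have three: "card (N p) \<le> 3" if "N p \<subseteq> set [u, v, x]" for x
    using card_mono[OF _ that] card_length[of "[u, v, x]"] by simp
  have "X \<noteq> {}" "Y \<noteq> {}"
  proof -
    show "X \<noteq> {}"
    proof
      assume "X = {}"
      moreover then obtain y where "Y = {y}" using assms(3,7) unfolding cap_def by blast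
      ultimately show False using three[of y] assms(6) Np four_le by auto
    qed
    show "Y \<noteq> {}"
    proof
      assume "Y = {}"
      moreover then obtain x where "X = {x}" using assms(2,7) unfolding cap_def by blast
      ultimately show False using three[of x] assms(6) Np four_le by auto
    qed
  qed
  then obtain x y where x: "X = {x}" "N x = {u, p}" and y: "Y = {y}" "N y = {p, v}"
    using assms(2,3) unfolding cap_def by blast
  have d: "distinct [u, v, x, p, y]" using assms(1,4,5) x(1) y(1) by auto
  have Np4: "N p = set [u, v, x, y]"
    by (rule eq_set_if_card_ge) (use assms(6) x(1) y(1) Np four_le in auto)
  have k: "k = 4" using Np Np4 four_le card_length[of "[u, v, x, y]"] by simp
  have in_N: "x \<in> N u" "p \<in> N u" "y \<in> N v" "p \<in> N v"
    by (rule N_sym, simp add: x(2) y(2) Np4)+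
  have V: "{x, p, y} \<inter> \<Union>E \<noteq> {}" using N_vertex[OF in_N(2)] by blast
  obtain U where U: "coloured_within k {e \<in> E. e \<inter> {x, p, y} = {}} U" "U u \<subseteq> {..<k}" "U v \<subseteq> {..<k}"
    "card (U u) \<le> k - length [x, p]" "card (U v) \<le> k - length [y, p]"
    by (rule delete_below[of "{x, p, y}" "[x, p]" u "[y, p]" v]) (use V in_N d in auto)
  note U = U[unfolded k]
  have "E \<subseteq> {e \<in> E. e \<inter> {x, p, y} = {}} \<union> {{u, x}, {u, p}, {v, y}, {v, p}, {p, x}, {p, y}}"
    using edges_at[of "{x, p, y}"] by (simp add: Np4 x(2) y(2) insert_commute)
  then have "colourable 4 E"
    using colourable_path[OF U(1-3) _ _ d, of E] U(4,5) by simp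
  then show False using not_colourable k by simp
qed

lemma contradiction: False
proof -
  obtain u v where V: "u \<in> \<Union>E" "v \<in> \<Union>E" and uv: "separates u v" and two: "2 \<le> card (between u v)"
    and caps: "\<And>a b. a \<in> \<Union>E \<Longrightarrow> b \<in> \<Union>E \<Longrightarrow> u \<le> a \<Longrightarrow> b \<le> v \<Longrightarrow> a \<noteq> u \<or> b \<noteq> v \<Longrightarrow> separates a b \<Longrightarrow>
      cap a b (between a b)"
    using tight_interval by metis
  have uv_less: "u < v" using uv unfolding separates_def by blast
  have inside: "u \<le> z \<and> z \<le> v" if "u < w" "w < v" "z \<in> N w" for w z
    using uv that unfolding separates_def by blast
  have mem: "w \<in> between a b" if "a < w" "w < b" "z \<in> N w" for a b w z
    using that N_vertex[OF N_sym[OF that(3)]] unfolding between_def by simp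
  show False
  \<comment> \<open>The two shapes are told apart by whether two edges within the closed interval
    interleave.\<close>
  proof (cases "\<exists>a b c d. a < b \<and> b < c \<and> c < d \<and> u \<le> a \<and> d \<le> v \<and> c \<in> N a \<and> d \<in> N b")
    case True
    then obtain a b c d where o: "a < b" "b < c" "c < d" "u \<le> a" "d \<le> v" and N: "c \<in> N a" "d \<in> N b"
      by blast
    note sep = crossing_separates[OF N o(1-3)]
    note N' = N_sym[OF N(1)] N_sym[OF N(2)]
    have V': "a \<in> \<Union>E" "b \<in> \<Union>E" "c \<in> \<Union>E" "d \<in> \<Union>E"
      using N_vertex[OF N(1)] N_vertex[OF N(2)] N_vertex[OF N'(1)] N_vertex[OF N'(2)] by auto
    have bc: "b \<in> between a d" "c \<in> between a d" using V' o unfolding between_def by auto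
    \<comment> \<open>Otherwise the span of the crossing pair would be a smaller separating
      interval, hence a cap, yet with two inner vertices \<open>b\<close> and
      \<open>c\<close>.\<close>
    have "a = u \<and> d = v"
    proof (rule ccontr)
      assume "\<not> (a = u \<and> d = v)"
      then have "cap a d (between a d)" using caps[OF V'(1,4) o(4,5)] sep(4) by blast
      then have "b = c" using bc by (rule cap_le_one)
      then show False using o(2) by simp
    qed
    then have [simp]: "a = u" "d = v" by auto
    have lt: "u \<le> b" "u \<le> c" "u \<noteq> b" "u \<noteq> c" "b \<le> v" "c \<le> v" "b \<noteq> v" "c \<noteq> v" "b \<noteq> u" "c \<noteq> u"
      using o by auto
    have capX: "cap u b (between u b)" and capY: "cap b c (between b c)" and capZ: "cap c v (between c v)"
      using caps[of u b] caps[of b c] caps[of c v] V V' sep lt by simp_all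
    have notZ: "b \<notin> N z" if "z \<in> between c v" for z
      using cap_nbrs[OF capZ that] o by auto
    have notX: "c \<notin> N z" if "z \<in> between u b" for z
      using cap_nbrs[OF capX that] o by auto
    have Nb: "N b \<subseteq> {u, c, v} \<union> between u b \<union> between b c"
    proof
      fix z assume z: "z \<in> N b"
      have "u \<le> z" "z \<le> v" using inside[OF _ _ z] o by auto
      moreover have "z \<noteq> b" using z N_irrefl by blast
      moreover have "\<not> (c < z \<and> z < v)" using notZ[of z] mem[OF _ _ N_sym[OF z]] N_sym[OF z] by blast
      ultimately show "z \<in> {u, c, v} \<union> between u b \<union> between b c"
        using mem[OF _ _ N_sym[OF z], of u b] mem[OF _ _ N_sym[OF z], of b c] by force
    qed
    have Nc: "N c \<subseteq> {u, b, v} \<union> between b c \<union> between c v"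
    proof
      fix z assume z: "z \<in> N c"
      have "u \<le> z" "z \<le> v" using inside[OF _ _ z] o by auto
      moreover have "z \<noteq> c" using z N_irrefl by blast
      moreover have "\<not> (u < z \<and> z < b)" using notX[of z] mem[OF _ _ N_sym[OF z]] N_sym[OF z] by blast
      ultimately show "z \<in> {u, b, v} \<union> between b c \<union> between c v"
        using mem[OF _ _ N_sym[OF z], of b c] mem[OF _ _ N_sym[OF z], of c v] by force
    qed
    have "K4_config u b c v (between u b) (between b c) (between c v)"
      unfolding K4_config_def using N o Nb Nc capX capY capZ uv_less
      by (auto simp: between_def)
    moreover have "\<Union>E \<inter> {u<..<v} = {b, c} \<union> between u b \<union> between b c \<union> between c v"
      using V' o unfolding between_def by auto
    ultimately show False using no_K4_config uv_less by blast
  next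
    case False
    then have no_cross: "\<not> (a < b \<and> b < c \<and> c < d \<and> u \<le> a \<and> d \<le> v \<and> c \<in> N a \<and> d \<in> N b)" for a b c d
      by blast
    \<comment> \<open>Without crossings, every edge within the interval other than \<open>uv\<close>
      spans a separating interval.\<close>
    have edge_cap: "cap x y (between x y)" if e: "y \<in> N x" "x < y" "u \<le> x" "y \<le> v" "x \<noteq> u \<or> y \<noteq> v" for x y
    proof (rule caps)
      show "x \<in> \<Union>E" "y \<in> \<Union>E" using N_vertex e(1) N_sym by blast+
      show "separates x y"
        unfolding separates_def
      proof (intro conjI allI impI)
        fix w z assume w: "x < w" "w < y" "z \<in> N w"
        have z: "u \<le> z" "z \<le> v" using inside[OF _ _ w(3)] w e by auto
        show "x \<le> z" using no_cross[of z x w y] z w e N_sym[OF w(3)] by force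
        show "z \<le> y" using no_cross[of x w y z] z w e by force
      qed (rule e(2))
    qed (use e in auto)
    \<comment> \<open>Some inner vertex is passed over by no edge except possibly \<open>uv\<close>.
      Otherwise an edge over the leftmost inner vertex \<open>?m\<close> starts at \<open>u\<close>
      and ends at an inner vertex \<open>y\<close>. A further edge passes over \<open>y\<close>. If
      it starts at \<open>u\<close>, its cap contains both \<open>?m\<close> and \<open>y\<close>.
      If not, it starts inside the cap from \<open>u\<close> to \<open>y\<close>, hence at
      \<open>?m\<close>, and crosses \<open>uy\<close>.\<close>
    have breakpoint: "\<exists>p \<in> between u v. \<forall>x y. y \<in> N x \<longrightarrow> u \<le> x \<longrightarrow> x < p \<longrightarrow> p < y \<longrightarrow> y \<le> v \<longrightarrow> x = u \<and> y = v"
    proof (rule ccontr)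
      assume none: "\<not> ?thesis"
      let ?m = "Min (between u v)"
      have "between u v \<noteq> {}" using two by force
      then have m: "?m \<in> between u v" by (rule Min_in[OF finite_between])
      have least: "?m \<le> w" if "w \<in> between u v" for w by (rule Min_le[OF finite_between that])
      from none have none: "\<exists>x y. y \<in> N x \<and> u \<le> x \<and> x < p \<and> p < y \<and> y \<le> v \<and> \<not> (x = u \<and> y = v)"
        if "p \<in> between u v" for p using that by blast
      obtain x y where xy: "y \<in> N x" "u \<le> x" "x < ?m" "?m < y" "y \<le> v" "\<not> (x = u \<and> y = v)"
        using none[OF m] by blast
      have "x = u"
      proof (rule ccontr)
        assume "x \<noteq> u"
        then have "x \<in> between u v" using mem[OF _ _ xy(1), of u v] xy by force
        then show False using least xy(3) by force
      qed
      then have "y < v" "u < y" using xy by auto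
      have y: "y \<in> between u v" by (rule mem[OF \<open>u < y\<close> \<open>y < v\<close> N_sym[OF xy(1)]])
      obtain x' y' where x'y': "y' \<in> N x'" "u \<le> x'" "x' < y" "y < y'" "y' \<le> v" "\<not> (x' = u \<and> y' = v)"
        using none[OF y] by blast
      have mV: "?m \<in> \<Union>E" "u < ?m" "?m < v" using m y unfolding between_def by auto
      show False
      proof (cases "x' = u")
        case True
        have "cap u y' (between u y')" using edge_cap[OF x'y'(1)] x'y' True by auto
        moreover have "?m \<in> between u y'" "y \<in> between u y'"
          using mV y xy x'y' unfolding between_def by auto
        ultimately have "?m = y" by (rule cap_le_one)
        then show False using xy(4) by simp
      next
        case x': False
        have "cap u y (between u y)" using edge_cap[OF xy(1)] xy \<open>x = u\<close> by auto
        moreover have "?m \<in> between u y" using mV xy unfolding between_def by auto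
        moreover have "x' \<in> between u y" using mem[OF _ _ x'y'(1), of u y] x' x'y' by auto
        ultimately have "?m = x'" by (rule cap_le_one)
        then show False using no_cross[of u ?m y y'] mV xy x'y' \<open>x = u\<close> by auto
      qed
    qed
    then obtain p where p: "p \<in> between u v"
      and break: "\<And>x y. y \<in> N x \<Longrightarrow> u \<le> x \<Longrightarrow> x < p \<Longrightarrow> p < y \<Longrightarrow> y \<le> v \<Longrightarrow> x = u \<and> y = v" by blast
    have pV: "p \<in> \<Union>E" "u < p" "p < v" using p unfolding between_def by auto
    have "separates u p"
      unfolding separates_def
    proof (intro conjI allI impI)
      fix w z assume w: "u < w" "w < p" "z \<in> N w"
      have z: "u \<le> z" "z \<le> v" using inside[OF _ _ w(3)] w pV by auto
      show "u \<le> z" by (rule z(1))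
      show "z \<le> p" using break[OF w(3)] w z by force
    qed (rule pV(2))
    then have capX: "cap u p (between u p)" using caps[OF V(1) pV(1)] pV by auto
    have "separates p v"
      unfolding separates_def
    proof (intro conjI allI impI)
      fix w z assume w: "p < w" "w < v" "z \<in> N w"
      have z: "u \<le> z" "z \<le> v" using inside[OF _ _ w(3)] w pV by auto
      show "z \<le> v" by (rule z(2))
      show "p \<le> z" using break[OF N_sym[OF w(3)]] w z by force
    qed (rule pV(3))
    then have capY: "cap p v (between p v)" using caps[OF pV(1) V(2)] pV by auto
    have "N p \<subseteq> {u, v} \<union> between u p \<union> between p v"
    proof
      fix z assume z: "z \<in> N p"
      have "u \<le> z" "z \<le> v" using inside[OF _ _ z] pV by auto
      moreover have "z \<noteq> p" using z N_irrefl by blast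
      ultimately show "z \<in> {u, v} \<union> between u p \<union> between p v"
        using mem[OF _ _ N_sym[OF z], of u p] mem[OF _ _ N_sym[OF z], of p v] by force
    qed
    moreover have "between u p \<noteq> {} \<or> between p v \<noteq> {}"
    proof (rule ccontr)
      assume "\<not> ?thesis"
      then have empty: "w \<notin> between u p" "w \<notin> between p v" for w by auto
      have "between u v \<subseteq> {p}"
      proof
        fix w assume "w \<in> between u v"
        then show "w \<in> {p}" using empty[of w] unfolding between_def by (cases w p rule: linorder_cases) auto
      qed
      then have "card (between u v) \<le> card {p}" by (intro card_mono) auto
      then show False using two by simp
    qed
    moreover have "(between u p \<union> between p v) \<inter> {u, p, v} = {}" "between u p \<inter> between p v = {}"
      using pV unfolding between_def by auto
    ultimately show False using no_path_config[OF _ capX capY] pV uv_less by auto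
  qed
qed

end

theorem thin_colourable:
  fixes E :: "'a::linorder set set"
  assumes "finite E" "\<forall>e\<in>E. card e = 2" "thin E" "\<And>w. vdegree E w \<le> k" "4 \<le> k"
  shows "colourable k E"
  using assms(1-4)
proof (induction "card E" arbitrary: E rule: less_induct)
  case less
  show ?case
  proof (rule ccontr)
    assume "\<not> colourable k E"
    then interpret edge_minimal k E
      using less assms(5) by unfold_locales auto
    show False by (rule contradiction)
  qed
qed

subsection \<open>Gluing at cut vertices\<close>

text \<open>The vertices of the theorem carry no order. A placement on the real line supplies one,
  and real coordinates are what the stereographic projection delivers.\<close>

definition thin_layout :: "'a set \<Rightarrow> 'a set set \<Rightarrow> bool" where
  "thin_layout W F \<longleftrightarrow> (\<exists>f :: 'a \<Rightarrow> real. inj_on f W \<and> thin ((`) f ` F))"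

lemma thin_layout_subset:
  assumes "thin_layout W F" "W' \<subseteq> W" "F' \<subseteq> F"
  shows "thin_layout W' F'"
proof -
  obtain f :: "'a \<Rightarrow> real" where f: "inj_on f W" "thin ((`) f ` F)"
    using assms(1) unfolding thin_layout_def by blast
  have "inj_on f W'" by (rule inj_on_subset[OF f(1) assms(2)])
  moreover have "thin ((`) f ` F')" by (rule thin_subset[OF f(2) image_mono[OF assms(3)]])
  ultimately show ?thesis unfolding thin_layout_def by blast
qed

lemma finite_edges: "simple_graph V E \<Longrightarrow> finite E"
  unfolding simple_graph_def by (rule finite_subset[of E "Pow V"]) auto

lemma thin_layout_colourable:
  assumes G: "simple_graph W F" and "thin_layout W F" and deg: "\<And>w. vdegree F w \<le> k" and "4 \<le> k"
  shows "colourable k F"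
proof -
  obtain f :: "'a \<Rightarrow> real" where f: "inj_on f W" "thin ((`) f ` F)"
    using assms(2) unfolding thin_layout_def by blast
  have F: "e \<subseteq> W" "card e = 2" if "e \<in> F" for e using G that unfolding simple_graph_def by auto
  have inj: "inj_on ((`) f) F"
    using inj_on_image_eq_iff[OF f(1)] F(1) by (intro inj_onI) blast
  have "colourable k ((`) f ` F)"
  proof (rule thin_colourable[OF _ _ f(2) _ \<open>4 \<le> k\<close>])
    show "finite ((`) f ` F)" using finite_edges[OF G] by simp
    show "\<forall>e\<in>(`) f ` F. card e = 2"
      using F card_image[OF inj_on_subset[OF f(1)]] by force
    show "vdegree ((`) f ` F) w \<le> k" for w
    proof (cases "w \<in> f ` W")
      case True
      then obtain x where x: "x \<in> W" "w = f x" by blast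
      have "{e \<in> (`) f ` F. w \<in> e} \<subseteq> (`) f ` {e \<in> F. x \<in> e}"
      proof
        fix e' assume "e' \<in> {e \<in> (`) f ` F. w \<in> e}"
        then obtain e where e: "e \<in> F" "e' = f ` e" "f x \<in> f ` e" using x(2) by auto
        then have "x \<in> e" using inj_on_image_mem_iff[OF f(1) x(1) F(1)[OF e(1)]] by blast
        then show "e' \<in> (`) f ` {e \<in> F. x \<in> e}" using e by blast
      qed
      then have "vdegree ((`) f ` F) w \<le> card ((`) f ` {e \<in> F. x \<in> e})"
        unfolding vdegree_def using finite_edges[OF G] by (intro card_mono) auto
      also have "\<dots> \<le> vdegree F x"
        unfolding vdegree_def using finite_edges[OF G] by (intro card_image_le) auto
      finally show ?thesis using deg[of x] by linarith
    next
      case False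
      then have "{e \<in> (`) f ` F. w \<in> e} = {}" using F(1) by blast
      then have "vdegree ((`) f ` F) w = card ({} :: real set set)" unfolding vdegree_def by (rule arg_cong)
      then show ?thesis by simp
    qed
  qed
  then obtain c where c: "proper_colouring k ((`) f ` F) c" unfolding colourable_def by blast
  have "proper_colouring k F (\<lambda>e. c (f ` e))"
    unfolding proper_colouring_def
  proof (intro conjI ballI impI)
    show "c (f ` e) < k" if "e \<in> F" for e using proper_colouringD(1)[OF c] that by blast
    fix e e' assume e: "e \<in> F" "e' \<in> F" "e \<noteq> e'" "e \<inter> e' \<noteq> {}"
    have "f ` e \<noteq> f ` e'" using inj_onD[OF inj _ e(1,2)] e(3) by blast
    moreover have "f ` e \<inter> f ` e' \<noteq> {}" using e(4) by blast
    ultimately show "c (f ` e) \<noteq> c (f ` e')"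
      by (intro proper_colouringD(2)[OF c] imageI e(1,2))
  qed
  then show ?thesis unfolding colourable_def by blast
qed

section \<open>Splitting a graph and joining colourings\<close>

lemma disconnected_split:
  assumes "\<forall>e\<in>E. e \<subseteq> V \<and> card e = 2" "V \<noteq> {}" "\<not> graph_connected V E"
  obtains A B where "A \<union> B = V" "A \<inter> B = {}" "A \<noteq> {}" "B \<noteq> {}" "\<forall>e\<in>E. e \<subseteq> A \<or> e \<subseteq> B"
proof -
  obtain u v where uv: "u \<in> V" "v \<in> V" "(u, v) \<notin> (adj E)\<^sup>*"
    using assms(2,3) unfolding graph_connected_def by blast
  define A where "A = {w \<in> V. (u, w) \<in> (adj E)\<^sup>*}"
  have "e \<subseteq> A \<or> e \<subseteq> V - A" if e: "e \<in> E" for e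
  proof -
    obtain x y where xy: "e = {x, y}" using assms(1) e by (meson card_2_iff)
    have V: "x \<in> V" "y \<in> V" using assms(1) e xy by auto
    have "(x, y) \<in> adj E" "(y, x) \<in> adj E" using e xy unfolding adj_def by (auto simp: insert_commute)
    then have "x \<in> A \<longleftrightarrow> y \<in> A" unfolding A_def using V by (auto intro: rtrancl_into_rtrancl)
    then show ?thesis using xy V by auto
  qed
  moreover have "u \<in> A" "v \<in> V - A" using uv unfolding A_def by auto
  moreover have "A \<subseteq> V" unfolding A_def by blast
  ultimately show ?thesis using that[of A "V - A"] by blast
qed

text \<open>The inclusion \<open>A \<inter> B \<subseteq> {v}\<close>, in place of an equality,
  covers a disconnected graph, with any \<open>v\<close>, as well as a cut vertex \<open>v\<close>,
  which is put back into both sides.\<close>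

lemma cut_vertex_split:
  assumes G: "simple_graph V E" and "3 \<le> card V" "\<not> two_connected V E"
  obtains A B v where "A \<union> B = V" "A \<inter> B \<subseteq> {v}" "A \<noteq> V" "B \<noteq> V" "\<forall>e\<in>E. e \<subseteq> A \<or> e \<subseteq> B"
proof -
  have E: "\<forall>e\<in>E. e \<subseteq> V \<and> card e = 2" using G unfolding simple_graph_def by auto
  have "V \<noteq> {}" using assms(2) by force
  consider "\<not> graph_connected V E"
    | v where "v \<in> V" "\<not> graph_connected (V - {v}) {e \<in> E. v \<notin> e}"
    using assms(2,3) unfolding two_connected_def by blast
  then show ?thesis
  proof cases
    case 1
    obtain A B where "A \<union> B = V" "A \<inter> B = {}" "A \<noteq> {}" "B \<noteq> {}" "\<forall>e\<in>E. e \<subseteq> A \<or> e \<subseteq> B"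
      using disconnected_split[OF E \<open>V \<noteq> {}\<close> 1] .
    then show ?thesis using that[of A B] by blast
  next
    case (2 v)
    \<comment> \<open>\<open>graph_connected\<close> is also false for the empty graph; having three
      vertices excludes this reason.\<close>
    have "V - {v} \<noteq> {}"
    proof
      assume "V - {v} = {}"
      then have "card V \<le> card {v}" by (intro card_mono) auto
      then show False using assms(2) by simp
    qed
    then obtain A B where AB: "A \<union> B = V - {v}" "A \<inter> B = {}" "A \<noteq> {}" "B \<noteq> {}"
      "\<forall>e\<in>{e \<in> E. v \<notin> e}. e \<subseteq> A \<or> e \<subseteq> B"
      using disconnected_split[OF _ _ 2(2)] E by (metis (no_types, lifting) Diff_empty mem_Collect_eq subset_Diff_insert)
    have "e \<subseteq> insert v A \<or> e \<subseteq> insert v B" if e: "e \<in> E" for e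
    proof (cases "v \<in> e")
      case True
      obtain x y where "e = {x, y}" using E e by (meson card_2_iff)
      then obtain z where "e = {v, z}" using True by auto
      then have "z = v \<or> z \<in> A \<union> B" using E e AB(1) by auto
      then show ?thesis using \<open>e = {v, z}\<close> by auto
    next
      case False
      then show ?thesis using AB(5) e by blast
    qed
    moreover have "insert v A \<union> insert v B = V" using AB(1) 2(1) by auto
    moreover have "insert v A \<inter> insert v B \<subseteq> {v}" using AB(2) by auto
    moreover have "insert v A \<noteq> V" "insert v B \<noteq> V" using AB(1-4) by auto
    ultimately show ?thesis using that[of "insert v A" "insert v B" v] by blast
  qed
qed

text \<open>There is room for a copy of \<open>B\<close> outside \<open>A\<close>; \<open>B\<close>
  is mapped onto it, and the equally large complements are matched with each other.\<close>

lemma separating_permutation: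
  assumes "A \<subseteq> {..<k}" "B \<subseteq> {..<k}" "card A + card B \<le> (k::nat)"
  obtains \<pi> where "bij_betw \<pi> {..<k} {..<k}" "\<pi> ` B \<inter> A = {}"
proof -
  have fin: "finite A" "finite B" using assms finite_subset by blast+
  have "card B \<le> card ({..<k} - A)" using assms fin by (simp add: card_Diff_subset)
  then obtain T where T: "T \<subseteq> {..<k} - A" "card T = card B"
    using obtain_subset_with_card_n by metis
  have finT: "finite T" using T(1) finite_subset by blast
  have T': "T \<subseteq> {..<k}" using T(1) by blast
  obtain g where g: "bij_betw g B T" using finite_same_card_bij[OF fin(2) finT] T(2) by metis
  have "card ({..<k} - B) = card ({..<k} - T)"
    using assms(2) T' T(2) fin finT by (simp add: card_Diff_subset)
  then obtain h where h: "bij_betw h ({..<k} - B) ({..<k} - T)"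
    using finite_same_card_bij[of "{..<k} - B" "{..<k} - T"] by auto
  let ?\<pi> = "\<lambda>x. if x \<in> B then g x else h x"
  have "bij_betw ?\<pi> (B \<union> ({..<k} - B)) (T \<union> ({..<k} - T))"
    by (rule bij_betw_disjoint_Un[OF g h]) auto
  moreover have "B \<union> ({..<k} - B) = {..<k}" "T \<union> ({..<k} - T) = {..<k}" using assms(2) T' by auto
  moreover have "?\<pi> ` B \<inter> A = {}"
  proof -
    have "?\<pi> ` B = T" using g unfolding bij_betw_def by (simp cong: image_cong_simp)
    then show ?thesis using T(1) by blast
  qed
  ultimately show ?thesis using that[of ?\<pi>] by simp
qed

lemma colourable_glue:
  assumes "colourable k E" "colourable k F" "finite E" "finite F" "E \<inter> F = {}"
    and meet: "\<And>e f. e \<in> E \<Longrightarrow> f \<in> F \<Longrightarrow> e \<inter> f \<subseteq> {v}" and deg: "vdegree (E \<union> F) v \<le> k"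
  shows "colourable k (E \<union> F)"
proof -
  obtain c d where c: "proper_colouring k E c" and d: "proper_colouring k F d"
    using assms(1,2) unfolding colourable_def by blast
  let ?A = "c ` {e \<in> E. v \<in> e}" and ?B = "d ` {e \<in> F. v \<in> e}"
  have AB: "?A \<subseteq> {..<k}" "?B \<subseteq> {..<k}" using c d unfolding proper_colouring_def by auto
  \<comment> \<open>The two sides together show at most as many colours at \<open>v\<close> as
    \<open>v\<close> has edges; this is where the degree bound enters.\<close>
  have "card ?A + card ?B \<le> vdegree E v + vdegree F v"
    unfolding vdegree_def using assms(3,4) by (intro add_mono card_image_le) auto
  also have "\<dots> = vdegree (E \<union> F) v"
  proof -
    have "{e \<in> E \<union> F. v \<in> e} = {e \<in> E. v \<in> e} \<union> {e \<in> F. v \<in> e}" by blast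
    then show ?thesis
      unfolding vdegree_def using assms(3-5) by (simp, subst card_Un_disjoint) auto
  qed
  finally have "card ?A + card ?B \<le> k" using deg by linarith
  then obtain \<pi> where \<pi>: "bij_betw \<pi> {..<k} {..<k}" "\<pi> ` ?B \<inter> ?A = {}"
    using separating_permutation[OF AB] by blast
  have \<pi>_less: "\<pi> i < k" if "i < k" for i using \<pi>(1) that unfolding bij_betw_def by auto
  have \<pi>_inj: "i = j" if "\<pi> i = \<pi> j" "i < k" "j < k" for i j
    using \<pi>(1) that unfolding bij_betw_def inj_on_def by auto
  have across: "c e \<noteq> \<pi> (d f)" if "e \<in> E" "f \<in> F" "e \<inter> f \<noteq> {}" for e f
  proof -
    have "v \<in> e" "v \<in> f" using meet[OF that(1,2)] that(3) by auto
    then have "c e \<in> ?A" "\<pi> (d f) \<in> \<pi> ` ?B" using that by auto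
    then show ?thesis using \<pi>(2) by (metis disjoint_iff)
  qed
  let ?c = "\<lambda>e. if e \<in> E then c e else \<pi> (d e)"
  have "proper_colouring k (E \<union> F) ?c"
    unfolding proper_colouring_def
  proof (intro conjI ballI impI)
    show "?c e < k" if "e \<in> E \<union> F" for e
      using that proper_colouringD(1)[OF c] proper_colouringD(1)[OF d] \<pi>_less by auto
    fix e f assume e: "e \<in> E \<union> F" "f \<in> E \<union> F" "e \<noteq> f" "e \<inter> f \<noteq> {}"
    consider "e \<in> E" "f \<in> E" | "e \<in> E" "f \<in> F" "f \<notin> E" | "e \<in> F" "e \<notin> E" "f \<in> E"
      | "e \<in> F" "e \<notin> E" "f \<in> F" "f \<notin> E" using e(1,2) by blast
    then show "?c e \<noteq> ?c f"
    proof cases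
      case 1
      then show ?thesis using proper_colouringD(2)[OF c] e(3,4) by simp
    next
      case 2
      then show ?thesis using across[of e f] e(4) by simp
    next
      case 3
      then have "c f \<noteq> \<pi> (d e)" using across[of f e] e(4) by (simp add: Int_commute)
      then show ?thesis using 3 by simp
    next
      case 4
      then have "d e \<noteq> d f" "d e < k" "d f < k"
        using proper_colouringD[OF d] e(3,4) by blast+
      then show ?thesis using 4 \<pi>_inj by auto
    qed
  qed
  then show ?thesis unfolding colourable_def by blast
qed

text \<open>The hypothesis concerns all two-connected subgraphs instead of the maximal ones. In this
  form it passes to both sides of a split, and their blocks need not be compared with those of the
  whole graph.\<close>

lemma colourable_by_blocks:
  assumes "simple_graph V E" "\<And>w. vdegree E w \<le> k" "4 \<le> k"
    and "\<And>W F. subgraph W F V E \<Longrightarrow> two_connected W F \<Longrightarrow> thin_layout W F"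
  shows "colourable k E"
  using assms(1,2,4)
proof (induction "card V" arbitrary: V E rule: less_induct)
  case less
  have fin: "finite V" "finite E" and E: "\<forall>e\<in>E. e \<subseteq> V \<and> card e = 2"
    using less.prems(1) finite_edges unfolding simple_graph_def by blast+
  consider "two_connected V E" | "card V \<le> 2" | "3 \<le> card V" "\<not> two_connected V E" by linarith
  then show ?case
  proof cases
    case 1
    have "subgraph V E V E" using less.prems(1) unfolding subgraph_def by blast
    then show ?thesis using thin_layout_colourable[OF less.prems(1) _ less.prems(2) assms(3)] less.prems(3) 1 by blast
  next
    case 2
    \<comment> \<open>On at most two vertices the only possible edge is \<open>V\<close> itself, so
      one colour is enough.\<close>
    have "e = V" if "e \<in> E" for e using E that 2 fin(1) by (metis card_seteq)
    then have "proper_colouring k E (\<lambda>_. 0)" unfolding proper_colouring_def using assms(3) by auto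
    then show ?thesis unfolding colourable_def by blast
  next
    case 3
    obtain A B v where AB: "A \<union> B = V" "A \<inter> B \<subseteq> {v}" "A \<noteq> V" "B \<noteq> V" "\<forall>e\<in>E. e \<subseteq> A \<or> e \<subseteq> B"
      using cut_vertex_split[OF less.prems(1) 3] .
    have part: "colourable k {e \<in> E. e \<subseteq> C}" if C: "C \<subseteq> V" "C \<noteq> V" for C
    proof (rule less.hyps)
      show "card C < card V" using C fin(1) by (simp add: psubset_card_mono psubsetI)
      show "simple_graph C {e \<in> E. e \<subseteq> C}"
        using E C(1) fin(1) finite_subset unfolding simple_graph_def by blast
      show "vdegree {e \<in> E. e \<subseteq> C} w \<le> k" for w
        using vdegree_mono[OF fin(2), of "{e \<in> E. e \<subseteq> C}" w] less.prems(2)[of w] by fastforce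
      show "thin_layout W F" if "subgraph W F C {e \<in> E. e \<subseteq> C}" "two_connected W F" for W F
        using less.prems(3)[of W F] that C(1) unfolding subgraph_def by blast
    qed
    let ?A = "{e \<in> E. e \<subseteq> A}" and ?B = "{e \<in> E. e \<subseteq> B}"
    have EAB: "?A \<union> ?B = E" using AB(5) by blast
    have "colourable k (?A \<union> ?B)"
    proof (rule colourable_glue)
      show "colourable k ?A" "colourable k ?B" using part AB(1,3,4) by blast+
      show "finite ?A" "finite ?B" using fin(2) by simp_all
      show "?A \<inter> ?B = {}"
      proof (rule ccontr)
        assume "?A \<inter> ?B \<noteq> {}"
        then obtain e where "e \<in> E" "e \<subseteq> {v}" using AB(2) by blast
        then have "card e \<le> card {v}" "card e = 2" using E card_mono[of "{v}" e] by auto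
        then show False by simp
      qed
      show "e \<inter> f \<subseteq> {v}" if "e \<in> ?A" "f \<in> ?B" for e f using that AB(2) by blast
      show "vdegree (?A \<union> ?B) v \<le> k" unfolding EAB by (rule less.prems(2))
    qed
    then show ?thesis unfolding EAB .
  qed
qed

subsection \<open>Alternating paths in a disk\<close>

text \<open>Away from its pole, the Moebius map \<open>1 / (2 - z)\<close> takes the disk of radius
  2 into the half plane with real part at least \<open>1 / 4\<close>. The coordinates are swapped to
  make the boundary horizontal, since the Fashoda theorem is applied with all four ends on the lower
  side of a box.\<close>

definition half_plane :: "complex \<Rightarrow> real^2" where
  "half_plane z = (\<chi> i. if i = 1 then Im (1 / (2 - z)) else Re (1 / (2 - z)))"

lemma half_plane_nth [simp]:
  "half_plane z $ 1 = Im (1 / (2 - z))" "half_plane z $ 2 = Re (1 / (2 - z))"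
  unfolding half_plane_def by simp_all

text \<open>This includes the pole: division by zero yields 0, a value that
  \<open>1 / (2 - z)\<close> takes nowhere else.\<close>

lemma half_plane_inj: "half_plane z = half_plane w \<Longrightarrow> z = w"
proof -
  assume "half_plane z = half_plane w"
  then have "half_plane z $ i = half_plane w $ i" for i by simp
  from this[of 1] this[of 2] have "1 / (2 - z) = 1 / (2 - w)" by (simp add: complex_eq_iff)
  then show "z = w" by (simp add: divide_inverse)
qed

lemma half_plane_continuous: "2 \<notin> S \<Longrightarrow> continuous_on S half_plane"
  unfolding half_plane_def
proof (rule continuous_on_vec_lambda)
  fix i :: 2
  assume S: "2 \<notin> S"
  then have "2 - z \<noteq> 0" if "z \<in> S" for z using that by force
  then have "continuous_on S (\<lambda>z. Im (1 / (2 - z)))" "continuous_on S (\<lambda>z. Re (1 / (2 - z)))"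
    by (auto intro!: continuous_intros)
  then show "continuous_on S (\<lambda>z. if i = 1 then Im (1 / (2 - z)) else Re (1 / (2 - z)))"
    by (cases "i = 1") simp_all
qed

text \<open>With \<open>z = x + iy\<close>, clearing the denominator turns the inequality into
  \<open>(2 - x)^2 + y^2 <= 4 * (2 - x)\<close>, which is \<open>x^2 + y^2 <= 4\<close>.\<close>

lemma half_plane_height:
  assumes "z \<noteq> 2"
  shows "1 / 4 \<le> Re (1 / (2 - z)) \<longleftrightarrow> norm z \<le> 2"
    and "Re (1 / (2 - z)) = 1 / 4 \<longleftrightarrow> norm z = 2"
proof -
  define x y where "x = Re z" and "y = Im z"
  have D: "(2 - x)\<^sup>2 + y\<^sup>2 > 0"
    using assms unfolding x_def y_def by (auto simp: complex_eq_iff sum_power2_gt_zero_iff)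
  have re: "Re (1 / (2 - z)) = (2 - x) / ((2 - x)\<^sup>2 + y\<^sup>2)"
    unfolding x_def y_def by (simp add: Re_divide power2_eq_square)
  have n: "(norm z)\<^sup>2 = x\<^sup>2 + y\<^sup>2" unfolding x_def y_def by (simp add: cmod_power2)
  have "1 / 4 \<le> Re (1 / (2 - z)) \<longleftrightarrow> x\<^sup>2 + y\<^sup>2 \<le> 4"
    unfolding re using D by (simp add: field_simps power2_eq_square)
  also have "\<dots> \<longleftrightarrow> norm z \<le> 2"
    using abs_le_square_iff[of "norm z" 2] n by simp
  finally show "1 / 4 \<le> Re (1 / (2 - z)) \<longleftrightarrow> norm z \<le> 2" .
  have "Re (1 / (2 - z)) = 1 / 4 \<longleftrightarrow> x\<^sup>2 + y\<^sup>2 = 4"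
    unfolding re using D by (simp add: field_simps power2_eq_square)
  also have "\<dots> \<longleftrightarrow> norm z = 2"
    using power2_eq_iff_nonneg[of "norm z" 2] n by simp
  finally show "Re (1 / (2 - z)) = 1 / 4 \<longleftrightarrow> norm z = 2" .
qed

text \<open>The radial spikes keep the path away from the pole of \<^const>\<open>half_plane\<close>, which a path in the
  closed unit disk might otherwise meet.\<close>

definition spiked :: "(real \<Rightarrow> complex) \<Rightarrow> real \<Rightarrow> complex" where
  "spiked \<gamma> = linepath (2 * pathstart \<gamma>) (pathstart \<gamma>) +++ \<gamma> +++
    linepath (pathfinish \<gamma>) (2 * pathfinish \<gamma>)"

lemma spiked_ends [simp]:
  "pathstart (spiked \<gamma>) = 2 * pathstart \<gamma>" "pathfinish (spiked \<gamma>) = 2 * pathfinish \<gamma>"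
  unfolding spiked_def by simp_all

lemma path_spiked: "path \<gamma> \<Longrightarrow> path (spiked \<gamma>)"
  unfolding spiked_def by simp

lemma path_image_spiked:
  assumes "z \<in> path_image (spiked \<gamma>)" "z \<notin> path_image \<gamma>"
  obtains t s where "1 < t" "t \<le> 2" "s \<in> {pathstart \<gamma>, pathfinish \<gamma>}" "z = of_real t * s"
proof -
  have seg: "\<exists>t. 1 \<le> t \<and> t \<le> 2 \<and> z = of_real t * s" if z: "z \<in> closed_segment s (2 * s)" for s
  proof -
    obtain u where u: "0 \<le> u" "u \<le> 1" "z = (1 - u) *\<^sub>R s + u *\<^sub>R (2 * s)"
      using z unfolding in_segment by blast
    then have "z = of_real (1 + u) * s" by (simp add: scaleR_conv_of_real algebra_simps)
    then show ?thesis using u by (intro exI[of _ "1 + u"]) simp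
  qed
  have "z \<in> closed_segment (pathstart \<gamma>) (2 * pathstart \<gamma>) \<or>
      z \<in> closed_segment (pathfinish \<gamma>) (2 * pathfinish \<gamma>)"
    using assms unfolding spiked_def
    by (auto simp: path_image_join closed_segment_commute)
  then obtain t s where ts: "1 \<le> t" "t \<le> 2" "s \<in> {pathstart \<gamma>, pathfinish \<gamma>}" "z = of_real t * s"
    using seg by blast
  have "t \<noteq> 1"
  proof
    assume "t = 1"
    then have "z \<in> path_image \<gamma>" using ts by auto
    then show False using assms(2) by simp
  qed
  then show ?thesis using that[of t s] ts by simp
qed

text \<open>By the Fashoda theorem the spiked paths meet. A meeting point outside the unit disk
  would lie on a spike of each, hence on a common ray, and then the two paths would share an end,
  against the order of the ends.\<close>

lemma alternating_paths_meet:
  fixes \<gamma> \<delta> :: "real \<Rightarrow> complex"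
  assumes path: "path \<gamma>" "path \<delta>"
    and disk: "path_image \<gamma> \<subseteq> cball 0 1" "path_image \<delta> \<subseteq> cball 0 1"
    and ends: "norm (pathstart \<gamma>) = 1" "norm (pathfinish \<gamma>) = 1" "norm (pathstart \<delta>) = 1" "norm (pathfinish \<delta>) = 1"
      "1 \<notin> {pathstart \<gamma>, pathfinish \<gamma>, pathstart \<delta>, pathfinish \<delta>}"
    and order: "Im (1 / (1 - pathstart \<gamma>)) < Im (1 / (1 - pathstart \<delta>))"
      "Im (1 / (1 - pathstart \<delta>)) < Im (1 / (1 - pathfinish \<gamma>))"
      "Im (1 / (1 - pathfinish \<gamma>)) < Im (1 / (1 - pathfinish \<delta>))"
  shows "path_image \<gamma> \<inter> path_image \<delta> \<noteq> {}"
proof -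
  have spike_norm: "norm z \<le> 2" "z \<noteq> 2"
    if h: "z \<in> path_image (spiked \<eta>)" "path_image \<eta> \<subseteq> cball 0 1" "norm (pathstart \<eta>) = 1"
      "norm (pathfinish \<eta>) = 1" "1 \<notin> {pathstart \<eta>, pathfinish \<eta>}" for z \<eta>
  proof -
    have "norm z \<le> 2 \<and> z \<noteq> 2"
    proof (cases "z \<in> path_image \<eta>")
      case True
      then have "norm z \<le> 1" using h(2) by auto
      then show ?thesis by auto
    next
      case False
      obtain t s where ts: "1 < t" "t \<le> 2" "s \<in> {pathstart \<eta>, pathfinish \<eta>}" "z = of_real t * s"
        using path_image_spiked[OF h(1) False] .
      then have "norm s = 1" "s \<noteq> 1" using h by auto
      then have "norm z = t" using ts by (simp add: norm_mult)
      moreover have "z \<noteq> 2"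
      proof
        assume "z = 2"
        then have "t = 2" using \<open>norm z = t\<close> by simp
        then show False using \<open>z = 2\<close> ts(4) \<open>s \<noteq> 1\<close> by simp
      qed
      ultimately show ?thesis using ts(2) by simp
    qed
    then show "norm z \<le> 2" "z \<noteq> 2" by simp_all
  qed
  let ?G = "half_plane \<circ> spiked \<gamma>" and ?D = "half_plane \<circ> spiked \<delta>"
  have G: "norm z \<le> 2" "z \<noteq> 2" if "z \<in> path_image (spiked \<gamma>)" for z
    using spike_norm[OF that disk(1) ends(1,2)] ends(5) by auto
  have D: "norm z \<le> 2" "z \<noteq> 2" if "z \<in> path_image (spiked \<delta>)" for z
    using spike_norm[OF that disk(2) ends(3,4)] ends(5) by auto
  have paths: "path ?G" "path ?D"
    using path_continuous_image[OF path_spiked[OF path(1)] half_plane_continuous]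
      path_continuous_image[OF path_spiked[OF path(2)] half_plane_continuous] G(2) D(2) by blast+
  have "bounded (path_image ?G \<union> path_image ?D)"
    unfolding bounded_Un using bounded_path_image[OF paths(1)] bounded_path_image[OF paths(2)] by (rule conjI)
  then obtain M where M: "norm w \<le> M" if "w \<in> path_image ?G \<union> path_image ?D" for w
    unfolding bounded_iff by auto
  \<comment> \<open>The lower side of the box has height \<open>1 / 4\<close>, where the spikes end;
    the other three sides come from the bound \<open>M\<close>.\<close>
  define a b :: "real^2" where "a = (\<chi> i. if i = 1 then - M else 1 / 4)" and "b = (\<chi> i. M)"
  have box: "w \<in> cbox a b" if w: "w \<in> path_image ?G \<union> path_image ?D" for w
  proof -
    obtain z where z: "w = half_plane z" "z \<in> path_image (spiked \<gamma>) \<union> path_image (spiked \<delta>)"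
      using w by (auto simp: path_image_compose)
    then have "1 / 4 \<le> w $ 2" using half_plane_height(1)[of z] G D by auto
    moreover have "\<bar>w $ i\<bar> \<le> M" for i
      using component_le_norm_cart[of w i] M[OF w] by linarith
    ultimately show ?thesis
      unfolding mem_box_cart a_def b_def by (auto simp: forall_2 abs_le_iff minus_le_iff)
  qed
  \<comment> \<open>Since \<open>1 / (2 - 2 * s)\<close> is half of \<open>1 / (1 - s)\<close>, the
    tips of the spikes come in the order assumed for the ends of the paths.\<close>
  have base: "half_plane (2 * s) $ 1 = Im (1 / (1 - s)) / 2" "half_plane (2 * s) $ 2 = a $ 2"
    if "norm s = 1" "s \<noteq> 1" for s
  proof -
    have "1 / (2 - 2 * s) = (1 / (1 - s)) / 2" using that(2) by (simp add: field_simps)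
    then show "half_plane (2 * s) $ 1 = Im (1 / (1 - s)) / 2"
      by (simp only: half_plane_nth Im_divide_numeral)
    have "2 * s \<noteq> 2" using that(2) by simp
    then have "Re (1 / (2 - 2 * s)) = 1 / 4" using half_plane_height(2)[of "2 * s"] that(1) by (simp add: norm_mult)
    then show "half_plane (2 * s) $ 2 = a $ 2" unfolding a_def by simp
  qed
  have starts: "pathstart ?G = half_plane (2 * pathstart \<gamma>)" "pathfinish ?G = half_plane (2 * pathfinish \<gamma>)"
    "pathstart ?D = half_plane (2 * pathstart \<delta>)" "pathfinish ?D = half_plane (2 * pathfinish \<delta>)"
    by (simp_all add: pathstart_compose pathfinish_compose)
  have ne: "pathstart \<gamma> \<noteq> 1" "pathfinish \<gamma> \<noteq> 1" "pathstart \<delta> \<noteq> 1" "pathfinish \<delta> \<noteq> 1" using ends(5) by auto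
  obtain w where w: "w \<in> path_image ?G" "w \<in> path_image ?D"
  proof (rule fashoda_interlace[OF paths, of a b])
    show "path_image ?G \<subseteq> cbox a b" "path_image ?D \<subseteq> cbox a b" using box by blast+
    show "pathstart ?G $ 2 = a $ 2" "pathfinish ?G $ 2 = a $ 2" "pathstart ?D $ 2 = a $ 2" "pathfinish ?D $ 2 = a $ 2"
      unfolding starts using base(2) ends(1-4) ne by blast+
    show "pathstart ?G $ 1 < pathstart ?D $ 1" "pathstart ?D $ 1 < pathfinish ?G $ 1"
      "pathfinish ?G $ 1 < pathfinish ?D $ 1"
      unfolding starts base(1)[OF ends(1) ne(1)] base(1)[OF ends(2) ne(2)] base(1)[OF ends(3) ne(3)]
        base(1)[OF ends(4) ne(4)] using order by simp_all
  qed
  then obtain z where z: "z \<in> path_image (spiked \<gamma>)" "z \<in> path_image (spiked \<delta>)"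
    unfolding path_image_compose using half_plane_inj by blast
  have norm_out: "1 < norm z" if h: "z \<in> path_image (spiked \<eta>)" "z \<notin> path_image \<eta>"
    "norm (pathstart \<eta>) = 1" "norm (pathfinish \<eta>) = 1" for \<eta>
  proof -
    obtain t s where "1 < t" "s \<in> {pathstart \<eta>, pathfinish \<eta>}" "z = of_real t * s"
      using path_image_spiked[OF h(1,2)] .
    then show ?thesis using h(3,4) by (auto simp: norm_mult)
  qed
  \<comment> \<open>A spiked path leaves its original path only strictly outside the closed unit
    disk, so a common point lies on both original paths or on neither.\<close>
  have same: "z \<in> path_image \<gamma> \<longleftrightarrow> z \<in> path_image \<delta>"
    using norm_out[OF z(1) _ ends(1,2)] norm_out[OF z(2) _ ends(3,4)] disk
    unfolding subset_iff mem_cball_0 by (meson not_le)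
  have "z \<in> path_image \<gamma>"
  proof (rule ccontr)
    assume no: "z \<notin> path_image \<gamma>"
    obtain t s where ts: "1 < t" "t \<le> 2" "s \<in> {pathstart \<gamma>, pathfinish \<gamma>}" "z = of_real t * s"
      using path_image_spiked[OF z(1) no] .
    obtain t' s' where ts': "1 < t'" "t' \<le> 2" "s' \<in> {pathstart \<delta>, pathfinish \<delta>}" "z = of_real t' * s'"
      using path_image_spiked[OF z(2) no[unfolded same]] .
    have "norm s = 1" "norm s' = 1" using ts(3) ts'(3) ends by auto
    have t: "norm z = t" unfolding ts(4) using ts(1) \<open>norm s = 1\<close> by (simp add: norm_mult)
    have t': "norm z = t'" unfolding ts'(4) using ts'(1) \<open>norm s' = 1\<close> by (simp add: norm_mult)
    have "of_real t * s = of_real t * s'" using ts(4) ts'(4) t t' by metis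
    then have "s = s'" using ts(1) by simp
    then show False using ts(3) ts'(3) order by auto
  qed
  then show ?thesis using same by blast
qed

subsection \<open>From drawings to linear orders\<close>

text \<open>The plane is identified with the complex numbers such that \<open>c\<close> becomes 0
  and \<open>q\<close> becomes 1; the circle around \<open>c\<close> through \<open>q\<close>
  becomes the unit circle.\<close>

definition chart :: "real^2 \<Rightarrow> real^2 \<Rightarrow> real^2 \<Rightarrow> complex" where
  "chart c q P = Complex ((P - c) $ 1) ((P - c) $ 2) / Complex ((q - c) $ 1) ((q - c) $ 2)"

text \<open>This is stereographic projection from \<open>q\<close>: if \<open>chart c q P\<close> is
  the point of the unit circle at angle \<open>t\<close>, the value is half the cotangent of
  \<open>t / 2\<close>.\<close>

definition position :: "real^2 \<Rightarrow> real^2 \<Rightarrow> real^2 \<Rightarrow> real" where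
  "position c q P = Im (1 / (1 - chart c q P))"

lemma norm_Complex_nth: "norm (Complex (P $ 1) (P $ 2)) = norm P" for P :: "real^2"
  by (simp add: complex_norm norm_vec_def L2_set_def UNIV_2)

lemma chart_inverse:
  fixes q c :: "real^2"
  assumes "q \<noteq> c"
  shows "Complex ((q - c) $ 1) ((q - c) $ 2) \<noteq> 0"
proof -
  have "norm (Complex ((q - c) $ 1) ((q - c) $ 2)) \<noteq> 0" unfolding norm_Complex_nth using assms by simp
  then show ?thesis by (metis norm_zero)
qed

lemma norm_chart: "norm (chart c q P) = dist c P / dist c q"
  unfolding chart_def norm_divide norm_Complex_nth dist_norm by (simp only: norm_minus_commute)

lemma chart_inj:
  assumes "q \<noteq> c" "chart c q P = chart c q Q"
  shows "P = Q"
proof -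
  have "Complex ((P - c) $ 1) ((P - c) $ 2) = Complex ((Q - c) $ 1) ((Q - c) $ 2)"
    using assms(2) chart_inverse[OF assms(1)] unfolding chart_def by simp
  then show ?thesis by (simp add: vec_eq_iff forall_2)
qed

lemma chart_base: "q \<noteq> c \<Longrightarrow> chart c q q = 1"
  unfolding chart_def using chart_inverse by simp

lemma continuous_on_chart:
  assumes "q \<noteq> c"
  shows "continuous_on S (chart c q)"
proof -
  have "continuous_on S (\<lambda>P :: real^2. Complex ((P - c) $ 1) ((P - c) $ 2))"
    unfolding Complex_eq by (intro continuous_intros)
  then show ?thesis unfolding chart_def using chart_inverse[OF assms] by (intro continuous_intros) auto
qed

text \<open>The map \<open>1 / (1 - z)\<close> sends the unit circle to the line with real part \<open>1 / 2\<close>.\<close>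

lemma position_inj:
  assumes "r > 0" "q \<in> sphere c r" "P \<in> sphere c r" "Q \<in> sphere c r" "P \<noteq> q" "Q \<noteq> q"
    and eq: "position c q P = position c q Q"
  shows "P = Q"
proof -
  have qc: "q \<noteq> c" using assms(1,2) by auto
  have half: "Re (1 / (1 - z)) = 1 / 2" if "norm z = 1" "z \<noteq> 1" for z :: complex
  proof -
    \<comment> \<open>Scaling by 2 reduces the claim to the boundary case of
      \<open>half_plane_height\<close>.\<close>
    have "1 / (2 - 2 * z) = (1 / (1 - z)) / 2" using that(2) by (simp add: field_simps)
    moreover have "Re (1 / (2 - 2 * z)) = 1 / 4"
      using half_plane_height(2)[of "2 * z"] that by (simp add: norm_mult)
    ultimately have "Re ((1 / (1 - z)) / 2) = 1 / 4" by (simp only:)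
    then show ?thesis by (simp only: Re_divide_numeral)
  qed
  have unit: "norm (chart c q X) = 1" "chart c q X \<noteq> 1" if "X \<in> sphere c r" "X \<noteq> q" for X
  proof -
    show "norm (chart c q X) = 1" using that(1) assms(1,2) unfolding norm_chart by simp
    show "chart c q X \<noteq> 1" using chart_inj[OF qc, of X q] chart_base[OF qc] that(2) by auto
  qed
  have "1 / (1 - chart c q P) = 1 / (1 - chart c q Q)"
    using half[OF unit[OF assms(3,5)]] half[OF unit[OF assms(4,6)]] eq
    unfolding position_def by (intro complex_eqI) simp_all
  then have "chart c q P = chart c q Q" by (simp add: divide_inverse)
  then show ?thesis by (rule chart_inj[OF qc])
qed

lemma interleaving_edges_cross:
  assumes drawing: "circle_drawing c r p g W F" and q: "q \<in> sphere c r" "q \<notin> p ` W"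
    and edges: "{x, y} \<in> F" "{x', y'} \<in> F" "{x, y, x', y'} \<subseteq> W"
    and order: "position c q (p x) < position c q (p x')" "position c q (p x') < position c q (p y)"
      "position c q (p y) < position c q (p y')"
  shows "path_image (g {x, y}) \<inter> path_image (g {x', y'}) \<noteq> {}"
proof -
  have D: "r > 0" "p ` W \<subseteq> sphere c r" using drawing unfolding circle_drawing_def by auto
  have gs: "arc (g e)" "{pathstart (g e), pathfinish (g e)} = p ` e" "path_image (g e) \<subseteq> cball c r"
    if "e \<in> F" for e
    using drawing that unfolding circle_drawing_def by auto
  have qc: "q \<noteq> c" and dq: "dist c q = r" using D(1) q(1) by auto
  let ?\<zeta> = "chart c q"
  \<comment> \<open>A drawing does not fix the direction of an arc, so it may have to be
    reversed.\<close>
  have oriented: "\<exists>\<gamma>. path \<gamma> \<and> path_image \<gamma> = path_image (g {a, b}) \<and> pathstart \<gamma> = p a \<and> pathfinish \<gamma> = p b"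
    if "{a, b} \<in> F" for a b
  proof -
    have "{pathstart (g {a, b}), pathfinish (g {a, b})} = {p a, p b}" "path (g {a, b})"
      using gs(2)[OF that] arc_imp_path[OF gs(1)[OF that]] by auto
    then have "pathstart (g {a, b}) = p a \<and> pathfinish (g {a, b}) = p b \<or>
        pathstart (reversepath (g {a, b})) = p a \<and> pathfinish (reversepath (g {a, b})) = p b"
      by (auto simp: doubleton_eq_iff)
    then show ?thesis using \<open>path (g {a, b})\<close> path_image_reversepath path_reversepath by metis
  qed
  obtain \<gamma> where \<gamma>: "path \<gamma>" "path_image \<gamma> = path_image (g {x, y})" "pathstart \<gamma> = p x" "pathfinish \<gamma> = p y"
    using oriented[OF edges(1)] by blast
  obtain \<delta> where \<delta>: "path \<delta>" "path_image \<delta> = path_image (g {x', y'})" "pathstart \<delta> = p x'" "pathfinish \<delta> = p y'"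
    using oriented[OF edges(2)] by blast
  have unit: "norm (?\<zeta> (p w)) = 1" "?\<zeta> (p w) \<noteq> 1" if "w \<in> W" for w
  proof -
    have w: "p w \<in> sphere c r" "p w \<noteq> q" using that D(2) q(2) by auto
    then show "norm (?\<zeta> (p w)) = 1" using D(1) dq unfolding norm_chart by simp
    show "?\<zeta> (p w) \<noteq> 1" using chart_inj[OF qc, of "p w" q] chart_base[OF qc] w(2) by auto
  qed
  have disk: "?\<zeta> ` path_image (g e) \<subseteq> cball 0 1" if "e \<in> F" for e
    using gs(3)[OF that] D(1) dq by (auto simp: norm_chart)
  have W: "x \<in> W" "y \<in> W" "x' \<in> W" "y' \<in> W" using edges(3) by auto
  have "path_image (?\<zeta> \<circ> \<gamma>) \<inter> path_image (?\<zeta> \<circ> \<delta>) \<noteq> {}"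
  proof (rule alternating_paths_meet)
    show "path (?\<zeta> \<circ> \<gamma>)" "path (?\<zeta> \<circ> \<delta>)" using path_continuous_image[OF \<gamma>(1) continuous_on_chart[OF qc]]
        path_continuous_image[OF \<delta>(1) continuous_on_chart[OF qc]] by blast+
    show "path_image (?\<zeta> \<circ> \<gamma>) \<subseteq> cball 0 1" "path_image (?\<zeta> \<circ> \<delta>) \<subseteq> cball 0 1"
      unfolding path_image_compose \<gamma>(2) \<delta>(2) using disk edges(1,2) by blast+
  qed (use \<gamma>(3,4) \<delta>(3,4) unit W order in \<open>auto simp: pathstart_compose pathfinish_compose position_def\<close>)
  then obtain P Q where PQ: "P \<in> path_image \<gamma>" "Q \<in> path_image \<delta>" "?\<zeta> P = ?\<zeta> Q"
    unfolding path_image_compose by auto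
  then have "P = Q" using chart_inj[OF qc] by blast
  then show ?thesis using PQ \<gamma>(2) \<delta>(2) by blast
qed

text \<open>A finite connected set has at most one point, but a circle contains antipodal points.
  The lemma provides a centre of projection that is not a vertex.\<close>

lemma infinite_circle:
  fixes c :: "real^2"
  assumes "r > 0"
  shows "infinite (sphere c r)"
proof
  assume "finite (sphere c r)"
  moreover have "connected (sphere c r)" by (rule connected_sphere) simp
  moreover have "c + r *\<^sub>R axis 1 1 \<in> sphere c r" "c - r *\<^sub>R axis 1 1 \<in> sphere c r"
    using assms by (simp_all add: dist_norm norm_axis_1)
  ultimately have "c + r *\<^sub>R axis 1 1 = c - r *\<^sub>R axis 1 1"
    using connected_finite_iff_sing by (metis empty_iff singletonD)
  then have "(c + r *\<^sub>R axis 1 1) $ 1 = (c - r *\<^sub>R axis 1 1) $ 1" by (rule arg_cong)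
  then show False using assms by (simp add: axis_def)
qed

lemma thin_layout_if_drawing:
  assumes G: "simple_graph W F" and drawing: "circle_drawing c r p g W F"
    and few: "\<forall>e\<in>F. card {f \<in> F. crosses p g e f} \<le> 1"
  shows "thin_layout W F"
proof -
  have D: "r > 0" "p ` W \<subseteq> sphere c r" "inj_on p W"
    using drawing unfolding circle_drawing_def by auto
  have "finite (p ` W)" using G unfolding simple_graph_def by blast
  then have "\<not> sphere c r \<subseteq> p ` W" using infinite_circle[OF D(1)] finite_subset by blast
  then obtain q where q: "q \<in> sphere c r" "q \<notin> p ` W" by blast
  define f where "f v = position c q (p v)" for v
  have F: "e \<subseteq> W" "card e = 2" if "e \<in> F" for e using G that unfolding simple_graph_def by auto
  have inj: "inj_on f W"
  proof (rule inj_onI)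
    fix v w assume vw: "v \<in> W" "w \<in> W" "f v = f w"
    then have "p v = p w"
      using position_inj[OF D(1) q(1), of "p v" "p w"] D(2) q(2) unfolding f_def by blast
    then show "v = w" using D(3) vw(1,2) unfolding inj_on_def by blast
  qed
  have cross: "crosses p g e e'" if e: "e \<in> F" "e' \<in> F" "interleave (f ` e) (f ` e')" for e e'
  proof -
    \<comment> \<open>Interleaving edges share no end, so every common point of their arcs counts as
      a crossing.\<close>
    have ne: "e \<inter> e' = {}" using interleave_disjoint[OF e(3)] by blast
    have preimage: "\<exists>x y. e = {x, y} \<and> f x = a \<and> f y = b" if im: "e \<in> F" "f ` e = {a, b}" for e a b
    proof -
      obtain x y where "e = {x, y}" using F(2)[OF im(1)] by (meson card_2_iff)
      then have "f x = a \<and> f y = b \<or> f y = a \<and> f x = b" using im(2) by (auto simp: doubleton_eq_iff)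
      then show ?thesis using \<open>e = {x, y}\<close> by (metis insert_commute)
    qed
    obtain a b c' d where o: "a < b" "b < c'" "c' < d"
      and "f ` e = {a, c'} \<and> f ` e' = {b, d} \<or> f ` e = {b, d} \<and> f ` e' = {a, c'}"
      using e(3) unfolding interleave_def by blast
    then consider "f ` e = {a, c'}" "f ` e' = {b, d}" | "f ` e = {b, d}" "f ` e' = {a, c'}" by blast
    then have "path_image (g e) \<inter> path_image (g e') \<noteq> {}"
    proof cases
      case 1
      obtain x y x' y' where "e = {x, y}" "f x = a" "f y = c'" "e' = {x', y'}" "f x' = b" "f y' = d"
        using preimage[OF e(1) 1(1)] preimage[OF e(2) 1(2)] by blast
      then show ?thesis
        using interleaving_edges_cross[OF drawing q, of x y x' y'] e(1,2) F(1) o unfolding f_def by auto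
    next
      case 2
      obtain x y x' y' where "e' = {x, y}" "f x = a" "f y = c'" "e = {x', y'}" "f x' = b" "f y' = d"
        using preimage[OF e(1) 2(1)] preimage[OF e(2) 2(2)] by blast
      then have "path_image (g e') \<inter> path_image (g e) \<noteq> {}"
        using interleaving_edges_cross[OF drawing q, of x y x' y'] e(1,2) F(1) o unfolding f_def by auto
      then show ?thesis by blast
    qed
    moreover have "e \<noteq> e'" using ne F(2)[OF e(1)] by auto
    ultimately show ?thesis unfolding crosses_def ne by simp
  qed
  have "thin ((`) f ` F)"
    unfolding thin_def
  proof (intro ballI impI)
    fix E1 E2 E3 assume h: "E1 \<in> (`) f ` F" "E2 \<in> (`) f ` F" "E3 \<in> (`) f ` F" "interleave E1 E2" "interleave E1 E3"
    then obtain e1 e2 e3 where e: "e1 \<in> F" "e2 \<in> F" "e3 \<in> F" "E1 = f ` e1" "E2 = f ` e2" "E3 = f ` e3" by blast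
    let ?S = "{f \<in> F. crosses p g e1 f}"
    have "e2 \<in> ?S" "e3 \<in> ?S" using cross[OF e(1,2)] cross[OF e(1,3)] h(4,5) e by auto
    moreover have "finite ?S" using finite_edges[OF G] by simp
    moreover have "card ?S \<le> Suc 0" using few e(1) by simp
    ultimately have "e2 = e3" using card_le_Suc0_iff_eq[of ?S] by blast
    then show "E2 = E3" using e by simp
  qed
  then show ?thesis unfolding thin_layout_def using inj by blast
qed

subsection \<open>Chromatic index\<close>

text \<open>Drawings are given for blocks only. Among the two-connected subgraphs containing the
  given one, one with the largest total number of vertices and edges is maximal under
  inclusion.\<close>

lemma two_connected_in_block:
  assumes G: "simple_graph V E" and sub: "subgraph W F V E" "two_connected W F"
  obtains W' F' where "block V E W' F'" "W \<subseteq> W'" "F \<subseteq> F'" "simple_graph W' F'"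
proof -
  define P where "P = (\<lambda>(W', F'). subgraph W' F' V E \<and> two_connected W' F' \<and> W \<subseteq> W' \<and> F \<subseteq> F')"
  have fin: "finite V" "finite E" using G finite_edges unfolding simple_graph_def by blast+
  have start: "P (W, F)" unfolding P_def using sub by simp
  have bound: "\<forall>H. P H \<longrightarrow> card (fst H) + card (snd H) < card V + card E + 1"
  proof (intro allI impI)
    fix H assume "P H"
    then have "fst H \<subseteq> V" "snd H \<subseteq> E" unfolding P_def subgraph_def by (auto split: prod.splits)
    then have "card (fst H) \<le> card V" "card (snd H) \<le> card E" using card_mono fin by auto
    then show "card (fst H) + card (snd H) < card V + card E + 1" by linarith
  qed
  obtain H where H: "P H" "\<And>H'. P H' \<Longrightarrow> card (fst H') + card (snd H') \<le> card (fst H) + card (snd H)"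
    using ex_has_greatest_nat[of P "(W, F)" "\<lambda>H. card (fst H) + card (snd H)", OF start bound] by blast
  obtain W' F' where WF: "H = (W', F')" by (cases H)
  have W'F': "subgraph W' F' V E" "two_connected W' F'" "W \<subseteq> W'" "F \<subseteq> F'"
    using H(1) unfolding P_def WF by auto
  have "W'' = W' \<and> F'' = F'"
    if "subgraph W'' F'' V E" "two_connected W'' F''" "W' \<subseteq> W''" "F' \<subseteq> F''" for W'' F''
  proof -
    have "P (W'', F'')" unfolding P_def using that W'F' by auto
    then have le: "card W'' + card F'' \<le> card W' + card F'" using H(2)[of "(W'', F'')"] WF by simp
    have fin'': "finite W''" "finite F''"
      using that(1) fin finite_subset unfolding subgraph_def by blast+
    then have "card W' \<le> card W''" "card F' \<le> card F''" using that(3,4) card_mono by blast+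
    then have "card W'' \<le> card W'" "card F'' \<le> card F'" using le by linarith+
    then show ?thesis using card_seteq[OF fin''(1) that(3)] card_seteq[OF fin''(2) that(4)] by simp
  qed
  then have "block V E W' F'" unfolding block_def using W'F' by blast
  then show ?thesis using that W'F' unfolding subgraph_def by blast
qed

lemma pseudo_outerplanar_colourable:
  assumes G: "simple_graph V E" "pseudo_outerplanar V E" and "max_degree V E \<le> k" "4 \<le> k"
  shows "colourable k E"
proof (rule colourable_by_blocks[OF G(1) _ \<open>4 \<le> k\<close>])
  have fin: "finite V" "finite E" and E: "e \<subseteq> V" if "e \<in> E" for e
    using G(1) finite_edges that unfolding simple_graph_def by blast+
  show "vdegree E w \<le> k" for w
  proof (cases "w \<in> V")
    case True
    have "finite V" using G(1) unfolding simple_graph_def by blast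
    then have "vdegree E w \<le> max_degree V E" unfolding max_degree_def using True by (intro Max_ge) auto
    then show ?thesis using assms(3) by linarith
  next
    case False
    then have "{e \<in> E. w \<in> e} = {}" using E by blast
    then have "vdegree E w = card ({} :: 'a set set)" unfolding vdegree_def by (rule arg_cong)
    then show ?thesis by simp
  qed
  show "thin_layout W F" if sub: "subgraph W F V E" "two_connected W F" for W F
  proof -
    obtain W' F' where W': "block V E W' F'" "W \<subseteq> W'" "F \<subseteq> F'" "simple_graph W' F'"
      using two_connected_in_block[OF G(1) sub] .
    then obtain c r p g where "circle_drawing c r p g W' F'" "\<forall>e\<in>F'. card {f \<in> F'. crosses p g e f} \<le> 1"
      using G(2) unfolding pseudo_outerplanar_def by blast
    then show ?thesis using thin_layout_if_drawing[OF W'(4)] thin_layout_subset W'(2,3) by blast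
  qed
qed

definition matching_partition :: "'a set set \<Rightarrow> 'a set set set \<Rightarrow> bool" where
  "matching_partition E P \<longleftrightarrow> partition_on E P \<and> finite P \<and> (\<forall>M\<in>P. matching E M)"

lemma matching_partition_if_colourable:
  assumes "colourable k E"
  obtains P where "matching_partition E P" "card P \<le> k"
proof -
  obtain c where c: "proper_colouring k E c" using assms unfolding colourable_def by blast
  define P where "P = (\<lambda>i. {e \<in> E. c e = i}) ` {..<k} - {{}}"
  have "card P \<le> card ((\<lambda>i. {e \<in> E. c e = i}) ` {..<k})" unfolding P_def by (intro card_mono) auto
  also have "\<dots> \<le> k" using card_image_le[of "{..<k}"] by simp
  finally have "card P \<le> k" .
  moreover have "partition_on E P"
    unfolding partition_on_def
  proof (intro conjI)
    show "\<Union>P = E" unfolding P_def using proper_colouringD(1)[OF c] by auto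
    show "disjoint P" unfolding P_def disjoint_def by auto
    show "{} \<notin> P" unfolding P_def by simp
  qed
  moreover have "matching E M" if M: "M \<in> P" for M
  proof -
    obtain i where i: "M = {e \<in> E. c e = i}" using M unfolding P_def by blast
    have "e \<inter> f = {}" if "e \<in> M" "f \<in> M" "e \<noteq> f" for e f
      using proper_colouringD(2)[OF c, of e f] that unfolding i by auto
    then show ?thesis unfolding matching_def disjoint_def using i by blast
  qed
  moreover have "finite P" unfolding P_def by simp
  ultimately show ?thesis using that unfolding matching_partition_def by blast
qed

text \<open>Two edges at \<open>v\<close> meet, so no matching contains both; sending each edge to
  its matching is therefore injective on the edges at \<open>v\<close>.\<close>

lemma vdegree_le_matching_partition:
  assumes "matching_partition E P"
  shows "vdegree E v \<le> card P"
proof -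
  have P: "\<Union>P = E" "finite P" and M: "\<And>M. M \<in> P \<Longrightarrow> disjoint M"
    using assms unfolding matching_partition_def partition_on_def matching_def by auto
  have "\<exists>M. M \<in> P \<and> e \<in> M" if "e \<in> E" for e using that P(1) by blast
  then obtain h where h: "h e \<in> P \<and> e \<in> h e" if "e \<in> E" for e by metis
  have "inj_on h {e \<in> E. v \<in> e}"
  proof (rule inj_onI)
    fix e f assume ef: "e \<in> {e \<in> E. v \<in> e}" "f \<in> {e \<in> E. v \<in> e}" "h e = h f"
    then have "e \<in> h e" "f \<in> h e" "h e \<in> P" using h[of e] h[of f] by auto
    then show "e = f" using M[of "h e"] ef unfolding disjoint_def by blast
  qed
  moreover have "h ` {e \<in> E. v \<in> e} \<subseteq> P" using h by blast
  ultimately show ?thesis unfolding vdegree_def using card_inj_on_le P(2) by blast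
qed

theorem theorem5p3:
  fixes V :: "'a set" and E :: "'a set set"
  assumes "simple_graph V E"
    and "pseudo_outerplanar V E"
    and "max_degree V E \<ge> 4"
  shows "chromatic_index E = max_degree V E"
proof -
  have "finite V" using assms(1) unfolding simple_graph_def by blast
  then have "max_degree V E \<in> insert 0 (vdegree E ` V)" unfolding max_degree_def by (intro Max_in) auto
  \<comment> \<open>A maximum degree of at least 4 is not the inserted \<open>0\<close>, so some
    vertex attains it.\<close>
  then obtain v where v: "vdegree E v = max_degree V E" using assms(3) by auto
  have lower: "max_degree V E \<le> card P" if "matching_partition E P" for P
    using vdegree_le_matching_partition[OF that, of v] v by simp
  obtain P where P: "matching_partition E P" "card P \<le> max_degree V E"
    using matching_partition_if_colourable[OF pseudo_outerplanar_colourable[OF assms(1,2) order.refl assms(3)]] .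
  show ?thesis
    unfolding chromatic_index_def
  proof (rule Least_equality)
    show "\<exists>P. partition_on E P \<and> finite P \<and> card P = max_degree V E \<and> (\<forall>M\<in>P. matching E M)"
      using P lower[OF P(1)] unfolding matching_partition_def by (intro exI[of _ P]) auto
    show "max_degree V E \<le> k"
      if "\<exists>P. partition_on E P \<and> finite P \<and> card P = k \<and> (\<forall>M\<in>P. matching E M)" for k
      using that lower unfolding matching_partition_def by blast
  qed
qed

end
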